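(* Let $u_1,\ldots,u_p\in\mathcal{U}$ be pairwise different, let $X_l=D_lY(u_l)D_{l+1}$ for $1\le l\le p$, let $B=X_1X_2\cdots X_p$, and let $\mu$ be the asymptotic distribution of $BB^*$ under $\tau_1$, with moments $m_k=\lim_{n\to\infty}\tau_1((BB^* )^k)$. Then the moment generating function $\psi_\mu(z)=\sum_{k\ge1}m_kz^k$ is the unique solution (as a formal power series) of the equation $$d_1\psi_\mu=R_{\widetilde\nu}\big(z(d_1\psi_\mu+d_1)(d_1\psi_\mu+d_2)\cdots(d_1\psi_\mu+d_{p+1})\big),$$ where $\widetilde\nu=\widetilde\nu_1\boxtimes\ldots\boxtimes\widetilde\nu_p$ and $\widetilde\nu_j$ is the distribution defined by the even free cumulants of $\nu_j$, the asymptotic distribution of $Y(u_j)$, for $1\le j\le p$.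
   Context: **Random matrices.** Fix $p\in\mathbb{N}$. For each $n$ let $n=n_1+\ldots+n_{p+1}$ with natural numbers $n_j$ depending on $n$, such that $d_j=\lim_{n\to\infty}n_j/n>0$ exists for $1\le j\le p+1$. Let $D_j$ be the $n\times n$ diagonal matrix whose only nonzero entries are $(D_j)_{i,i}=1$ for $n_1+\ldots+n_{j-1}<i\le n_1+\ldots+n_j$. Let $\mathbb{E}$ be classical expectation, $\tau(A)=\frac1n\mathbb{E}(\mathrm{Tr}(A))$ for $n\times n$ random matrices, and $\tau_j(A)=\frac1{n_j}\mathbb{E}(\mathrm{Tr}(D_jA))$ the normalized partial traces. Let $\{Y(u):u\in\mathcal{U}\}$ be a family of independent Hermitian $n\times n$ random matrices (dependence on $n$ is suppressed) such that: (A1) the family is asymptotically free under $\tau$; (A2) the family is asymptotically free under $\tau$ against the family of deterministic diagonal matrices; (A3) the norms of the matrices $Y(u)$ are uniformly bounded almost surely. Let $\nu_j$ be the limit distribution of $Y(u_j)$ under $\tau$. **Distributions.** A distribution is a moment sequence (a unital linear functional on $\mathbb{C}[x]$), not necessarily coming from a measure. The combinatorial $R$-series of a distribution with free cumulants $(\kappa_n)$ is the formal power series $R(z)=\sum_{n\ge1}\kappa_nz^n$. If $\nu$ has free cumulants $(r_n)$, then $\widetilde\nu$ is the distribution with $R_{\widetilde\nu}(z)=\sum_{n=1}^\infty r_{2n}z^n$, i.e. whose $n$-th free cumulant is $r_{2n}$. $\boxtimes$ is free multiplicative convolution of distributions. *)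

theory Defs
  imports
    "HOL-Probability.Probability"
    "HOL-Library.Poly_Mapping"
    "HOL-Library.Disjoint_Sets"
    "HOL-Computational_Algebra.Formal_Power_Series"
    "Jordan_Normal_Form.Schur_Decomposition"
begin

section \<open>Free cumulants\<close>

text \<open>A distribution, i.e. a unital linear functional on the complex polynomials in one variable,
  is represented by its moment sequence \<open>m :: nat \<Rightarrow> complex\<close> with \<open>m 0 = 1\<close>.\<close>

definition noncrossing :: "nat set set \<Rightarrow> bool" where
  "noncrossing \<pi> \<longleftrightarrow> (\<forall>V\<in>\<pi>. \<forall>W\<in>\<pi>. \<forall>a\<in>V. \<forall>b\<in>W. \<forall>c\<in>V. \<forall>d\<in>W. a < b \<and> b < c \<and> c < d \<longrightarrow> V = W)"

definition NC :: "nat \<Rightarrow> nat set set set" where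
  "NC n = {\<pi>. partition_on {1..n} \<pi> \<and> noncrossing \<pi>}"

lemma NC_block_less:
  assumes "\<pi> \<in> NC n" "\<pi> \<noteq> {{1..n}}" "V \<in> \<pi>"
  shows "card V < n"
proof -
  have part: "partition_on {1..n} \<pi>" using assms(1) by (simp add: NC_def)
  have sub: "V \<subseteq> {1..n}" using partition_onD1[OF part] assms(3) by blast
  have "V \<noteq> {1..n}"
  proof
    assume V: "V = {1..n}"
    have "W = V" if "W \<in> \<pi>" for W
    proof (rule ccontr)
      assume "W \<noteq> V"
      with partition_onD2[OF part] that assms(3) have "W \<inter> V = {}"
        by (auto simp: disjoint_def)
      moreover have "W \<subseteq> {1..n}" using partition_onD1[OF part] that by blast
      ultimately have "W = {}" using V by blast
      with partition_onD3[OF part] that show False by simp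
    qed
    with assms(3) V have "\<pi> = {{1..n}}" by auto
    with assms(2) show False ..
  qed
  with sub have "card V < card {1..n}" by (intro psubset_card_mono) auto
  thus ?thesis by simp
qed

definition moments_of_cumulants :: "(nat \<Rightarrow> complex) \<Rightarrow> nat \<Rightarrow> complex" where
  "moments_of_cumulants \<kappa> n = (\<Sum>\<pi>\<in>NC n. \<Prod>V\<in>\<pi>. \<kappa> (card V))"

text \<open>The free moment-cumulant formula, solved for the cumulant of the one-block partition; see
  \<open>moments_of_free_cumulant\<close> below. The value at \<open>0\<close> carries no meaning.\<close>

function free_cumulant :: "(nat \<Rightarrow> complex) \<Rightarrow> nat \<Rightarrow> complex" where
  "free_cumulant m n =
     m n - (\<Sum>\<pi>\<in>{\<pi> \<in> NC n. \<pi> \<noteq> {{1..n}}}. \<Prod>V\<in>\<pi>. free_cumulant m (card V))"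
  by pat_completeness auto
termination
  by (relation "Wellfounded.measure snd") (auto intro: NC_block_less)

declare free_cumulant.simps [simp del]

lemma finite_NC [simp]: "finite (NC n)"
  by (rule finite_subset[of _ "Pow (Pow {1..n})"]) (auto simp: NC_def partition_on_def)

lemma moments_of_free_cumulant:
  assumes "m 0 = 1"
  shows "moments_of_cumulants (free_cumulant m) = m"
proof
  fix n
  show "moments_of_cumulants (free_cumulant m) n = m n"
  proof (cases "n = 0")
    case True
    have "NC 0 = {{}}"
      by (auto simp: NC_def partition_on_def noncrossing_def disjoint_def)
    with True assms show ?thesis by (simp add: moments_of_cumulants_def)
  next
    case False
    hence one: "{{1..n}} \<in> NC n"
      by (auto simp: NC_def noncrossing_def intro!: partition_on_space)
    have "NC n = insert {{1..n}} {\<pi> \<in> NC n. \<pi> \<noteq> {{1..n}}}"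
      using one by auto
    hence "moments_of_cumulants (free_cumulant m) n =
        (\<Sum>\<pi>\<in>insert {{1..n}} {\<pi> \<in> NC n. \<pi> \<noteq> {{1..n}}}. \<Prod>V\<in>\<pi>. free_cumulant m (card V))"
      unfolding moments_of_cumulants_def by simp
    also have "\<dots> = free_cumulant m n +
        (\<Sum>\<pi>\<in>{\<pi> \<in> NC n. \<pi> \<noteq> {{1..n}}}. \<Prod>V\<in>\<pi>. free_cumulant m (card V))"
      by (subst sum.insert) auto
    also have "\<dots> = m n" by (subst free_cumulant.simps) simp
    finally show ?thesis .
  qed
qed

definition R_series :: "(nat \<Rightarrow> complex) \<Rightarrow> complex fps" where
  "R_series m = Abs_fps (\<lambda>n. if n = 0 then 0 else free_cumulant m n)"

definition moment_gf :: "(nat \<Rightarrow> complex) \<Rightarrow> complex fps" where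
  "moment_gf m = Abs_fps (\<lambda>n. if n = 0 then 0 else m n)"

text \<open>The distribution whose \<open>n\<close>-th free cumulant is the \<open>2n\<close>-th free cumulant of \<open>m\<close>.\<close>

definition even_cumulant_dist :: "(nat \<Rightarrow> complex) \<Rightarrow> nat \<Rightarrow> complex" where
  "even_cumulant_dist m = moments_of_cumulants (\<lambda>n. free_cumulant m (2 * n))"


section \<open>Joint distributions, freeness and free multiplicative convolution\<close>

text \<open>With concatenation of words as addition, the ring \<open>'g list \<Rightarrow>\<^sub>0 complex\<close> is the unital free
  algebra of noncommutative polynomials in indeterminates \<open>x\<^sub>g\<close>, \<open>g :: 'g\<close>.\<close>

instantiation list :: (type) monoid_add
begin

definition zero_list :: "'a list" where "zero_list = []"
definition plus_list :: "'a list \<Rightarrow> 'a list \<Rightarrow> 'a list" where "plus_list = (@)"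

instance by standard (simp_all add: zero_list_def plus_list_def)

end

type_synonym 'g ncpoly = "'g list \<Rightarrow>\<^sub>0 complex"

text \<open>A joint distribution is a unital linear functional on the free algebra. It is given by its
  values \<open>\<phi> w\<close> on words (the mixed moments) and extended linearly by \<open>dist_eval\<close>.\<close>

definition dist_eval :: "('g list \<Rightarrow> complex) \<Rightarrow> 'g ncpoly \<Rightarrow> complex" where
  "dist_eval \<phi> f = (\<Sum>w\<in>Poly_Mapping.keys f. Poly_Mapping.lookup f w * \<phi> w)"

text \<open>Freeness with respect to \<open>\<phi>\<close> of the families \<open>{x\<^sub>g : g \<in> G i}\<close>, \<open>i :: 'i\<close>: alternating products
  of centered elements of the unital subalgebras generated by these families are centered.\<close>

definition free_families :: "('g list \<Rightarrow> complex) \<Rightarrow> ('i \<Rightarrow> 'g set) \<Rightarrow> bool" where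
  "free_families \<phi> G \<longleftrightarrow>
     (\<forall>ts :: ('i \<times> 'g ncpoly) list.
        ts \<noteq> [] \<and> distinct_adj (map fst ts) \<and>
        (\<forall>(i, f)\<in>set ts. Poly_Mapping.keys f \<subseteq> lists (G i) \<and> dist_eval \<phi> f = 0)
        \<longrightarrow> dist_eval \<phi> (prod_list (map snd ts)) = 0)"

text \<open>The distribution of \<open>ab\<close>, where \<open>a\<close> and \<open>b\<close> are free with distributions \<open>\<mu>\<close> and \<open>\<nu>\<close>. The
  indeterminates indexed by \<open>True\<close> and \<open>False\<close> play the roles of \<open>a\<close> and \<open>b\<close>, and \<open>\<phi>\<close> is their joint
  distribution (the free product of \<open>\<mu>\<close> and \<open>\<nu>\<close>, which exists and is unique).\<close>

definition free_mult_conv :: "(nat \<Rightarrow> complex) \<Rightarrow> (nat \<Rightarrow> complex) \<Rightarrow> nat \<Rightarrow> complex"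
    (infixr "\<boxtimes>" 70) where
  "\<mu> \<boxtimes> \<nu> = (THE \<rho>. \<exists>\<phi> :: bool list \<Rightarrow> complex.
      \<phi> [] = 1 \<and> free_families \<phi> (\<lambda>b :: bool. {b}) \<and>
      (\<forall>k. \<phi> (replicate k True) = \<mu> k) \<and> (\<forall>k. \<phi> (replicate k False) = \<nu> k) \<and>
      (\<forall>k. \<rho> k = \<phi> (concat (replicate k [True, False]))))"

fun free_mult_conv_list :: "(nat \<Rightarrow> complex) list \<Rightarrow> nat \<Rightarrow> complex" where
  "free_mult_conv_list [] = (\<lambda>k. 1)"
| "free_mult_conv_list [\<mu>] = \<mu>"
| "free_mult_conv_list (\<mu> # \<nu> # ms) = \<mu> \<boxtimes> free_mult_conv_list (\<nu> # ms)"


section \<open>Random matrices\<close>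

definition mat_trace :: "complex mat \<Rightarrow> complex" where
  "mat_trace A = (\<Sum>i<dim_row A. A $$ (i, i))"

definition hermitian_mat :: "complex mat \<Rightarrow> bool" where
  "hermitian_mat A \<longleftrightarrow> mat_adjoint A = A"

definition vec_l2_norm :: "complex vec \<Rightarrow> real" where
  "vec_l2_norm v = sqrt (\<Sum>i<dim_vec v. (cmod (vec_index v i))\<^sup>2)"

definition mat_op_norm :: "complex mat \<Rightarrow> real" where
  "mat_op_norm A = (SUP v\<in>{v \<in> carrier_vec (dim_col A). vec_l2_norm v \<le> 1}. vec_l2_norm (A *\<^sub>v v))"

definition mat_prod_list :: "nat \<Rightarrow> complex mat list \<Rightarrow> complex mat" where
  "mat_prod_list n As = foldr (*) As (1\<^sub>m n)"

text \<open>The array of the \<open>n\<^sup>2\<close> entries of a matrix, as an element of the product space; it turns a random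
  matrix into a random variable with values in \<open>mat_space n\<close>.\<close>

definition mat_entries :: "nat \<Rightarrow> complex mat \<Rightarrow> nat \<times> nat \<Rightarrow> complex" where
  "mat_entries n A = restrict (\<lambda>ij. A $$ ij) ({..<n} \<times> {..<n})"

definition mat_space :: "nat \<Rightarrow> (nat \<times> nat \<Rightarrow> complex) measure" where
  "mat_space n = (\<Pi>\<^sub>M ij\<in>{..<n} \<times> {..<n}. borel)"

definition random_matrix :: "'w measure \<Rightarrow> nat \<Rightarrow> ('w \<Rightarrow> complex mat) \<Rightarrow> bool" where
  "random_matrix M n A \<longleftrightarrow>
     (\<forall>\<omega>\<in>space M. A \<omega> \<in> carrier_mat n n) \<and> (\<lambda>\<omega>. mat_entries n (A \<omega>)) \<in> measurable M (mat_space n)"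

definition tau :: "'w measure \<Rightarrow> nat \<Rightarrow> ('w \<Rightarrow> complex mat) \<Rightarrow> complex" where
  "tau M n A = (1 / of_nat n) * (\<integral>\<omega>. mat_trace (A \<omega>) \<partial>M)"

text \<open>For \<open>n = s 1 + s 2 + \<dots>\<close>, the diagonal projection onto the \<open>j\<close>-th block of \<open>s j\<close> coordinates
  (\<open>j \<ge> 1\<close>); the rows and columns of a matrix are numbered from \<open>0\<close>.\<close>

definition block_proj :: "nat \<Rightarrow> (nat \<Rightarrow> nat) \<Rightarrow> nat \<Rightarrow> complex mat" where
  "block_proj n s j =
     mat n n (\<lambda>(i, k). if i = k \<and> (\<Sum>l\<in>{1..<j}. s l) \<le> i \<and> i < (\<Sum>l\<in>{1..j}. s l) then 1 else 0)"

definition partial_tau ::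
  "'w measure \<Rightarrow> nat \<Rightarrow> (nat \<Rightarrow> nat) \<Rightarrow> nat \<Rightarrow> ('w \<Rightarrow> complex mat) \<Rightarrow> complex" where
  "partial_tau M n s j A = (1 / of_nat (s j)) * (\<integral>\<omega>. mat_trace (block_proj n s j * A \<omega>) \<partial>M)"

text \<open>\<open>X\<^sub>1 X\<^sub>2 \<cdots> X\<^sub>p\<close> with \<open>X\<^sub>l = D\<^sub>l Z\<^sub>l D\<^sub>l\<^sub>+\<^sub>1\<close>.\<close>

definition block_product ::
  "nat \<Rightarrow> (nat \<Rightarrow> nat) \<Rightarrow> nat \<Rightarrow> (nat \<Rightarrow> complex mat) \<Rightarrow> complex mat" where
  "block_product n s p Z =
     mat_prod_list n (map (\<lambda>l. block_proj n s l * Z l * block_proj n s (l + 1)) [1..<p + 1])"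

text \<open>In the following a family of random matrices is a map \<open>X :: 'g \<Rightarrow> nat \<Rightarrow> 'w \<Rightarrow> complex mat\<close>,
  where \<open>X g n\<close> is an \<open>n \<times> n\<close> random matrix on the probability space \<open>M n\<close>.\<close>

definition limit_distribution ::
  "(nat \<Rightarrow> 'w measure) \<Rightarrow> ('g \<Rightarrow> nat \<Rightarrow> 'w \<Rightarrow> complex mat) \<Rightarrow> ('g list \<Rightarrow> complex) \<Rightarrow> bool" where
  "limit_distribution M X \<phi> \<longleftrightarrow>
     (\<forall>w. (\<lambda>n. tau (M n) n (\<lambda>\<omega>. mat_prod_list n (map (\<lambda>g. X g n \<omega>) w))) \<longlonglongrightarrow> \<phi> w)"

definition asymptotically_free ::
  "(nat \<Rightarrow> 'w measure) \<Rightarrow> ('g \<Rightarrow> nat \<Rightarrow> 'w \<Rightarrow> complex mat) \<Rightarrow> ('i \<Rightarrow> 'g set) \<Rightarrow> bool" where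
  "asymptotically_free M X G \<longleftrightarrow> (\<exists>\<phi>. limit_distribution M X \<phi> \<and> free_families \<phi> G)"

text \<open>The sets \<open>{Y u : u}\<close> and \<open>{\<Delta> i : i}\<close> are asymptotically free whenever the \<open>\<Delta> i\<close> are
  deterministic diagonal matrices, bounded in norm, which have a joint limit distribution. (Freeness
  involves finitely many variables at a time, so countable families suffice.)\<close>

definition asymptotically_free_from_diagonal ::
  "(nat \<Rightarrow> 'w measure) \<Rightarrow> ('u \<Rightarrow> nat \<Rightarrow> 'w \<Rightarrow> complex mat) \<Rightarrow> bool" where
  "asymptotically_free_from_diagonal M Y \<longleftrightarrow>
     (\<forall>\<Delta> :: nat \<Rightarrow> nat \<Rightarrow> complex mat.
        (\<forall>i n. \<Delta> i n \<in> carrier_mat n n \<and> diagonal_mat (\<Delta> i n)) \<and>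
        (\<forall>i. \<exists>C. \<forall>n. mat_op_norm (\<Delta> i n) \<le> C) \<and>
        (\<exists>\<delta>. limit_distribution M (\<lambda>i n \<omega>. \<Delta> i n) \<delta>)
        \<longrightarrow> asymptotically_free M
              (\<lambda>g n \<omega>. case g of Inl u \<Rightarrow> Y u n \<omega> | Inr i \<Rightarrow> \<Delta> i n)
              (\<lambda>b :: bool. if b then range Inl else range Inr))"

end

theory Submission
  imports Defs
begin

text \<open>Only the limit \<open>\<phi>\<close> of the joint moments of the matrices \<open>Y u\<close> and of the projections \<open>D\<^sub>j\<close> matters. It is
a trace under which the \<open>Y u\<close> are free from one another and from the \<open>D\<^sub>j\<close>, and in which
\<open>D\<^sub>i D\<^sub>j = 0\<close> for \<open>i \<noteq> j\<close>, \<open>D\<^sub>j D\<^sub>j = D\<^sub>j\<close> and \<open>\<phi>(D\<^sub>j) = d\<^sub>j\<close>. The number \<open>d\<^sub>1 m\<^sub>k\<close> is the value of \<open>\<phi>\<close> at a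
word that climbs \<open>k\<close> times from level \<open>1\<close> to level \<open>p + 1\<close> and back: between the levels \<open>l\<close> and
\<open>l + 1\<close> it reads \<open>Y\<^sub>l\<close>, and at level \<open>j\<close> it reads \<open>D\<^sub>j\<close>.

Such values are computed with the Schwinger-Dyson equation (\<open>schwinger_dyson_free_families\<close>): if \<open>x\<close> is
free from the other variables and has the free cumulants \<open>\<kappa>\<close>, then
\<open>\<phi>(x w) = (\<Sum>r. \<kappa> (r + 1) \<cdot> (\<Sum>w = w\<^sub>0 x w\<^sub>1 x \<dots> x w\<^sub>r. \<phi>(w\<^sub>0) \<cdots> \<phi>(w\<^sub>r)))\<close>. For a single variable this is the
moment-cumulant formula, organised by the block of the first element
(\<open>moments_of_cumulants_Suc\<close>). The passage to free families needs no combinatorics: both sides vanish on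
alternating products of centered elements that involve more than the family of \<open>x\<close>.

In the zigzag word a factor \<open>\<phi>(w\<^sub>i)\<close> vanishes unless \<open>w\<^sub>i\<close> begins and ends at the same level, so the chosen
occurrences of \<open>Y\<^sub>l\<close> are alternately steps up and steps down, and only the even cumulants of
\<open>Y\<^sub>l\<close> contribute. Let \<open>U\<^sub>l\<close> be the generating series of the words that arrive at level \<open>l + 1\<close> from below and
are about to leave it downwards, \<open>L\<^sub>l\<close> that of the words that arrive at level \<open>l\<close> from above and are about to
leave it upwards, and \<open>\<Lambda>\<^sub>j = d\<^sub>j + d\<^sub>1 \<psi>\<close> that of the full turns at level \<open>j\<close>. If \<open>X\<close> counts letters and
\<open>C\<^sub>l(z) = (\<Sum>n. \<kappa>\<^sub>2\<^sub>n\<^sub>+\<^sub>2(Y\<^sub>l) z\<^sup>n)\<close>, then with \<open>s\<^sub>l = X\<^sup>2 U\<^sub>l L\<^sub>l\<close>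
  \<^item> \<open>d\<^sub>1 \<psi> = s\<^sub>l C\<^sub>l(s\<^sub>l)\<close>,
  \<^item> \<open>U\<^sub>l\<^sub>-\<^sub>1 = X\<^sup>2 U\<^sub>l C\<^sub>l(s\<^sub>l) \<Lambda>\<^sub>l\<close> and \<open>L\<^sub>l\<^sub>+\<^sub>1 = X\<^sup>2 L\<^sub>l C\<^sub>l(s\<^sub>l) \<Lambda>\<^sub>l\<^sub>+\<^sub>1\<close>, with the boundary values
    \<open>U\<^sub>p = \<Lambda>\<^sub>p\<^sub>+\<^sub>1\<close> and \<open>L\<^sub>1 = \<Lambda>\<^sub>1\<close>.

The same equation, applied to the words \<open>abab\<dots>\<close> in two free variables, describes the free multiplicative
convolution without any S-transform, hence also when a mean vanishes: writing \<open>C\<^sub>\<mu>(z) = R\<^sub>\<mu>(z) / z\<close>, the system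
\<open>s = y C\<^sub>\<nu>(t)\<close>, \<open>t = y C\<^sub>\<mu>(s)\<close> has exactly one solution and \<open>C(y) = C\<^sub>\<mu>(s) C\<^sub>\<nu>(t)\<close> for the convolution
(\<open>cumulant_series_free_mult_conv\<close>). The equations for \<open>U\<^sub>l\<close>, \<open>L\<^sub>l\<close>, \<open>s\<^sub>l\<close> are an instance of this system for each \<open>l\<close>,
and a downward induction on \<open>l\<close> assembles them into the claimed equation (\<open>loop_series_equation\<close>).
The equation determines its solution because its right-hand side carries a factor \<open>z\<close>.\<close>

unbundle fps_syntax
unbundle no vec_syntax
no_notation Matrix.vec_index (infixl "$" 100)

section \<open>Formal power series\<close>

text \<open>Agreement modulo \<open>X\<^sup>n\<close>. Equations \<open>f = \<Phi>(f)\<close> whose right-hand side gains one order have at most one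
  solution, by induction on \<open>n\<close>.\<close>

definition fps_agree :: "nat \<Rightarrow> 'a::comm_ring_1 fps \<Rightarrow> 'a fps \<Rightarrow> bool" where
  "fps_agree n f g \<longleftrightarrow> (\<forall>k<n. f $ k = g $ k)"

lemma fps_agree_0 [simp]: "fps_agree 0 f g"
  and fps_agree_refl [simp]: "fps_agree n f f"
  by (simp_all add: fps_agree_def)

lemma fps_eqI_agree: "(\<And>n. fps_agree n f g) \<Longrightarrow> f = g"
  by (auto simp: fps_agree_def fps_eq_iff)

lemma fps_agree_add: "fps_agree n f f' \<Longrightarrow> fps_agree n g g' \<Longrightarrow> fps_agree n (f + g) (f' + g')"
  by (simp add: fps_agree_def)

lemma fps_agree_mult: "fps_agree n f f' \<Longrightarrow> fps_agree n g g' \<Longrightarrow> fps_agree n (f * g) (f' * g')"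
  unfolding fps_agree_def fps_mult_nth by (auto intro!: sum.cong)

lemma fps_agree_prod:
  "(\<And>i. i \<in> A \<Longrightarrow> fps_agree n (f i) (g i)) \<Longrightarrow> fps_agree n (prod f A) (prod g A)"
  by (induction A rule: infinite_finite_induct) (auto intro: fps_agree_mult)

lemma fps_agree_power: "fps_agree n f g \<Longrightarrow> fps_agree n (f ^ k) (g ^ k)"
  by (induction k) (auto intro: fps_agree_mult)

lemma fps_agree_compose: "fps_agree n f g \<Longrightarrow> fps_agree n (a oo f) (a oo g)"
  using fps_agree_power[of n f g] unfolding fps_agree_def fps_compose_nth
  by (auto intro!: sum.cong)

text \<open>A factor without constant term gains one order; this is what makes the inductions on \<open>n\<close> work.\<close>

lemma fps_agree_Suc_mult:
  assumes "y $ 0 = 0" "fps_agree n f g"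
  shows "fps_agree (Suc n) (y * f) (y * g)"
  unfolding fps_agree_def fps_mult_nth
proof (intro allI impI sum.cong refl)
  fix k i assume *: "k < Suc n" "i \<in> {0..k}"
  show "y $ i * f $ (k - i) = y $ i * g $ (k - i)"
    using * assms by (cases "i = 0") (auto simp: fps_agree_def)
qed

text \<open>The infinite sum \<open>\<Sum>i. a\<^sub>i b\<^sup>i c\<close> is finite in each coefficient because \<open>b\<^sup>i\<close> has order at least \<open>i\<close>.\<close>

lemma fps_compose_mult_nth:
  fixes a b c :: "'a::idom fps"
  assumes b: "b $ 0 = 0"
  shows "((a oo b) * c) $ n = (\<Sum>i\<le>n. a $ i * (b ^ i * c) $ n)"
proof -
  have "((a oo b) * c) $ n = (\<Sum>j\<le>n. (\<Sum>i\<le>n. a $ i * (b ^ i $ j)) * c $ (n - j))"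
    unfolding fps_mult_nth fps_compose_nth atLeast0AtMost
  proof (rule sum.cong[OF refl])
    fix j assume "j \<in> {..n}"
    hence "(\<Sum>i\<le>j. a $ i * (b ^ i $ j)) = (\<Sum>i\<le>n. a $ i * (b ^ i $ j))"
      by (intro sum.mono_neutral_left) (auto simp: startsby_zero_power_prefix[OF b])
    thus "(\<Sum>i\<le>j. a $ i * (b ^ i $ j)) * c $ (n - j) =
      (\<Sum>i\<le>n. a $ i * (b ^ i $ j)) * c $ (n - j)" by simp
  qed
  also have "\<dots> = (\<Sum>i\<le>n. a $ i * (b ^ i * c) $ n)"
    unfolding fps_mult_nth atLeast0AtMost sum_distrib_left sum_distrib_right
    by (subst sum.swap) (simp add: mult_ac)
  finally show ?thesis .
qed

text \<open>The factor \<open>y\<close> gains one order in each round, so both components are determined coefficient by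
  coefficient. No coefficient of \<open>f\<close> or \<open>g\<close> has to be invertible.\<close>

lemma coupled_fps_unique:
  fixes y f g :: "'a::idom fps"
  assumes y: "y $ 0 = 0"
    and "s = y * (g oo t)" "t = y * (f oo s)" "s' = y * (g oo t')" "t' = y * (f oo s')"
  shows "s = s'" "t = t'"
proof -
  have "fps_agree n s s' \<and> fps_agree n t t'" for n
  proof (induction n)
    case (Suc n)
    have "fps_agree (Suc n) (y * (g oo t)) (y * (g oo t'))"
      "fps_agree (Suc n) (y * (f oo s)) (y * (f oo s'))"
      using Suc by (auto intro!: fps_agree_Suc_mult[OF y] fps_agree_compose)
    with assms(2-) show ?case by metis
  qed simp
  thus "s = s'" "t = t'" by (auto intro: fps_eqI_agree)
qed

lemma fps_compose_X_power_nth: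
  fixes f :: "'a::idom fps"
  assumes m: "m > 0"
  shows "(f oo fps_X ^ m) $ n = (if m dvd n then f $ (n div m) else 0)"
proof (cases "m dvd n")
  case True
  then obtain k where k: "n = m * k" by auto
  have "(f oo fps_X ^ m) $ n = (\<Sum>i\<in>{0..n}. if i = k then f $ i else 0)"
    unfolding fps_compose_nth using m by (intro sum.cong) (auto simp: k fps_X_power_nth simp flip: power_mult)
  also have "\<dots> = f $ k" using m by (simp add: k)
  finally show ?thesis using True k m by simp
next
  case False
  thus ?thesis unfolding fps_compose_nth
    by (auto simp: fps_X_power_nth simp flip: power_mult intro!: sum.neutral)
qed

lemma fps_compose_X_power_inj:
  fixes f g :: "'a::idom fps"
  assumes "m > 0" "f oo fps_X ^ m = g oo fps_X ^ m"
  shows "f = g"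
proof (rule fps_ext)
  fix n
  have "(f oo fps_X ^ m) $ (m * n) = (g oo fps_X ^ m) $ (m * n)" using assms by simp
  thus "f $ n = g $ n" using assms(1) by (simp add: fps_compose_X_power_nth)
qed

lemma fps_even_part:
  fixes s :: "complex fps"
  assumes "\<And>k. odd k \<Longrightarrow> s $ k = 0"
  shows "Abs_fps (\<lambda>k. s $ (2 * k)) oo fps_X ^ 2 = s"
  using assms by (intro fps_ext) (simp add: fps_compose_X_power_nth)

text \<open>The form in which the Schwinger-Dyson equation reaches generating series: splitting at \<open>r\<close> further
  occurrences contributes a geometric factor \<open>s\<^sup>r\<close>.\<close>

lemma series_of_recursion:
  fixes s G F :: "complex fps"
  assumes s: "s $ 0 = 0"
    and F: "\<And>k. F $ Suc k = (\<Sum>r\<le>k. K $ r * (s ^ r * G) $ k)"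
  shows "F = fps_const (F $ 0) + fps_X * ((K oo s) * G)"
proof (rule fps_ext)
  fix k
  show "F $ k = (fps_const (F $ 0) + fps_X * ((K oo s) * G)) $ k"
    by (cases k) (simp_all add: F fps_compose_mult_nth[OF s])
qed

section \<open>Non-crossing partitions and free cumulants\<close>

text \<open>Partitions of arbitrary sets are needed, since the restriction of a non-crossing partition to a gap
  of a block lives on a shorter interval.\<close>

definition nc_partitions :: "nat set \<Rightarrow> nat set set set" where
  "nc_partitions A = {\<pi>. partition_on A \<pi> \<and> noncrossing \<pi>}"

lemma NC_eq_nc_partitions: "NC n = nc_partitions {1..<Suc n}"
  by (simp add: NC_def nc_partitions_def atLeastLessThanSuc_atLeastAtMost)

lemma finite_nc_partitions [simp]: "finite A \<Longrightarrow> finite (nc_partitions A)"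
  by (rule finite_subset[of _ "Pow (Pow A)"]) (auto simp: nc_partitions_def partition_on_def)

lemma nc_partitions_empty [simp]: "nc_partitions {} = {{}}"
  by (auto simp: nc_partitions_def partition_on_empty noncrossing_def)

lemma nc_partitions_block_eq:
  assumes "\<pi> \<in> nc_partitions A" "V \<in> \<pi>" "W \<in> \<pi>" "x \<in> V" "x \<in> W"
  shows "V = W"
  using assms by (auto simp: nc_partitions_def partition_on_def disjoint_def)

lemma nc_partitions_crossing:
  assumes "\<pi> \<in> nc_partitions A" "V \<in> \<pi>" "W \<in> \<pi>" "p \<in> V" "q \<in> W" "r \<in> V" "t \<in> W"
    "p < q" "q < r" "r < t"
  shows "V = W"
proof -
  have "noncrossing \<pi>" using assms(1) by (simp add: nc_partitions_def)
  from this[unfolded noncrossing_def, rule_format, of V W p q r t] assms(2-) show ?thesis by simp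
qed

lemma nc_partitions_subset: "\<pi> \<in> nc_partitions A \<Longrightarrow> V \<in> \<pi> \<Longrightarrow> V \<subseteq> A"
  and nc_partitions_nonempty: "\<pi> \<in> nc_partitions A \<Longrightarrow> V \<in> \<pi> \<Longrightarrow> V \<noteq> {}"
  and nc_partitions_block: "\<pi> \<in> nc_partitions A \<Longrightarrow> x \<in> A \<Longrightarrow> \<exists>V\<in>\<pi>. x \<in> V"
  and nc_partitions_finite: "\<pi> \<in> nc_partitions A \<Longrightarrow> finite A \<Longrightarrow> finite \<pi>"
  by (auto simp: nc_partitions_def partition_on_def finite_UnionD)

lemma nc_partitionsI:
  assumes "\<And>V. V \<in> \<pi> \<Longrightarrow> V \<subseteq> A" "\<And>V. V \<in> \<pi> \<Longrightarrow> V \<noteq> {}" "\<And>x. x \<in> A \<Longrightarrow> \<exists>V\<in>\<pi>. x \<in> V"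
    "\<And>V W x. V \<in> \<pi> \<Longrightarrow> W \<in> \<pi> \<Longrightarrow> x \<in> V \<Longrightarrow> x \<in> W \<Longrightarrow> V = W"
    "\<And>V W p q r t. V \<in> \<pi> \<Longrightarrow> W \<in> \<pi> \<Longrightarrow> p \<in> V \<Longrightarrow> q \<in> W \<Longrightarrow> r \<in> V \<Longrightarrow> t \<in> W \<Longrightarrow>
       p < q \<Longrightarrow> q < r \<Longrightarrow> r < t \<Longrightarrow> V = W"
  shows "\<pi> \<in> nc_partitions A"
proof -
  have "disjoint \<pi>" using assms(4) by (auto simp: disjoint_def)
  moreover have "\<Union>\<pi> = A" using assms(1,3) by auto
  moreover have "noncrossing \<pi>" unfolding noncrossing_def using assms(5) by metis
  ultimately show ?thesis using assms(2) by (auto simp: nc_partitions_def partition_on_def)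
qed

definition add_to_block :: "nat \<Rightarrow> nat \<Rightarrow> nat set \<Rightarrow> nat set" where
  "add_to_block a j T = (if j \<in> T then insert a T else T)"

text \<open>The element of the block of \<open>a\<close> that follows \<open>a\<close> is \<open>j\<close>. Peeling off one element of the block at a
  time is simpler than recording all its gaps at once.\<close>

definition second_in_block :: "nat \<Rightarrow> nat \<Rightarrow> nat set set \<Rightarrow> bool" where
  "second_in_block a j \<pi> \<longleftrightarrow> (\<exists>V\<in>\<pi>. a \<in> V \<and> j \<in> V \<and> V \<inter> {a<..<j} = {})"

text \<open>A block of \<open>\<sigma>\<close> lies strictly between the consecutive elements \<open>a\<close> and \<open>j\<close> of one block, so it crosses
  nothing; adding \<open>a\<close> next to \<open>j\<close> creates no crossing because \<open>\<tau>\<close> has nothing to the left of \<open>j\<close>.\<close>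

lemma nc_partitions_join:
  assumes \<sigma>: "\<sigma> \<in> nc_partitions {Suc a..<j}" and \<tau>: "\<tau> \<in> nc_partitions {j..<b}" and "a < j" "j < b"
  shows "\<sigma> \<union> add_to_block a j ` \<tau> \<in> nc_partitions {a..<b}"
    and "second_in_block a j (\<sigma> \<union> add_to_block a j ` \<tau>)"
proof -
  have s: "x \<in> {Suc a..<j}" if "V \<in> \<sigma>" "x \<in> V" for x V
    using nc_partitions_subset[OF \<sigma>] that by blast
  have t: "x = a \<and> j \<in> T \<or> x \<in> T \<and> j \<le> x \<and> x < b" if "T \<in> \<tau>" "x \<in> add_to_block a j T" for x T
    using nc_partitions_subset[OF \<tau>] that by (force simp: add_to_block_def split: if_splits)
  obtain T0 where T0: "T0 \<in> \<tau>" "j \<in> T0"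
    using nc_partitions_block[OF \<tau>, of j] \<open>j < b\<close> by auto
  show "second_in_block a j (\<sigma> \<union> add_to_block a j ` \<tau>)"
    unfolding second_in_block_def
    using T0 t[OF T0(1)] by (intro bexI[of _ "add_to_block a j T0"]) (force simp: add_to_block_def)+
  show "\<sigma> \<union> add_to_block a j ` \<tau> \<in> nc_partitions {a..<b}"
  proof (rule nc_partitionsI)
    fix V assume "V \<in> \<sigma> \<union> add_to_block a j ` \<tau>"
    thus "V \<subseteq> {a..<b}" "V \<noteq> {}"
      using s t nc_partitions_nonempty[OF \<sigma>] nc_partitions_nonempty[OF \<tau>] \<open>a < j\<close> \<open>j < b\<close>
      by (fastforce simp: add_to_block_def split: if_splits)+
  next
    fix x assume x: "x \<in> {a..<b}"
    consider "x = a" | "x \<in> {Suc a..<j}" | "x \<in> {j..<b}" using x by force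
    thus "\<exists>V\<in>\<sigma> \<union> add_to_block a j ` \<tau>. x \<in> V"
    proof cases
      case 1
      with T0 show ?thesis by (intro bexI[of _ "add_to_block a j T0"]) (auto simp: add_to_block_def)
    next
      case 2
      with nc_partitions_block[OF \<sigma>] show ?thesis by blast
    next
      case 3
      with nc_partitions_block[OF \<tau>] obtain T where "T \<in> \<tau>" "x \<in> T" by blast
      thus ?thesis by (intro bexI[of _ "add_to_block a j T"]) (auto simp: add_to_block_def)
    qed
  next
    fix V W x
    assume V: "V \<in> \<sigma> \<union> add_to_block a j ` \<tau>" and W: "W \<in> \<sigma> \<union> add_to_block a j ` \<tau>"
      and x: "x \<in> V" "x \<in> W"
    have eq: "S = T" if "S \<in> \<tau>" "T \<in> \<tau>" "x \<in> add_to_block a j S" "x \<in> add_to_block a j T" for S T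
      using t[of S x] t[of T x] that nc_partitions_block_eq[OF \<tau>] \<open>a < j\<close> by (metis leD)
    show "V = W"
      using V W
    proof (elim UnE imageE)
      assume "V \<in> \<sigma>" "W \<in> \<sigma>"
      thus ?thesis using nc_partitions_block_eq[OF \<sigma>] x by blast
    next
      fix T assume "V \<in> \<sigma>" "W = add_to_block a j T" "T \<in> \<tau>"
      thus ?thesis using s[of V x] t[of T x] x by force
    next
      fix S assume "W \<in> \<sigma>" "V = add_to_block a j S" "S \<in> \<tau>"
      thus ?thesis using s[of W x] t[of S x] x by force
    next
      fix S T assume "V = add_to_block a j S" "S \<in> \<tau>" "W = add_to_block a j T" "T \<in> \<tau>"
      thus ?thesis using eq x by blast
    qed
  next
    fix V W p q r u
    assume V: "V \<in> \<sigma> \<union> add_to_block a j ` \<tau>" and W: "W \<in> \<sigma> \<union> add_to_block a j ` \<tau>"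
      and el: "p \<in> V" "q \<in> W" "r \<in> V" "u \<in> W" and less: "p < q" "q < r" "r < u"
    show "V = W"
      using V W
    proof (elim UnE imageE)
      assume "V \<in> \<sigma>" "W \<in> \<sigma>"
      thus ?thesis using nc_partitions_crossing[OF \<sigma>] el less by blast
    next
      fix T assume "V \<in> \<sigma>" "W = add_to_block a j T" "T \<in> \<tau>"
      thus ?thesis using s[of V p] s[of V r] t[of T q] el less by force
    next
      fix S assume "W \<in> \<sigma>" "V = add_to_block a j S" "S \<in> \<tau>"
      thus ?thesis using s[of W q] s[of W u] t[of S r] el less by force
    next
      fix S T assume VS: "V = add_to_block a j S" "S \<in> \<tau>" and WT: "W = add_to_block a j T" "T \<in> \<tau>"
      have p: "p = a \<and> j \<in> S \<or> p \<in> S \<and> j \<le> p" using t[of S p] el VS by auto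
      have "a \<le> p" using p \<open>a < j\<close> by auto
      hence *: "q \<in> T" "u \<in> T" "r \<in> S" "j \<le> q"
        using t[of T q] t[of T u] t[of S r] el VS WT less by auto
      have "S = T"
      proof (cases "p \<in> S")
        case True
        thus ?thesis using nc_partitions_crossing[OF \<tau>] VS(2) WT(2) * less by blast
      next
        case False
        hence j: "j \<in> S" using p by auto
        show ?thesis
        proof (cases "q = j")
          case True
          thus ?thesis using nc_partitions_block_eq[OF \<tau>] VS(2) WT(2) j * by blast
        next
          case False
          hence "j < q" using * by simp
          thus ?thesis using nc_partitions_crossing[OF \<tau> VS(2) WT(2) j] * less by blast
        qed
      qed
      thus ?thesis using VS WT by simp
    qed
  qed
qed

text \<open>Converse of the previous lemma: a block that meets the gap between \<open>a\<close> and \<open>j\<close> cannot leave it without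
  crossing the block of \<open>a\<close> and \<open>j\<close>.\<close>

lemma nc_partitions_split:
  assumes \<pi>: "\<pi> \<in> nc_partitions {a..<b}" and sec: "second_in_block a j \<pi>" and "a < j" and "j < b"
  defines "\<sigma> \<equiv> {V \<in> \<pi>. V \<subseteq> {Suc a..<j}}"
    and "\<tau> \<equiv> (\<lambda>V. V - {a}) ` {V \<in> \<pi>. \<not> V \<subseteq> {Suc a..<j}}"
  shows "\<sigma> \<in> nc_partitions {Suc a..<j}" "\<tau> \<in> nc_partitions {j..<b}"
    "\<sigma> \<union> add_to_block a j ` \<tau> = \<pi>"
proof -
  obtain V0 where V0: "V0 \<in> \<pi>" "a \<in> V0" "j \<in> V0" "V0 \<inter> {a<..<j} = {}"
    using sec by (auto simp: second_in_block_def)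
  have a_block: "V = V0" if "V \<in> \<pi>" "a \<in> V" for V
    using nc_partitions_block_eq[OF \<pi>] that V0 by blast
  have j_block: "V = V0" if "V \<in> \<pi>" "j \<in> V" for V
    using nc_partitions_block_eq[OF \<pi>] that V0 by blast
  have sub: "V \<subseteq> {a..<b}" if "V \<in> \<pi>" for V using nc_partitions_subset[OF \<pi> that] .
  have inner: "V \<subseteq> {Suc a..<j}" if V: "V \<in> \<pi>" "x \<in> V" "a < x" "x < j" for V x
  proof
    fix y assume y: "y \<in> V"
    have "V \<noteq> V0" using V V0(4) by auto
    hence ne: "y \<noteq> a" "y \<noteq> j" using a_block[OF V(1)] j_block[OF V(1)] y by metis+
    have "a \<le> y" using sub[OF V(1)] y by auto
    moreover have "\<not> j < y"
      using nc_partitions_crossing[OF \<pi> V0(1) V(1) V0(2) V(2) V0(3) y] \<open>V \<noteq> V0\<close> V by auto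
    ultimately show "y \<in> {Suc a..<j}" using ne by auto
  qed
  have outer: "x = a \<or> j \<le> x \<and> x < b" if "V \<in> \<pi>" "\<not> V \<subseteq> {Suc a..<j}" "x \<in> V" for V x
  proof -
    have "x \<in> {a..<b}" using sub[OF that(1)] that(3) by blast
    moreover have "\<not> (a < x \<and> x < j)" using inner[OF that(1,3)] that(2) by blast
    ultimately show ?thesis by auto
  qed
  show "\<sigma> \<in> nc_partitions {Suc a..<j}"
  proof (rule nc_partitionsI)
    fix x assume "x \<in> {Suc a..<j}"
    moreover from this obtain V where V: "V \<in> \<pi>" "x \<in> V"
      using nc_partitions_block[OF \<pi>, of x] \<open>j < b\<close> by auto
    ultimately have "V \<in> \<sigma>" using inner[OF V] unfolding \<sigma>_def by simp
    thus "\<exists>V\<in>\<sigma>. x \<in> V" using V by blast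
  next
    fix V W p q r t assume "V \<in> \<sigma>" "W \<in> \<sigma>"
      and el: "p \<in> V" "q \<in> W" "r \<in> V" "t \<in> W" "p < q" "q < r" "r < t"
    hence "V \<in> \<pi>" "W \<in> \<pi>" by (simp_all add: \<sigma>_def)
    thus "V = W" by (rule nc_partitions_crossing[OF \<pi> _ _ el])
  next
    fix V W x assume "V \<in> \<sigma>" "W \<in> \<sigma>" "x \<in> V" "x \<in> W"
    hence "V \<in> \<pi>" "W \<in> \<pi>" by (simp_all add: \<sigma>_def)
    thus "V = W" using \<open>x \<in> V\<close> \<open>x \<in> W\<close> by (rule nc_partitions_block_eq[OF \<pi>])
  qed (use nc_partitions_nonempty[OF \<pi>] in \<open>auto simp: \<sigma>_def\<close>)
  have \<tau>_block: "\<exists>V'\<in>\<pi>. V = V' - {a}" if "V \<in> \<tau>" for V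
    using that unfolding \<tau>_def by blast
  show "\<tau> \<in> nc_partitions {j..<b}"
  proof (rule nc_partitionsI)
    fix V assume "V \<in> \<tau>"
    then obtain V' where V': "V' \<in> \<pi>" "\<not> V' \<subseteq> {Suc a..<j}" "V = V' - {a}" by (auto simp: \<tau>_def)
    show "V \<subseteq> {j..<b}"
    proof
      fix x assume "x \<in> V"
      thus "x \<in> {j..<b}" using outer[OF V'(1,2), of x] V'(3) by auto
    qed
    show "V \<noteq> {}"
    proof (cases "a \<in> V'")
      case True
      hence "j \<in> V'" using a_block[OF V'(1)] V0(3) by simp
      with \<open>a < j\<close> have "j \<in> V" unfolding V'(3) by simp
      thus ?thesis by blast
    next
      case False
      thus ?thesis using nc_partitions_nonempty[OF \<pi> V'(1)] unfolding V'(3) by simp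
    qed
  next
    fix x assume x: "x \<in> {j..<b}"
    then obtain V where V: "V \<in> \<pi>" "x \<in> V"
      using nc_partitions_block[OF \<pi>, of x] \<open>a < j\<close> by auto
    have "\<not> V \<subseteq> {Suc a..<j}" using V x by auto
    hence mem: "V - {a} \<in> \<tau>" unfolding \<tau>_def using V by blast
    have "x \<in> V - {a}" using V x \<open>a < j\<close> by simp
    thus "\<exists>V\<in>\<tau>. x \<in> V" using mem by (rule bexI)
  next
    fix V W x assume "V \<in> \<tau>" "W \<in> \<tau>" "x \<in> V" "x \<in> W"
    obtain V' W' where *: "V' \<in> \<pi>" "W' \<in> \<pi>" "V = V' - {a}" "W = W' - {a}"
      using \<tau>_block[OF \<open>V \<in> \<tau>\<close>] \<tau>_block[OF \<open>W \<in> \<tau>\<close>] by metis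
    hence "V' = W'" using nc_partitions_block_eq[OF \<pi> *(1,2), of x] \<open>x \<in> V\<close> \<open>x \<in> W\<close> by simp
    thus "V = W" using * by simp
  next
    fix V W p q r t assume "V \<in> \<tau>" "W \<in> \<tau>"
      and el: "p \<in> V" "q \<in> W" "r \<in> V" "t \<in> W" "p < q" "q < r" "r < t"
    obtain V' W' where *: "V' \<in> \<pi>" "W' \<in> \<pi>" "V = V' - {a}" "W = W' - {a}"
      using \<tau>_block[OF \<open>V \<in> \<tau>\<close>] \<tau>_block[OF \<open>W \<in> \<tau>\<close>] by metis
    hence "V' = W'" using nc_partitions_crossing[OF \<pi> *(1,2), of p q r t] el by simp
    thus "V = W" using * by simp
  qed
  have restore: "add_to_block a j (V - {a}) = V" if V: "V \<in> \<pi>" for V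
  proof (cases "j \<in> V")
    case True
    have "a \<in> V" "j \<in> V - {a}" using j_block[OF V True] V0(2) True \<open>a < j\<close> by simp_all
    thus ?thesis unfolding add_to_block_def by auto
  next
    case False
    hence "a \<notin> V" using a_block[OF V] V0(3) by blast
    with False show ?thesis unfolding add_to_block_def by simp
  qed
  have "add_to_block a j ` \<tau> = (\<lambda>V. V) ` {V \<in> \<pi>. \<not> V \<subseteq> {Suc a..<j}}"
    unfolding \<tau>_def image_image by (rule image_cong) (use restore in blast)+
  thus "\<sigma> \<union> add_to_block a j ` \<tau> = \<pi>" unfolding \<sigma>_def by auto
qed

text \<open>The sum in the moment-cumulant formula with the size of the first block increased by \<open>s\<close>. The
  parameter \<open>s\<close> counts the elements of the first block that have already been peeled off.\<close>

definition nc_sum :: "(nat \<Rightarrow> complex) \<Rightarrow> nat \<Rightarrow> nat \<Rightarrow> nat \<Rightarrow> complex" where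
  "nc_sum \<kappa> s a b =
     (\<Sum>\<pi>\<in>nc_partitions {a..<b}. \<Prod>V\<in>\<pi>. \<kappa> (card V + (if a \<in> V then s else 0)))"

lemma nc_sum_second:
  assumes "a < j" "j < b"
  shows "(\<Sum>\<pi>\<in>{\<pi> \<in> nc_partitions {a..<b}. second_in_block a j \<pi>}.
            \<Prod>V\<in>\<pi>. \<kappa> (card V + (if a \<in> V then s else 0))) =
         nc_sum \<kappa> 0 (Suc a) j * nc_sum \<kappa> (Suc s) j b"
proof -
  let ?A = "nc_partitions {Suc a..<j}" and ?B = "nc_partitions {j..<b}"
  let ?w = "\<lambda>a s \<pi>. \<Prod>V\<in>\<pi>. \<kappa> (card V + (if a \<in> V then s else 0))"
  let ?i = "\<lambda>(\<sigma>, \<tau>). \<sigma> \<union> add_to_block a j ` \<tau>"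
  let ?k = "\<lambda>\<pi>. ({V \<in> \<pi>. V \<subseteq> {Suc a..<j}}, (\<lambda>V. V - {a}) ` {V \<in> \<pi>. \<not> V \<subseteq> {Suc a..<j}})"
  have s: "x \<in> {Suc a..<j}" if "\<sigma> \<in> ?A" "V \<in> \<sigma>" "x \<in> V" for x V \<sigma>
    using nc_partitions_subset[OF that(1,2)] that(3) by blast
  have t: "x \<in> {j..<b}" if "\<tau> \<in> ?B" "V \<in> \<tau>" "x \<in> V" for x V \<tau>
    using nc_partitions_subset[OF that(1,2)] that(3) by blast
  have restrict: "add_to_block a j T - {a} = T" if "\<tau> \<in> ?B" "T \<in> \<tau>" for T \<tau>
    using t[OF that, of a] \<open>a < j\<close> by (auto simp: add_to_block_def)
  have not_inner: "\<not> add_to_block a j T \<subseteq> {Suc a..<j}" if T: "\<tau> \<in> ?B" "T \<in> \<tau>" for T \<tau>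
  proof -
    obtain x where "x \<in> T" using nc_partitions_nonempty[OF T] by blast
    thus ?thesis using t[OF T, of x] by (auto simp: add_to_block_def)
  qed
  have "(\<Sum>\<pi>\<in>{\<pi> \<in> nc_partitions {a..<b}. second_in_block a j \<pi>}. ?w a s \<pi>) =
    (\<Sum>(\<sigma>, \<tau>)\<in>?A \<times> ?B. ?w (Suc a) 0 \<sigma> * ?w j (Suc s) \<tau>)"
  proof (rule sum.reindex_bij_witness[of _ ?i ?k])
    fix \<pi> assume "\<pi> \<in> {\<pi> \<in> nc_partitions {a..<b}. second_in_block a j \<pi>}"
    hence \<pi>: "\<pi> \<in> nc_partitions {a..<b}" "second_in_block a j \<pi>" by simp_all
    show "?i (?k \<pi>) = \<pi>" unfolding prod.case by (rule nc_partitions_split(3)[OF \<pi> assms])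
    show "?k \<pi> \<in> ?A \<times> ?B"
      by (rule SigmaI) (rule nc_partitions_split(1,2)[OF \<pi> assms])+
  next
    fix x assume x: "x \<in> ?A \<times> ?B"
    obtain \<sigma> \<tau> where x_eq: "x = (\<sigma>, \<tau>)" by (cases x)
    with x have st: "\<sigma> \<in> ?A" "\<tau> \<in> ?B" by auto
    show "?i x \<in> {\<pi> \<in> nc_partitions {a..<b}. second_in_block a j \<pi>}"
      using nc_partitions_join[OF st assms] by (simp add: x_eq)
    have 1: "{V \<in> \<sigma> \<union> add_to_block a j ` \<tau>. V \<subseteq> {Suc a..<j}} = \<sigma>"
      using nc_partitions_subset[OF st(1)] not_inner[OF st(2)] by blast
    have 2: "{V \<in> \<sigma> \<union> add_to_block a j ` \<tau>. \<not> V \<subseteq> {Suc a..<j}} = add_to_block a j ` \<tau>"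
      using nc_partitions_subset[OF st(1)] not_inner[OF st(2)] by blast
    have 3: "(\<lambda>V. V - {a}) ` add_to_block a j ` \<tau> = \<tau>"
      unfolding image_image using restrict[OF st(2)] by simp
    show "?k (?i x) = x" unfolding x_eq prod.case 1 2 3 ..
  next
    fix \<pi> assume "\<pi> \<in> {\<pi> \<in> nc_partitions {a..<b}. second_in_block a j \<pi>}"
    hence \<pi>: "\<pi> \<in> nc_partitions {a..<b}" "second_in_block a j \<pi>" by simp_all
    define \<sigma> \<tau> where st_def: "\<sigma> = fst (?k \<pi>)" "\<tau> = snd (?k \<pi>)"
    have k: "?k \<pi> = (\<sigma>, \<tau>)" by (simp only: st_def prod.collapse)
    have st: "\<sigma> \<in> ?A" "\<tau> \<in> ?B" and eq: "\<pi> = \<sigma> \<union> add_to_block a j ` \<tau>"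
      unfolding st_def fst_conv snd_conv
      using nc_partitions_split[OF \<pi> assms] by (simp_all only:)
    have fin: "finite \<sigma>" "finite \<tau>"
      using st by (auto intro: nc_partitions_finite)
    have "\<sigma> \<inter> add_to_block a j ` \<tau> = {}"
      using not_inner[OF st(2)] nc_partitions_subset[OF st(1)] by blast
    with fin have "?w a s \<pi> = ?w a s \<sigma> * ?w a s (add_to_block a j ` \<tau>)"
      by (subst eq, intro prod.union_disjoint) auto
    also have "?w a s \<sigma> = ?w (Suc a) 0 \<sigma>"
    proof (rule prod.cong[OF refl])
      fix V assume "V \<in> \<sigma>"
      hence "a \<notin> V" using s[OF st(1), of V a] by auto
      thus "\<kappa> (card V + (if a \<in> V then s else 0)) = \<kappa> (card V + (if Suc a \<in> V then 0 else 0))"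
        by simp
    qed
    also have "?w a s (add_to_block a j ` \<tau>) =
      (\<Prod>T\<in>\<tau>. \<kappa> (card (add_to_block a j T) + (if a \<in> add_to_block a j T then s else 0)))"
      using restrict[OF st(2)] by (subst prod.reindex) (auto intro!: inj_on_inverseI[of _ "\<lambda>V. V - {a}"])
    also have "\<dots> = ?w j (Suc s) \<tau>"
    proof (rule prod.cong[OF refl])
      fix T assume T: "T \<in> \<tau>"
      have "a \<notin> T" using t[OF st(2) T] \<open>a < j\<close> by force
      moreover have "finite T"
        using nc_partitions_subset[OF st(2) T] by (rule finite_subset) auto
      ultimately show "\<kappa> (card (add_to_block a j T) + (if a \<in> add_to_block a j T then s else 0)) =
        \<kappa> (card T + (if j \<in> T then Suc s else 0))" by (simp add: add_to_block_def)
    qed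
    finally show "(case ?k \<pi> of (\<sigma>, \<tau>) \<Rightarrow> ?w (Suc a) 0 \<sigma> * ?w j (Suc s) \<tau>) = ?w a s \<pi>"
      unfolding k by simp
  qed
  also have "\<dots> = nc_sum \<kappa> 0 (Suc a) j * nc_sum \<kappa> (Suc s) j b"
    unfolding nc_sum_def sum_product sum.cartesian_product ..
  finally show ?thesis .
qed

lemma nc_sum_singleton:
  assumes "a < b"
  shows "(\<Sum>\<pi>\<in>{\<pi> \<in> nc_partitions {a..<b}. {a} \<in> \<pi>}.
            \<Prod>V\<in>\<pi>. \<kappa> (card V + (if a \<in> V then s else 0))) = \<kappa> (Suc s) * nc_sum \<kappa> 0 (Suc a) b"
proof -
  let ?A = "nc_partitions {Suc a..<b}"
  let ?w = "\<lambda>a s \<pi>. \<Prod>V\<in>\<pi>. \<kappa> (card V + (if a \<in> V then s else 0))"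
  have "(\<Sum>\<pi>\<in>{\<pi> \<in> nc_partitions {a..<b}. {a} \<in> \<pi>}. ?w a s \<pi>) = (\<Sum>\<sigma>\<in>?A. \<kappa> (Suc s) * ?w (Suc a) 0 \<sigma>)"
  proof (rule sum.reindex_bij_witness[of _ "insert {a}" "\<lambda>\<pi>. \<pi> - {{a}}"])
    fix \<pi> assume "\<pi> \<in> {\<pi> \<in> nc_partitions {a..<b}. {a} \<in> \<pi>}"
    hence \<pi>: "\<pi> \<in> nc_partitions {a..<b}" "{a} \<in> \<pi>" by auto
    have no_a: "a \<notin> V" if "V \<in> \<pi> - {{a}}" for V
      using nc_partitions_block_eq[OF \<pi>(1) \<pi>(2), of V a] that by auto
    show "insert {a} (\<pi> - {{a}}) = \<pi>" using \<pi>(2) by blast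
    show "\<pi> - {{a}} \<in> ?A"
    proof (rule nc_partitionsI)
      fix V assume V: "V \<in> \<pi> - {{a}}"
      show "V \<subseteq> {Suc a..<b}"
      proof
        fix x assume "x \<in> V"
        with nc_partitions_subset[OF \<pi>(1), of V] no_a[OF V] V show "x \<in> {Suc a..<b}"
          by (cases "x = a") auto
      qed
    next
      fix x assume "x \<in> {Suc a..<b}"
      with nc_partitions_block[OF \<pi>(1), of x] show "\<exists>V\<in>\<pi> - {{a}}. x \<in> V" by force
    next
      fix V W p q r t assume "V \<in> \<pi> - {{a}}" "W \<in> \<pi> - {{a}}"
        and el: "p \<in> V" "q \<in> W" "r \<in> V" "t \<in> W" "p < q" "q < r" "r < t"
      hence "V \<in> \<pi>" "W \<in> \<pi>" by simp_all
      thus "V = W" by (rule nc_partitions_crossing[OF \<pi>(1) _ _ el])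
    next
      fix V W x assume "V \<in> \<pi> - {{a}}" "W \<in> \<pi> - {{a}}" "x \<in> V" "x \<in> W"
      hence "V \<in> \<pi>" "W \<in> \<pi>" by simp_all
      thus "V = W" using \<open>x \<in> V\<close> \<open>x \<in> W\<close> by (rule nc_partitions_block_eq[OF \<pi>(1)])
    qed (use nc_partitions_nonempty[OF \<pi>(1)] in auto)
    have "?w a s \<pi> = ?w a s (insert {a} (\<pi> - {{a}}))" using \<pi>(2) by (simp add: insert_absorb)
    also have "\<dots> = \<kappa> (Suc s) * ?w a s (\<pi> - {{a}})"
      using nc_partitions_finite[OF \<pi>(1)] by (subst prod.insert) auto
    also have "?w a s (\<pi> - {{a}}) = ?w (Suc a) 0 (\<pi> - {{a}})"
      using no_a by (intro prod.cong) auto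
    finally show "\<kappa> (Suc s) * ?w (Suc a) 0 (\<pi> - {{a}}) = ?w a s \<pi>" ..
  next
    fix \<sigma> assume \<sigma>: "\<sigma> \<in> ?A"
    have sub: "x \<in> {Suc a..<b}" if "V \<in> \<sigma>" "x \<in> V" for V x
      using nc_partitions_subset[OF \<sigma>] that by blast
    have no_a: "a \<notin> V" if "V \<in> \<sigma>" for V using sub[OF that] by force
    show "insert {a} \<sigma> - {{a}} = \<sigma>" using no_a by auto
    have "insert {a} \<sigma> \<in> nc_partitions {a..<b}"
    proof (rule nc_partitionsI)
      fix V assume "V \<in> insert {a} \<sigma>"
      thus "V \<subseteq> {a..<b}" "V \<noteq> {}" using sub assms nc_partitions_nonempty[OF \<sigma>] by force+
    next
      fix x assume "x \<in> {a..<b}"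
      thus "\<exists>V\<in>insert {a} \<sigma>. x \<in> V"
        using nc_partitions_block[OF \<sigma>, of x] by (cases "x = a") auto
    next
      fix V W x assume "V \<in> insert {a} \<sigma>" "W \<in> insert {a} \<sigma>" "x \<in> V" "x \<in> W"
      thus "V = W" using no_a nc_partitions_block_eq[OF \<sigma>] by auto
    next
      fix V W p q r t assume "V \<in> insert {a} \<sigma>" "W \<in> insert {a} \<sigma>" "p \<in> V" "q \<in> W" "r \<in> V" "t \<in> W"
        "p < q" "q < r" "r < t"
      thus "V = W" using nc_partitions_crossing[OF \<sigma>, of V W p q r t] by auto
    qed
    thus "insert {a} \<sigma> \<in> {\<pi> \<in> nc_partitions {a..<b}. {a} \<in> \<pi>}" by simp
  qed
  thus ?thesis by (simp add: nc_sum_def sum_distrib_left)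
qed

text \<open>Either the first block is a singleton, or its second element \<open>j\<close> splits the partition into one of the
  gap and one that starts at \<open>j\<close>.\<close>

lemma nc_sum_rec:
  assumes "a < b"
  shows "nc_sum \<kappa> s a b = \<kappa> (Suc s) * nc_sum \<kappa> 0 (Suc a) b +
           (\<Sum>j\<in>{a<..<b}. nc_sum \<kappa> 0 (Suc a) j * nc_sum \<kappa> (Suc s) j b)"
proof -
  let ?P = "nc_partitions {a..<b}"
  let ?w = "\<lambda>\<pi>. \<Prod>V\<in>\<pi>. \<kappa> (card V + (if a \<in> V then s else 0))"
  have split: "?P = {\<pi> \<in> ?P. {a} \<in> \<pi>} \<union> (\<Union>j\<in>{a<..<b}. {\<pi> \<in> ?P. second_in_block a j \<pi>})"
  proof (intro equalityI subsetI)
    fix \<pi> assume \<pi>: "\<pi> \<in> ?P"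
    obtain V where V: "V \<in> \<pi>" "a \<in> V" using nc_partitions_block[OF \<pi>, of a] assms by auto
    have sub: "V \<subseteq> {a..<b}" using nc_partitions_subset[OF \<pi> V(1)] .
    show "\<pi> \<in> {\<pi> \<in> ?P. {a} \<in> \<pi>} \<union> (\<Union>j\<in>{a<..<b}. {\<pi> \<in> ?P. second_in_block a j \<pi>})"
    proof (cases "V = {a}")
      case True
      with V \<pi> show ?thesis by auto
    next
      case False
      define j where "j = Min (V - {a})"
      have fin: "finite (V - {a})" using finite_subset[OF sub] by simp
      moreover have "V - {a} \<noteq> {}" using False V by auto
      ultimately have j: "j \<in> V - {a}" unfolding j_def by (rule Min_in)
      have "\<not> x < j" if "x \<in> V - {a}" for x using Min_le[OF fin that] by (simp add: j_def)
      hence "second_in_block a j \<pi>" unfolding second_in_block_def using V j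
        by (intro bexI[of _ V]) auto
      moreover have "j \<in> {a<..<b}" using j sub by force
      ultimately show ?thesis using \<pi> by auto
    qed
  qed auto
  have no_second: "\<not> second_in_block a j \<pi>" if "\<pi> \<in> ?P" "{a} \<in> \<pi>" "j \<in> {a<..<b}" for \<pi> j
  proof
    assume "second_in_block a j \<pi>"
    then obtain V where "V \<in> \<pi>" "a \<in> V" "j \<in> V" by (auto simp: second_in_block_def)
    with nc_partitions_block_eq[OF that(1), of V "{a}" a] that show False by auto
  qed
  have unique_second: "i = j"
    if "\<pi> \<in> ?P" "second_in_block a i \<pi>" "second_in_block a j \<pi>" "i \<in> {a<..<b}" "j \<in> {a<..<b}" for \<pi> i j
  proof -
    from that(2) obtain V where V: "V \<in> \<pi>" "a \<in> V" "i \<in> V" "V \<inter> {a<..<i} = {}"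
      by (auto simp: second_in_block_def)
    from that(3) obtain W where W: "W \<in> \<pi>" "a \<in> W" "j \<in> W" "W \<inter> {a<..<j} = {}"
      by (auto simp: second_in_block_def)
    have "V = W" using nc_partitions_block_eq[OF that(1)] V W by blast
    hence "\<not> j < i" "\<not> i < j" using V W that(4,5) by auto
    thus ?thesis by simp
  qed
  have "nc_sum \<kappa> s a b = (\<Sum>\<pi>\<in>{\<pi> \<in> ?P. {a} \<in> \<pi>} \<union> (\<Union>j\<in>{a<..<b}. {\<pi> \<in> ?P. second_in_block a j \<pi>}). ?w \<pi>)"
    unfolding nc_sum_def using split by simp
  also have "\<dots> = (\<Sum>\<pi>\<in>{\<pi> \<in> ?P. {a} \<in> \<pi>}. ?w \<pi>) +
      (\<Sum>\<pi>\<in>(\<Union>j\<in>{a<..<b}. {\<pi> \<in> ?P. second_in_block a j \<pi>}). ?w \<pi>)"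
    using no_second by (intro sum.union_disjoint) auto
  also have "(\<Sum>\<pi>\<in>(\<Union>j\<in>{a<..<b}. {\<pi> \<in> ?P. second_in_block a j \<pi>}). ?w \<pi>) =
      (\<Sum>j\<in>{a<..<b}. \<Sum>\<pi>\<in>{\<pi> \<in> ?P. second_in_block a j \<pi>}. ?w \<pi>)"
    using unique_second by (intro sum.UNION_disjoint) auto
  also have "\<dots> = (\<Sum>j\<in>{a<..<b}. nc_sum \<kappa> 0 (Suc a) j * nc_sum \<kappa> (Suc s) j b)"
    by (intro sum.cong refl nc_sum_second) auto
  finally show ?thesis by (simp add: nc_sum_singleton[OF assms])
qed

lemma nc_sum_empty [simp]: "nc_sum \<kappa> s a a = 1"
  by (simp add: nc_sum_def)

text \<open>The recursion depends on differences of positions only, which replaces a relabelling of partitions.\<close>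

lemma nc_sum_shift: "nc_sum \<kappa> s (a + c) (a + c + n) = nc_sum \<kappa> s a (a + n)"
proof (induction n arbitrary: a s rule: less_induct)
  case (less n)
  show ?case
  proof (cases n)
    case (Suc k)
    have rec: "nc_sum \<kappa> s a (a + n) = \<kappa> (Suc s) * nc_sum \<kappa> 0 (Suc a) (Suc a + k) +
      (\<Sum>i<k. nc_sum \<kappa> 0 (Suc a) (Suc a + i) * nc_sum \<kappa> (Suc s) (Suc a + i) (Suc a + i + (k - i)))"
      for a s
    proof -
      have "(\<Sum>j\<in>{a<..<a + n}. nc_sum \<kappa> 0 (Suc a) j * nc_sum \<kappa> (Suc s) j (a + n)) =
        (\<Sum>i<k. nc_sum \<kappa> 0 (Suc a) (Suc a + i) * nc_sum \<kappa> (Suc s) (Suc a + i) (Suc a + i + (k - i)))"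
      proof (rule sum.reindex_bij_witness[of _ "\<lambda>i. Suc a + i" "\<lambda>j. j - Suc a"])
        fix j assume "j \<in> {a<..<a + n}"
        hence "Suc a + (j - Suc a) = j" "j + (k - (j - Suc a)) = a + n" "j - Suc a < k"
          using Suc by auto
        thus "Suc a + (j - Suc a) = j" "j - Suc a \<in> {..<k}"
          "nc_sum \<kappa> 0 (Suc a) (Suc a + (j - Suc a)) *
           nc_sum \<kappa> (Suc s) (Suc a + (j - Suc a)) (Suc a + (j - Suc a) + (k - (j - Suc a))) =
           nc_sum \<kappa> 0 (Suc a) j * nc_sum \<kappa> (Suc s) j (a + n)"
          by (simp_all only: lessThan_iff)
      qed (auto simp: Suc)
      moreover have "Suc a + k = a + n" using Suc by simp
      ultimately show ?thesis using nc_sum_rec[of a "a + n" \<kappa> s] Suc by simp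
    qed
    have e1: "nc_sum \<kappa> 0 (Suc (a + c)) (Suc (a + c) + i) = nc_sum \<kappa> 0 (Suc a) (Suc a + i)" if "i \<le> k" for i
      using less[of i 0 "Suc a"] that Suc by simp
    have e2: "nc_sum \<kappa> (Suc s) (Suc (a + c) + i) (Suc (a + c) + i + (k - i)) =
        nc_sum \<kappa> (Suc s) (Suc a + i) (Suc a + i + (k - i))" for i
      using less[of "k - i" "Suc s" "Suc a + i"] Suc by (simp add: add_ac)
    show ?thesis unfolding rec
      by (intro arg_cong2[of _ _ _ _ "(+)"] arg_cong2[of _ _ _ _ "(*)"] sum.cong refl e1 e2) auto
  qed simp
qed

lemma moments_of_cumulants_nc_sum: "moments_of_cumulants \<kappa> n = nc_sum \<kappa> 0 a (a + n)"
proof -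
  have "moments_of_cumulants \<kappa> n = nc_sum \<kappa> 0 1 (1 + n)"
    by (simp add: moments_of_cumulants_def nc_sum_def NC_eq_nc_partitions)
  also have "\<dots> = nc_sum \<kappa> 0 0 (0 + n)" using nc_sum_shift[of \<kappa> 0 0 1 n] by simp
  also have "\<dots> = nc_sum \<kappa> 0 a (a + n)" using nc_sum_shift[of \<kappa> 0 0 a n] by simp
  finally show ?thesis .
qed

lemma moments_of_cumulants_0 [simp]: "moments_of_cumulants \<kappa> 0 = 1"
  using moments_of_cumulants_nc_sum[of \<kappa> 0 0] by simp

text \<open>The sum over all gap lengths \<open>i\<^sub>0 + \<dots> + i\<^sub>r = k - r\<close> of the products \<open>m i\<^sub>0 \<cdots> m i\<^sub>r\<close>.\<close>

primrec conv_moments :: "(nat \<Rightarrow> complex) \<Rightarrow> nat \<Rightarrow> nat \<Rightarrow> complex" where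
  "conv_moments m 0 = m"
| "conv_moments m (Suc r) = (\<lambda>k. \<Sum>i<k. m i * conv_moments m r (k - Suc i))"

lemma conv_moments_eq_0: "r > k \<Longrightarrow> conv_moments m r k = 0"
proof (induction r arbitrary: k)
  case (Suc r)
  thus ?case by (auto intro!: sum.neutral)
qed simp

lemma nc_sum_conv_moments:
  "nc_sum \<kappa> s 0 (Suc k) = (\<Sum>r\<le>k. \<kappa> (Suc (s + r)) * conv_moments (moments_of_cumulants \<kappa>) r k)"
proof (induction k arbitrary: s rule: less_induct)
  case (less k)
  let ?m = "moments_of_cumulants \<kappa>" and ?c = "conv_moments (moments_of_cumulants \<kappa>)"
  have "(\<Sum>j\<in>{0<..<Suc k}. nc_sum \<kappa> 0 (Suc 0) j * nc_sum \<kappa> (Suc s) j (Suc k)) =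
      (\<Sum>i<k. nc_sum \<kappa> 0 1 (1 + i) * nc_sum \<kappa> (Suc s) (0 + Suc i) (0 + Suc i + (k - i)))"
    by (rule sum.reindex_bij_witness[of _ "\<lambda>i. Suc i" "\<lambda>j. j - 1"]) auto
  also have "\<dots> = (\<Sum>i<k. ?m i * nc_sum \<kappa> (Suc s) 0 (Suc (k - Suc i)))"
  proof (rule sum.cong[OF refl])
    fix i assume "i \<in> {..<k}"
    hence "k - i = Suc (k - Suc i)" by auto
    thus "nc_sum \<kappa> 0 1 (1 + i) * nc_sum \<kappa> (Suc s) (0 + Suc i) (0 + Suc i + (k - i)) =
       ?m i * nc_sum \<kappa> (Suc s) 0 (Suc (k - Suc i))"
      using moments_of_cumulants_nc_sum[of \<kappa> i 1] unfolding nc_sum_shift by simp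
  qed
  also have "\<dots> = (\<Sum>i<k. ?m i * (\<Sum>r<k. \<kappa> (Suc (Suc s + r)) * ?c r (k - Suc i)))"
  proof (rule sum.cong[OF refl])
    fix i assume i: "i \<in> {..<k}"
    have "nc_sum \<kappa> (Suc s) 0 (Suc (k - Suc i)) =
        (\<Sum>r\<le>k - Suc i. \<kappa> (Suc (Suc s + r)) * ?c r (k - Suc i))"
      using i by (intro less) auto
    also have "\<dots> = (\<Sum>r<k. \<kappa> (Suc (Suc s + r)) * ?c r (k - Suc i))"
      using i by (intro sum.mono_neutral_left) (auto simp: conv_moments_eq_0)
    finally show "?m i * nc_sum \<kappa> (Suc s) 0 (Suc (k - Suc i)) =
      ?m i * (\<Sum>r<k. \<kappa> (Suc (Suc s + r)) * ?c r (k - Suc i))" by simp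
  qed
  also have "\<dots> = (\<Sum>r<k. \<kappa> (Suc (s + Suc r)) * ?c (Suc r) k)"
    unfolding sum_distrib_left conv_moments.simps by (subst sum.swap) (simp add: mult_ac)
  finally have "nc_sum \<kappa> s 0 (Suc k) = \<kappa> (Suc s) * ?m k + (\<Sum>r<k. \<kappa> (Suc (s + Suc r)) * ?c (Suc r) k)"
    using moments_of_cumulants_nc_sum[of \<kappa> k 1] by (subst nc_sum_rec) auto
  thus ?case by (simp add: sum.atMost_shift)
qed

lemma moments_of_cumulants_Suc:
  "moments_of_cumulants \<kappa> (Suc k) = (\<Sum>r\<le>k. \<kappa> (Suc r) * conv_moments (moments_of_cumulants \<kappa>) r k)"
  using nc_sum_conv_moments[of \<kappa> 0 k] moments_of_cumulants_nc_sum[of \<kappa> "Suc k" 0] by simp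

text \<open>Sequences of free cumulants can be prescribed freely. The entry at \<open>0\<close> is excluded because blocks are
  nonempty.\<close>

lemma free_cumulant_moments_of_cumulants:
  "n \<ge> 1 \<Longrightarrow> free_cumulant (moments_of_cumulants \<kappa>) n = \<kappa> n"
proof (induction n rule: less_induct)
  case (less n)
  let ?m = "moments_of_cumulants \<kappa>"
  have one: "{{1..n}} \<in> NC n"
    using less.prems by (auto simp: NC_def noncrossing_def intro!: partition_on_space)
  have "(\<Prod>V\<in>\<pi>. free_cumulant ?m (card V)) = (\<Prod>V\<in>\<pi>. \<kappa> (card V))"
    if \<pi>: "\<pi> \<in> NC n" "\<pi> \<noteq> {{1..n}}" for \<pi>
  proof (rule prod.cong[OF refl])
    fix V assume V: "V \<in> \<pi>"
    have \<pi>': "\<pi> \<in> nc_partitions {1..<Suc n}" using \<pi>(1) by (simp add: NC_eq_nc_partitions)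
    have "V \<noteq> {}" "finite V"
      using nc_partitions_nonempty[OF \<pi>' V] finite_subset[OF nc_partitions_subset[OF \<pi>' V]] by auto
    hence "card V \<ge> 1" by (simp add: Suc_leI card_gt_0_iff)
    thus "free_cumulant ?m (card V) = \<kappa> (card V)"
      using less.IH NC_block_less[OF \<pi> V] by blast
  qed
  hence "(\<Sum>\<pi>\<in>{\<pi> \<in> NC n. \<pi> \<noteq> {{1..n}}}. \<Prod>V\<in>\<pi>. free_cumulant ?m (card V)) =
      (\<Sum>\<pi>\<in>NC n - {{{1..n}}}. \<Prod>V\<in>\<pi>. \<kappa> (card V))"
    by (intro sum.cong) auto
  also have "\<dots> = ?m n - \<kappa> n"
    using one by (simp add: sum_diff1 moments_of_cumulants_def)
  finally show ?case by (subst free_cumulant.simps) simp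
qed

text \<open>The series \<open>R(z) / z\<close>. Working with it avoids divisions, in particular when the mean vanishes.\<close>

definition cumulant_series :: "(nat \<Rightarrow> complex) \<Rightarrow> complex fps" where
  "cumulant_series m = Abs_fps (\<lambda>n. free_cumulant m (Suc n))"

lemma R_series_cumulant_series: "R_series m = fps_X * cumulant_series m"
  by (rule fps_ext) (simp add: R_series_def cumulant_series_def)

lemma R_series_compose: "y $ 0 = 0 \<Longrightarrow> R_series m oo y = y * (cumulant_series m oo y)"
  by (simp add: R_series_cumulant_series fps_compose_mult_distrib)

lemma conv_moments_series: "Abs_fps (conv_moments m r) = (fps_X * Abs_fps m) ^ r * Abs_fps m"
proof (induction r)
  case (Suc r)
  have "Abs_fps (conv_moments m (Suc r)) = fps_X * (Abs_fps m * Abs_fps (conv_moments m r))"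
  proof (rule fps_ext)
    fix k
    show "Abs_fps (conv_moments m (Suc r)) $ k = (fps_X * (Abs_fps m * Abs_fps (conv_moments m r))) $ k"
    proof (cases k)
      case (Suc n)
      hence "(fps_X * (Abs_fps m * Abs_fps (conv_moments m r))) $ k =
          (Abs_fps m * Abs_fps (conv_moments m r)) $ n" by simp
      thus ?thesis by (simp add: Suc fps_mult_nth atLeast0AtMost lessThan_Suc_atMost)
    qed simp
  qed
  also have "\<dots> = (fps_X * Abs_fps m) ^ Suc r * Abs_fps m" by (simp add: Suc mult_ac)
  finally show ?case .
qed simp

text \<open>The functional equation \<open>M(z) = 1 + R(z M(z))\<close>.\<close>

lemma moment_series_equation:
  assumes "m 0 = 1"
  shows "Abs_fps m = 1 + fps_X * Abs_fps m * (cumulant_series m oo (fps_X * Abs_fps m))"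
proof -
  have m: "moments_of_cumulants (free_cumulant m) = m" using assms by (rule moments_of_free_cumulant)
  have "Abs_fps m = fps_const (Abs_fps m $ 0) +
      fps_X * ((cumulant_series m oo (fps_X * Abs_fps m)) * Abs_fps m)"
  proof (rule series_of_recursion)
    fix k
    show "Abs_fps m $ Suc k =
        (\<Sum>r\<le>k. cumulant_series m $ r * ((fps_X * Abs_fps m) ^ r * Abs_fps m) $ k)"
      using moments_of_cumulants_Suc[of "free_cumulant m" k]
      by (simp add: m cumulant_series_def flip: conv_moments_series)
  qed simp
  thus ?thesis using assms by (simp add: mult_ac)
qed

lemma cumulant_series_even_cumulant_dist:
  "cumulant_series (even_cumulant_dist m) = Abs_fps (\<lambda>n. free_cumulant m (2 * Suc n))"
  by (simp add: cumulant_series_def even_cumulant_dist_def free_cumulant_moments_of_cumulants)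

section \<open>Noncommutative polynomials and freeness\<close>

lemma dist_eval_zero [simp]: "dist_eval \<phi> 0 = 0"
  by (simp add: dist_eval_def)

lemma dist_eval_add: "dist_eval \<phi> (f + g) = dist_eval \<phi> f + dist_eval \<phi> g"
  unfolding dist_eval_def
  by (rule setsum_keys_plus_distrib[where f = "\<lambda>w c. c * \<phi> w"]) (simp_all add: algebra_simps)

lemma dist_eval_diff: "dist_eval \<phi> (f - g) = dist_eval \<phi> f - dist_eval \<phi> g"
  using dist_eval_add[of \<phi> "f - g" g] by simp

lemma dist_eval_single [simp]: "dist_eval \<phi> (Poly_Mapping.single w c) = c * \<phi> w"
  by (simp add: dist_eval_def)

lemma dist_eval_one [simp]: "dist_eval \<phi> 1 = \<phi> []"
  by (simp add: zero_list_def flip: single_one)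

lemma dist_eval_cong: "(\<And>w. w \<in> Poly_Mapping.keys f \<Longrightarrow> \<phi> w = \<psi> w) \<Longrightarrow> dist_eval \<phi> f = dist_eval \<psi> f"
  by (simp add: dist_eval_def)

lemma dist_eval_functional_add: "dist_eval (\<lambda>w. \<phi> w + \<psi> w) f = dist_eval \<phi> f + dist_eval \<psi> f"
  by (simp add: dist_eval_def sum.distrib algebra_simps)

lemma dist_eval_functional_diff: "dist_eval (\<lambda>w. \<phi> w - \<psi> w) f = dist_eval \<phi> f - dist_eval \<psi> f"
  by (simp add: dist_eval_def sum_subtractf algebra_simps)

lemma dist_eval_functional_mult: "dist_eval (\<lambda>w. c * \<phi> w) f = c * dist_eval \<phi> f"
  by (simp add: dist_eval_def sum_distrib_left mult_ac)

lemma dist_eval_functional_sum: "dist_eval (\<lambda>w. \<Sum>i\<in>I. \<phi> i w) f = (\<Sum>i\<in>I. dist_eval (\<phi> i) f)"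
  unfolding dist_eval_def sum_distrib_left by (rule sum.swap)

lemma dist_eval_swap:
  "dist_eval (\<lambda>u. dist_eval (\<lambda>v. h u v) g) f = dist_eval (\<lambda>v. dist_eval (\<lambda>u. h u v) f) g"
  unfolding dist_eval_def sum_distrib_left
  by (subst sum.swap) (simp add: mult_ac)

lemma ncpoly_induct [case_names zero add_single]:
  fixes f :: "'g ncpoly"
  assumes "P 0" "\<And>f w c. P f \<Longrightarrow> P (f + Poly_Mapping.single w c)"
  shows "P f"
proof (induction f rule: update_induct)
  case (update f a b)
  have "Poly_Mapping.update a b f = f + Poly_Mapping.single a b"
    using update(1) by (intro poly_mapping_eqI)
      (auto simp: lookup_update lookup_add lookup_single when_def in_keys_iff)
  with update assms(2) show ?case by simp
qed fact

text \<open>Values at products become iterated evaluations, which lets the arguments below proceed by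
  functionals on words instead of identities between polynomials.\<close>

lemma dist_eval_mult:
  "dist_eval \<phi> (f * g) = dist_eval (\<lambda>u. dist_eval (\<lambda>v. \<phi> (u @ v)) g) f"
proof (induction f rule: ncpoly_induct)
  case (add_single f w c)
  have "dist_eval \<phi> (Poly_Mapping.single w c * g) = c * dist_eval (\<lambda>v. \<phi> (w @ v)) g"
    by (induction g rule: ncpoly_induct)
      (simp_all add: distrib_left dist_eval_add mult_single plus_list_def)
  with add_single show ?case by (simp add: distrib_right dist_eval_add)
qed simp

text \<open>The component of \<open>f\<close> in the kernel of \<open>\<phi>\<close>, when \<open>\<phi> [] = 1\<close>.\<close>

definition centering :: "('g list \<Rightarrow> complex) \<Rightarrow> 'g ncpoly \<Rightarrow> 'g ncpoly" where
  "centering \<phi> f = f - Poly_Mapping.single [] (dist_eval \<phi> f)"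

lemma dist_eval_centering: "\<phi> [] = 1 \<Longrightarrow> dist_eval \<phi> (centering \<phi> f) = 0"
  by (simp add: centering_def dist_eval_diff)

lemma keys_centering: "Poly_Mapping.keys f \<subseteq> lists A \<Longrightarrow> Poly_Mapping.keys (centering \<phi> f) \<subseteq> lists A"
proof -
  assume f: "Poly_Mapping.keys f \<subseteq> lists A"
  have "Poly_Mapping.keys (Poly_Mapping.single [] (dist_eval \<phi> f)) \<subseteq> lists A" by simp
  with f keys_diff[of f "Poly_Mapping.single [] (dist_eval \<phi> f)"] show ?thesis
    unfolding centering_def by blast
qed

lemma dist_eval_single_mult:
  "dist_eval h (Poly_Mapping.single w c * f) = c * dist_eval (\<lambda>v. h (w @ v)) f"
  "dist_eval h (f * Poly_Mapping.single w c) = c * dist_eval (\<lambda>v. h (v @ w)) f"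
  by (simp_all add: dist_eval_mult dist_eval_functional_mult)

lemma dist_eval_centering_left:
  "dist_eval h (P * Q) = dist_eval h (centering \<phi> P * Q) + dist_eval \<phi> P * dist_eval h Q"
  by (simp add: centering_def left_diff_distrib dist_eval_diff dist_eval_single_mult)

lemma dist_eval_centering_right:
  "dist_eval h (Q * P) = dist_eval h (Q * centering \<phi> P) + dist_eval \<phi> P * dist_eval h Q"
  by (simp add: centering_def right_diff_distrib dist_eval_diff dist_eval_single_mult)

definition alternating_centered ::
    "('g list \<Rightarrow> complex) \<Rightarrow> ('i \<Rightarrow> 'g set) \<Rightarrow> ('i \<times> 'g ncpoly) list \<Rightarrow> bool" where
  "alternating_centered \<phi> G ts \<longleftrightarrow> distinct_adj (map fst ts) \<and>
     (\<forall>t\<in>set ts. Poly_Mapping.keys (snd t) \<subseteq> lists (G (fst t)) \<and> dist_eval \<phi> (snd t) = 0)"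

lemma free_families_altdef:
  "free_families \<phi> G \<longleftrightarrow>
     (\<forall>ts. ts \<noteq> [] \<and> alternating_centered \<phi> G ts \<longrightarrow> dist_eval \<phi> (prod_list (map snd ts)) = 0)"
  by (simp add: free_families_def alternating_centered_def case_prod_beta)

lemma alternating_centered_Nil [simp]: "alternating_centered \<phi> G []"
  by (simp add: alternating_centered_def)

lemma alternating_centered_Cons:
  "alternating_centered \<phi> G ((i, f) # ts) \<longleftrightarrow>
     Poly_Mapping.keys f \<subseteq> lists (G i) \<and> dist_eval \<phi> f = 0 \<and> alternating_centered \<phi> G ts \<and>
     (ts = [] \<or> fst (hd ts) \<noteq> i)"
  by (cases ts) (auto simp: alternating_centered_def)

lemma alternating_centered_append:
  "alternating_centered \<phi> G (xs @ ys) \<longleftrightarrow>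
     alternating_centered \<phi> G xs \<and> alternating_centered \<phi> G ys \<and>
     (xs = [] \<or> ys = [] \<or> fst (last xs) \<noteq> fst (hd ys))"
  unfolding alternating_centered_def map_append distinct_adj_append_iff set_append ball_Un
  by (cases "xs = []"; cases "ys = []") (simp_all add: last_map hd_map conj_ac)

text \<open>Alternating products of centered elements, with the empty product \<open>1\<close> among them, span the algebra
  generated by the families. The span is closed under multiplication by a letter from the left, which
  is what the induction on the word uses.\<close>

lemma functional_vanishing_by_alternating:
  assumes "\<phi> [] = 1"
    and "\<And>ts. alternating_centered \<phi> G ts \<Longrightarrow> dist_eval h (prod_list (map snd ts)) = 0"
    and "w \<in> lists (\<Union>i. G i)"
  shows "h w = 0"
  using assms(3,2)
proof (induction w arbitrary: h)
  case Nil
  from Nil.prems[of "[]"] show ?case by simp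
next
  case (Cons g w)
  then obtain i where g: "g \<in> G i" by auto
  define x where "x = Poly_Mapping.single [g] (1 :: complex)"
  have x: "Poly_Mapping.keys x \<subseteq> lists (G i)" using g by (simp add: x_def)
  show ?case
  proof (rule Cons.IH[of "\<lambda>v. h (g # v)"])
    fix ts assume ts: "alternating_centered \<phi> G ts"
    have "dist_eval (\<lambda>v. h (g # v)) (prod_list (map snd ts)) = dist_eval h (x * prod_list (map snd ts))"
      by (simp add: x_def dist_eval_single_mult)
    also have "\<dots> = 0"
    proof (cases "ts \<noteq> [] \<and> fst (hd ts) = i")
      case False
      with ts x have "alternating_centered \<phi> G ((i, centering \<phi> x) # ts)"
        by (auto simp: alternating_centered_Cons keys_centering dist_eval_centering assms(1))
      from Cons.prems[OF this] Cons.prems[OF ts] show ?thesis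
        by (subst dist_eval_centering_left[of _ _ _ \<phi>]) simp
    next
      case True
      then obtain f ts' where ts': "ts = (i, f) # ts'" by (cases ts) auto
      have "Poly_Mapping.keys (x * f) \<subseteq> lists (G i)"
        using keys_mult[of x f] x ts unfolding ts' alternating_centered_Cons
        by (fastforce simp: plus_list_def)
      with ts have "alternating_centered \<phi> G ((i, centering \<phi> (x * f)) # ts')"
        unfolding ts' alternating_centered_Cons
        by (auto simp: keys_centering dist_eval_centering assms(1))
      from Cons.prems[OF this] have "dist_eval h (centering \<phi> (x * f) * prod_list (map snd ts')) = 0"
        by simp
      moreover have "dist_eval h (prod_list (map snd ts')) = 0"
        using Cons.prems[of ts'] ts by (simp add: ts' alternating_centered_Cons)
      moreover have "x * prod_list (map snd ts) = (x * f) * prod_list (map snd ts')"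
        by (simp add: ts' mult.assoc)
      ultimately show ?thesis using dist_eval_centering_left[of h "x * f" "prod_list (map snd ts')" \<phi>] by simp
    qed
    finally show "dist_eval (\<lambda>v. h (g # v)) (prod_list (map snd ts)) = 0" .
  qed
qed

section \<open>The Schwinger-Dyson equation\<close>

text \<open>The sum of \<open>f(l) g(r)\<close> over all decompositions \<open>w = l x r\<close>, that is \<open>(f \<otimes> g)\<close> applied to the free
  difference quotient of \<open>w\<close> with respect to \<open>x\<close>.\<close>

fun split_conv :: "'g \<Rightarrow> ('g list \<Rightarrow> complex) \<Rightarrow> ('g list \<Rightarrow> complex) \<Rightarrow> 'g list \<Rightarrow> complex" where
  "split_conv x f g [] = 0"
| "split_conv x f g (y # w) = (if y = x then f [] * g w else 0) + split_conv x (\<lambda>v. f (y # v)) g w"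

text \<open>The derivation property of the free difference quotient.\<close>

lemma split_conv_append:
  "split_conv x f g (u @ v) =
     split_conv x f (\<lambda>r. g (r @ v)) u + split_conv x (\<lambda>l. f (u @ l)) g v"
  by (induction u arbitrary: f) simp_all

lemma split_conv_eq_0:
  "(\<And>l r. w = l @ x # r \<Longrightarrow> f l = 0 \<or> g r = 0) \<Longrightarrow> split_conv x f g w = 0"
proof (induction w arbitrary: f)
  case (Cons y w)
  have "split_conv x (\<lambda>v. f (y # v)) g w = 0"
    using Cons.prems[of "y # _"] by (intro Cons.IH) simp
  moreover have "y = x \<Longrightarrow> f [] * g w = 0" using Cons.prems[of "[]" w] by auto
  ultimately show ?case by auto
qed simp

lemma split_conv_dist_eval_right:
  "dist_eval (\<lambda>v. split_conv x f (g v) u) Q = split_conv x f (\<lambda>r. dist_eval (\<lambda>v. g v r) Q) u"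
proof (induction u arbitrary: f)
  case Nil
  show ?case by (simp add: dist_eval_def)
next
  case (Cons y u)
  thus ?case by (cases "y = x") (simp_all add: dist_eval_functional_add dist_eval_functional_mult)
qed

lemma split_conv_dist_eval_left:
  "dist_eval (\<lambda>v. split_conv x (f v) g u) Q = split_conv x (\<lambda>l. dist_eval (\<lambda>v. f v l) Q) g u"
proof (induction u arbitrary: f)
  case Nil
  show ?case by (simp add: dist_eval_def)
next
  case (Cons y u)
  have "dist_eval (\<lambda>v. f v [] * g u) Q = dist_eval (\<lambda>v. f v []) Q * g u"
    using dist_eval_functional_mult[of "g u" "\<lambda>v. f v []" Q] by (simp add: mult.commute)
  with Cons show ?case by (cases "y = x") (simp_all add: dist_eval_functional_add)
qed

text \<open>By the derivation property, a split of a product happens inside one of the factors.\<close>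

lemma split_conv_prod_list_eq_0:
  assumes "\<And>As P Bs. Ps = As @ P # Bs \<Longrightarrow>
      dist_eval (split_conv x (\<lambda>l. dist_eval (\<lambda>u. f (u @ l)) (prod_list As))
                              (\<lambda>r. dist_eval (\<lambda>v. g (r @ v)) (prod_list Bs))) P = 0"
  shows "dist_eval (split_conv x f g) (prod_list Ps) = 0"
  using assms
proof (induction Ps arbitrary: f)
  case (Cons P Ps)
  have "dist_eval (split_conv x f g) (prod_list (P # Ps)) =
      dist_eval (\<lambda>u. dist_eval (\<lambda>v. split_conv x f (\<lambda>r. g (r @ v)) u) (prod_list Ps)) P +
      dist_eval (\<lambda>u. dist_eval (\<lambda>v. split_conv x (\<lambda>l. f (u @ l)) g v) (prod_list Ps)) P"
    by (simp add: dist_eval_mult split_conv_append dist_eval_functional_add)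
  also have "dist_eval (\<lambda>u. dist_eval (\<lambda>v. split_conv x f (\<lambda>r. g (r @ v)) u) (prod_list Ps)) P = 0"
    using Cons.prems[of "[]" P Ps] by (simp add: split_conv_dist_eval_right)
  also have "dist_eval (\<lambda>u. dist_eval (\<lambda>v. split_conv x (\<lambda>l. f (u @ l)) g v) (prod_list Ps)) P =
      dist_eval (split_conv x (\<lambda>l. dist_eval (\<lambda>u. f (u @ l)) P) g) (prod_list Ps)"
    by (subst dist_eval_swap) (simp add: split_conv_dist_eval_left)
  also have "\<dots> = 0"
  proof (rule Cons.IH)
    fix As P' Bs assume Ps: "Ps = As @ P' # Bs"
    have "dist_eval (\<lambda>u. dist_eval (\<lambda>v. f (v @ u @ l)) P) (prod_list As) =
        dist_eval (\<lambda>u. f (u @ l)) (prod_list (P # As))" for l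
      by (subst dist_eval_swap) (simp add: dist_eval_mult)
    with Cons.prems[of "P # As" P' Bs] Ps
    show "dist_eval (split_conv x
        (\<lambda>l. dist_eval (\<lambda>u. dist_eval (\<lambda>v. f (v @ u @ l)) P) (prod_list As))
        (\<lambda>r. dist_eval (\<lambda>v. g (r @ v)) (prod_list Bs))) P' = 0" by simp
  qed
  finally show ?case by simp
qed simp

text \<open>The sum of \<open>\<phi>(w\<^sub>0) \<cdots> \<phi>(w\<^sub>r)\<close> over all decompositions \<open>w = w\<^sub>0 x w\<^sub>1 x \<dots> x w\<^sub>r\<close>.\<close>

primrec split_moment :: "('g list \<Rightarrow> complex) \<Rightarrow> 'g \<Rightarrow> nat \<Rightarrow> 'g list \<Rightarrow> complex" where
  "split_moment \<phi> x 0 = \<phi>"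
| "split_moment \<phi> x (Suc r) = split_conv x \<phi> (split_moment \<phi> x r)"

lemma split_moment_eq_0: "r > length w \<Longrightarrow> split_moment \<phi> x r w = 0"
proof (induction r arbitrary: w)
  case (Suc r)
  have "split_conv x \<phi> (split_moment \<phi> x r) w = 0"
    using Suc by (intro split_conv_eq_0) auto
  thus ?case by simp
qed simp

text \<open>Vanishing on the alternating centered products that involve a family other than the one of \<open>i0\<close>.
  These products span a complement of the algebra generated by that family.\<close>

definition kills_mixed ::
    "('g list \<Rightarrow> complex) \<Rightarrow> ('i \<Rightarrow> 'g set) \<Rightarrow> 'i \<Rightarrow> ('g list \<Rightarrow> complex) \<Rightarrow> bool" where
  "kills_mixed \<phi> G i0 h \<longleftrightarrow>
     (\<forall>ts. alternating_centered \<phi> G ts \<and> (\<exists>t\<in>set ts. fst t \<noteq> i0) \<longrightarrow>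
        dist_eval h (prod_list (map snd ts)) = 0)"

lemma kills_mixedD:
  "kills_mixed \<phi> G i0 h \<Longrightarrow> alternating_centered \<phi> G ts \<Longrightarrow> t \<in> set ts \<Longrightarrow> fst t \<noteq> i0 \<Longrightarrow>
     dist_eval h (prod_list (map snd ts)) = 0"
  by (auto simp: kills_mixed_def)

text \<open>Since the last factor is not from the family of \<open>i0\<close>, the word \<open>w\<close> can be replaced by its centering and
  its mean, and either way the product remains alternating.\<close>

lemma kills_mixed_mult_right:
  assumes h: "kills_mixed \<phi> G i0 h" and one: "\<phi> [] = 1" and w: "w \<in> lists (G i0)"
    and ts: "alternating_centered \<phi> G ts" "ts \<noteq> []" "fst (last ts) \<noteq> i0"
  shows "dist_eval (\<lambda>u. h (u @ w)) (prod_list (map snd ts)) = 0"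
proof -
  define W where "W = Poly_Mapping.single w (1 :: complex)"
  have "alternating_centered \<phi> G (ts @ [(i0, centering \<phi> W)])"
    using ts w keys_centering[of W "G i0" \<phi>]
    by (auto simp: alternating_centered_append alternating_centered_Cons dist_eval_centering one W_def)
  hence "dist_eval h (prod_list (map snd ts) * centering \<phi> W) = 0"
    using kills_mixedD[OF h, of _ "last ts"] ts by fastforce
  moreover have "dist_eval h (prod_list (map snd ts)) = 0"
    using kills_mixedD[OF h, of _ "last ts"] ts by simp
  moreover have "dist_eval (\<lambda>u. h (u @ w)) (prod_list (map snd ts)) =
      dist_eval h (prod_list (map snd ts) * W)"
    by (simp add: W_def dist_eval_single_mult)
  ultimately show ?thesis by (simp add: dist_eval_centering_right[of _ _ W \<phi>])
qed

lemma kills_mixed_mult_left: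
  assumes h: "kills_mixed \<phi> G i0 h" and one: "\<phi> [] = 1" and w: "w \<in> lists (G i0)"
    and ts: "alternating_centered \<phi> G ts" "ts \<noteq> []" "fst (hd ts) \<noteq> i0"
  shows "dist_eval (\<lambda>u. h (w @ u)) (prod_list (map snd ts)) = 0"
proof -
  define W where "W = Poly_Mapping.single w (1 :: complex)"
  have "alternating_centered \<phi> G ((i0, centering \<phi> W) # ts)"
    using ts w keys_centering[of W "G i0" \<phi>]
    by (auto simp: alternating_centered_Cons dist_eval_centering one W_def)
  hence "dist_eval h (centering \<phi> W * prod_list (map snd ts)) = 0"
    using kills_mixedD[OF h, of _ "hd ts"] ts by fastforce
  moreover have "dist_eval h (prod_list (map snd ts)) = 0"
    using kills_mixedD[OF h, of _ "hd ts"] ts by simp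
  moreover have "dist_eval (\<lambda>u. h (w @ u)) (prod_list (map snd ts)) =
      dist_eval h (W * prod_list (map snd ts))"
    by (simp add: W_def dist_eval_single_mult)
  ultimately show ?thesis by (simp add: dist_eval_centering_left[of _ W _ \<phi>])
qed

text \<open>A split takes place in a factor from the family of \<open>i0\<close>. Some other factor belongs to a different
  family; it lies entirely to the left or to the right of the split, and the corresponding functional
  vanishes.\<close>

lemma kills_mixed_split_conv:
  assumes f: "kills_mixed \<phi> G i0 f" and g: "kills_mixed \<phi> G i0 g" and one: "\<phi> [] = 1"
    and x: "\<And>i. i \<noteq> i0 \<Longrightarrow> x \<notin> G i"
  shows "kills_mixed \<phi> G i0 (split_conv x f g)"
  unfolding kills_mixed_def
proof (intro allI impI, elim conjE)
  fix ts assume ts: "alternating_centered \<phi> G ts" and mixed: "\<exists>t\<in>set ts. fst t \<noteq> i0"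
  show "dist_eval (split_conv x f g) (prod_list (map snd ts)) = 0"
  proof (rule split_conv_prod_list_eq_0)
    fix As P Bs assume "map snd ts = As @ P # Bs"
    then obtain xs t ys where dec: "ts = xs @ t # ys" "As = map snd xs" "P = snd t" "Bs = map snd ys"
      by (auto simp: map_eq_append_conv map_eq_Cons_conv)
    have xs: "alternating_centered \<phi> G xs" and ys: "alternating_centered \<phi> G ys"
      and supp: "Poly_Mapping.keys (snd t) \<subseteq> lists (G (fst t))"
      and ends: "xs = [] \<or> fst (last xs) \<noteq> fst t" "ys = [] \<or> fst (hd ys) \<noteq> fst t"
      using ts by (cases t; auto simp: dec alternating_centered_append alternating_centered_Cons)+
    let ?f = "\<lambda>l. dist_eval (\<lambda>u. f (u @ l)) (prod_list As)"
    let ?g = "\<lambda>r. dist_eval (\<lambda>v. g (r @ v)) (prod_list Bs)"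
    have "split_conv x ?f ?g w = 0" if "w \<in> Poly_Mapping.keys P" for w
    proof (rule split_conv_eq_0)
      fix l r assume w: "w = l @ x # r"
      have mem: "l \<in> lists (G (fst t))" "x \<in> G (fst t)" "r \<in> lists (G (fst t))"
        using supp that by (auto simp: dec w)
      hence t: "fst t = i0" using x by blast
      with mixed have "xs \<noteq> [] \<or> ys \<noteq> []" by (auto simp: dec)
      thus "?f l = 0 \<or> ?g r = 0"
        using kills_mixed_mult_right[OF f one _ xs] kills_mixed_mult_left[OF g one _ ys] mem ends
        unfolding t dec by metis
    qed
    thus "dist_eval (split_conv x ?f ?g) P = 0" by (simp add: dist_eval_def)
  qed
qed

lemma kills_mixed_split_moment:
  assumes "free_families \<phi> G" "\<phi> [] = 1" "\<And>i. i \<noteq> i0 \<Longrightarrow> x \<notin> G i"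
  shows "kills_mixed \<phi> G i0 (split_moment \<phi> x r)"
proof (induction r)
  case 0
  show ?case using assms(1) unfolding free_families_altdef kills_mixed_def
    by (metis empty_iff list.set(1) split_moment.simps(1))
next
  case (Suc r)
  moreover have "kills_mixed \<phi> G i0 \<phi>"
    using assms(1) unfolding free_families_altdef kills_mixed_def by (metis empty_iff list.set(1))
  ultimately show ?case using assms by (auto intro: kills_mixed_split_conv)
qed

definition schwinger_dyson :: "('g list \<Rightarrow> complex) \<Rightarrow> 'g \<Rightarrow> (nat \<Rightarrow> complex) \<Rightarrow> 'g list \<Rightarrow> bool" where
  "schwinger_dyson \<phi> x \<kappa> w \<longleftrightarrow>
     \<phi> (x # w) = (\<Sum>r\<le>length w. \<kappa> (Suc r) * split_moment \<phi> x r w)"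

text \<open>Both sides are linear in \<open>w\<close>. They agree on the algebra generated by the family of \<open>x\<close> by assumption,
  and they vanish on alternating centered products that involve another family: the right-hand side by
  the preceding lemmas, the left-hand side because \<open>x\<close> can be absorbed into the first factor.\<close>

theorem schwinger_dyson_free_families:
  assumes free: "free_families \<phi> G" and one: "\<phi> [] = 1"
    and x: "x \<in> G i0" "\<And>i. i \<noteq> i0 \<Longrightarrow> x \<notin> G i"
    and own: "\<And>w. w \<in> lists (G i0) \<Longrightarrow> schwinger_dyson \<phi> x \<kappa> w"
    and w: "w \<in> lists (\<Union>i. G i)"
  shows "schwinger_dyson \<phi> x \<kappa> w"
proof -
  define S where "S = (\<lambda>w. \<Sum>r\<le>length w. \<kappa> (Suc r) * split_moment \<phi> x r w)"
  define X where "X = Poly_Mapping.single [x] (1 :: complex)"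
  have freeD: "dist_eval \<phi> (prod_list (map snd ts)) = 0" if "alternating_centered \<phi> G ts" "ts \<noteq> []" for ts
    using free that by (auto simp: free_families_altdef)
  \<comment> \<open>Spanning by alternating products is applied to the difference of the two sides.\<close>
  have "\<phi> (x # w) - S w = 0"
  proof (rule functional_vanishing_by_alternating[where \<phi> = \<phi> and G = G and h = "\<lambda>w. \<phi> (x # w) - S w", OF one _ w])
    fix ts assume ts: "alternating_centered \<phi> G ts"
    have split: "dist_eval (\<lambda>w. \<phi> (x # w) - S w) f = dist_eval \<phi> (X * f) - dist_eval S f" for f
      by (simp add: dist_eval_functional_diff X_def dist_eval_single_mult)
    show "dist_eval (\<lambda>w. \<phi> (x # w) - S w) (prod_list (map snd ts)) = 0"
    proof (cases "\<exists>t\<in>set ts. fst t \<noteq> i0")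
      case False
      have "Poly_Mapping.keys (prod_list (map snd ts)) \<subseteq> lists (G i0)"
      proof (cases ts)
        case Nil
        thus ?thesis by (simp add: zero_list_def)
      next
        case (Cons t ts')
        have "ts' = []"
        proof (rule ccontr)
          assume "ts' \<noteq> []"
          then obtain t' ts'' where "ts' = t' # ts''" by (cases ts') auto
          with ts Cons False show False by (cases t) (auto simp: alternating_centered_Cons)
        qed
        with ts Cons False show ?thesis by (cases t) (auto simp: alternating_centered_Cons)
      qed
      hence "\<phi> (x # w) - S w = 0" if "w \<in> Poly_Mapping.keys (prod_list (map snd ts))" for w
        using own[of w] that by (auto simp: schwinger_dyson_def S_def)
      thus ?thesis by (simp add: dist_eval_def)
    next
      case True
      let ?Q = "prod_list (map snd ts)"
      \<comment> \<open>The number of terms of \<open>S w\<close> depends on \<open>w\<close>; a common bound makes it linear on \<open>?Q\<close>.\<close>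
      have "finite (length ` Poly_Mapping.keys ?Q)" by simp
      then obtain K where K: "\<And>w. w \<in> Poly_Mapping.keys ?Q \<Longrightarrow> length w \<le> K"
        by (metis finite_nat_set_iff_bounded_le image_eqI)
      have "dist_eval S ?Q = dist_eval (\<lambda>w. \<Sum>r\<le>K. \<kappa> (Suc r) * split_moment \<phi> x r w) ?Q"
        unfolding S_def
      proof (rule dist_eval_cong)
        fix w assume "w \<in> Poly_Mapping.keys ?Q"
        with K have "length w \<le> K" by blast
        thus "(\<Sum>r\<le>length w. \<kappa> (Suc r) * split_moment \<phi> x r w) =
              (\<Sum>r\<le>K. \<kappa> (Suc r) * split_moment \<phi> x r w)"
          by (intro sum.mono_neutral_left) (auto simp: split_moment_eq_0)
      qed
      also have "\<dots> = (\<Sum>r\<le>K. \<kappa> (Suc r) * dist_eval (split_moment \<phi> x r) ?Q)"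
        by (simp add: dist_eval_functional_sum dist_eval_functional_mult)
      also have "\<dots> = 0"
        using kills_mixed_split_moment[OF free one x(2)] ts True
        by (intro sum.neutral) (auto simp: kills_mixed_def)
      finally have S: "dist_eval S ?Q = 0" .
      have X: "Poly_Mapping.keys X \<subseteq> lists (G i0)" using x by (simp add: X_def)
      have ne: "ts \<noteq> []" using True by auto
      have "dist_eval \<phi> (X * ?Q) = 0"
      proof (cases "fst (hd ts) = i0")
        case False
        with ts X have "alternating_centered \<phi> G ((i0, centering \<phi> X) # ts)"
          by (auto simp: alternating_centered_Cons keys_centering dist_eval_centering one)
        from freeD[OF this] freeD[OF ts ne] show ?thesis
          by (subst dist_eval_centering_left[of _ _ _ \<phi>]) simp
      next
        case hd: True
        then obtain f ts' where ts': "ts = (i0, f) # ts'" using ne by (cases ts) auto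
        have "ts' \<noteq> []" using True by (auto simp: ts')
        have "Poly_Mapping.keys (X * f) \<subseteq> lists (G i0)"
          using keys_mult[of X f] X ts unfolding ts' alternating_centered_Cons
          by (fastforce simp: plus_list_def)
        with ts have "alternating_centered \<phi> G ((i0, centering \<phi> (X * f)) # ts')"
          unfolding ts' alternating_centered_Cons
          by (auto simp: keys_centering dist_eval_centering one)
        from freeD[OF this] have "dist_eval \<phi> (centering \<phi> (X * f) * prod_list (map snd ts')) = 0"
          by simp
        moreover have "dist_eval \<phi> (prod_list (map snd ts')) = 0"
          using freeD[of ts'] ts \<open>ts' \<noteq> []\<close> by (simp add: ts' alternating_centered_Cons)
        moreover have "X * ?Q = (X * f) * prod_list (map snd ts')"
          by (simp add: ts' mult.assoc)
        ultimately show ?thesis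
          using dist_eval_centering_left[of \<phi> "X * f" "prod_list (map snd ts')" \<phi>] by simp
      qed
      with S show ?thesis by (simp add: split)
    qed
  qed
  thus ?thesis by (simp add: schwinger_dyson_def S_def)
qed

lemma split_conv_replicate:
  "split_conv x f g (replicate k x) =
     (\<Sum>i<k. f (replicate i x) * g (replicate (k - Suc i) x))"
proof (induction k arbitrary: f)
  case (Suc k)
  show ?case by (subst sum.lessThan_Suc_shift) (simp add: Suc)
qed simp

lemma split_moment_replicate:
  "split_moment \<phi> x r (replicate k x) = conv_moments (\<lambda>k. \<phi> (replicate k x)) r k"
  by (induction r arbitrary: k) (simp_all add: split_conv_replicate)

text \<open>On powers of \<open>x\<close> this is the moment-cumulant formula.\<close>

lemma schwinger_dyson_replicate:
  assumes "\<phi> [] = 1"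
  shows "schwinger_dyson \<phi> x (free_cumulant (\<lambda>k. \<phi> (replicate k x))) (replicate k x)"
proof -
  define m where "m = (\<lambda>k. \<phi> (replicate k x))"
  have m: "moments_of_cumulants (free_cumulant m) = m"
    using assms by (intro moments_of_free_cumulant) (simp add: m_def)
  have "\<phi> (x # replicate k x) = m (Suc k)" by (simp add: m_def)
  also have "\<dots> = (\<Sum>r\<le>k. free_cumulant m (Suc r) * conv_moments m r k)"
    using moments_of_cumulants_Suc[of "free_cumulant m" k] by (simp add: m)
  finally show ?thesis
    by (simp add: schwinger_dyson_def split_moment_replicate m_def)
qed

corollary schwinger_dyson_free_variables:
  assumes free: "free_families \<phi> G" and one: "\<phi> [] = 1"
    and x: "G i0 = {x}" "\<And>i. i \<noteq> i0 \<Longrightarrow> x \<notin> G i"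
    and w: "w \<in> lists (\<Union>i. G i)"
  shows "schwinger_dyson \<phi> x (free_cumulant (\<lambda>k. \<phi> (replicate k x))) w"
proof (rule schwinger_dyson_free_families[OF free one _ x(2) _ w])
  fix w assume "w \<in> lists (G i0)"
  hence "w = replicate (length w) x"
    unfolding x(1) by (induction w) auto
  with schwinger_dyson_replicate[where \<phi> = \<phi> and x = x and k = "length w"] one
  show "schwinger_dyson \<phi> x (free_cumulant (\<lambda>k. \<phi> (replicate k x))) w" by simp
qed (use x in auto)

lemma split_conv_map:
  "inj h \<Longrightarrow> split_conv (h x) f g (map h w) = split_conv x (\<lambda>v. f (map h v)) (\<lambda>v. g (map h v)) w"
  by (induction w arbitrary: f) (auto simp: inj_eq)

lemma split_moment_map:
  "inj h \<Longrightarrow> split_moment \<phi> (h x) r (map h w) = split_moment (\<lambda>v. \<phi> (map h v)) x r w"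
  by (induction r arbitrary: w) (simp_all add: split_conv_map)

lemma schwinger_dyson_map:
  "inj h \<Longrightarrow> schwinger_dyson (\<lambda>v. \<phi> (map h v)) x \<kappa> w \<Longrightarrow> schwinger_dyson \<phi> (h x) \<kappa> (map h w)"
  by (simp add: schwinger_dyson_def split_moment_map)

text \<open>Applied twice, the extension theorem avoids the associativity of freeness: from powers of \<open>x\<close> to
  words in the variables \<open>Inl v\<close>, and from there to all words.\<close>

lemma schwinger_dyson_two_level:
  fixes \<phi> :: "('u + 'v) list \<Rightarrow> complex"
  assumes one: "\<phi> [] = 1"
    and free: "free_families \<phi> (\<lambda>b :: bool. if b then range Inl else range Inr)"
    and free_Inl: "free_families (\<lambda>w. \<phi> (map Inl w)) (\<lambda>v. {v})"
  shows "schwinger_dyson \<phi> (Inl x) (free_cumulant (\<lambda>k. \<phi> (replicate k (Inl x)))) w"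
proof (rule schwinger_dyson_free_families[where ?i0.0 = True, OF free])
  fix w :: "('u + 'v) list" assume "w \<in> lists (if True then range Inl else range Inr)"
  hence "set w \<subseteq> range Inl" by auto
  then obtain v where v: "w = map Inl v" by (metis ex_map_conv subsetD rangeE)
  have "schwinger_dyson (\<lambda>w. \<phi> (map Inl w)) x
      (free_cumulant (\<lambda>k. \<phi> (map Inl (replicate k x)))) v"
    by (rule schwinger_dyson_free_variables[where G = "\<lambda>v. {v}" and ?i0.0 = x, OF free_Inl])
      (use one in auto)
  from schwinger_dyson_map[of Inl \<phi> x, OF _ this]
  show "schwinger_dyson \<phi> (Inl x) (free_cumulant (\<lambda>k. \<phi> (replicate k (Inl x)))) w"
    by (simp add: v map_replicate)
next
  have "y \<in> (\<Union>b :: bool. if b then range Inl else range Inr)" for y :: "'u + 'v"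
    by (cases y) (auto intro: exI[of _ True] exI[of _ False])
  thus "w \<in> lists (\<Union>b :: bool. if b then range Inl else range Inr)" by blast
qed (use one in auto)

section \<open>Free products\<close>

text \<open>The free product of vector spaces has as a basis the alternating words in the centered powers
  \<open>x\<^sub>b\<^sup>k - \<mu>\<^sub>b(k)\<close>, \<open>k \<ge> 1\<close>; such a word is the list \<open>\<sigma>\<close> of its pairs \<open>(b, k)\<close>. Left multiplication by \<open>x\<^sub>g\<close> is
  a linear operator on this space, and \<open>free_step \<mu> h g\<close> is the covector \<open>h\<close> composed with it. The middle
  case expands \<open>x (x\<^sup>k - \<mu>(k))\<close> in centered powers.\<close>

definition free_step ::
    "('i \<Rightarrow> nat \<Rightarrow> complex) \<Rightarrow> (('i \<times> nat) list \<Rightarrow> complex) \<Rightarrow> 'i \<Rightarrow> ('i \<times> nat) list \<Rightarrow> complex" where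
  "free_step \<mu> h g \<sigma> = (case \<sigma> of
      [] \<Rightarrow> h [(g, 1)] + \<mu> g 1 * h []
    | (b, k) # \<tau> \<Rightarrow>
        if b = g then h ((b, Suc k) # \<tau>) - \<mu> b k * h ((b, 1) # \<tau>) + (\<mu> b (Suc k) - \<mu> b k * \<mu> b 1) * h \<tau>
        else h ((g, 1) # \<sigma>) + \<mu> g 1 * h \<sigma>)"

text \<open>The covector \<open>\<sigma> \<mapsto>\<close> coefficient of the empty word in \<open>w \<cdot> \<sigma>\<close>; at \<open>\<sigma> = []\<close> it is the free product
  functional.\<close>

definition free_covector :: "('i \<Rightarrow> nat \<Rightarrow> complex) \<Rightarrow> 'i list \<Rightarrow> ('i \<times> nat) list \<Rightarrow> complex" where
  "free_covector \<mu> = foldl (free_step \<mu>) (\<lambda>\<sigma>. if \<sigma> = [] then 1 else 0)"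

lemma free_step_power:
  assumes "\<mu> b 0 = 1" "\<sigma> = [] \<or> fst (hd \<sigma>) \<noteq> b"
  shows "foldl (free_step \<mu>) h (replicate k b) \<sigma> =
           (if k = 0 then 0 else h ((b, k) # \<sigma>)) + \<mu> b k * h \<sigma>"
proof (induction k arbitrary: h)
  case (Suc k)
  have "free_step \<mu> h b \<sigma> = h ((b, 1) # \<sigma>) + \<mu> b 1 * h \<sigma>"
    using assms(2) by (auto simp: free_step_def split: list.split)
  moreover have "free_step \<mu> h b ((b, k) # \<sigma>) =
      h ((b, Suc k) # \<sigma>) - \<mu> b k * h ((b, 1) # \<sigma>) + (\<mu> b (Suc k) - \<mu> b k * \<mu> b 1) * h \<sigma>"
    by (simp add: free_step_def)
  ultimately show ?case using assms(1) by (cases "k = 0") (simp_all add: Suc algebra_simps)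
qed (use assms in simp)

lemma lists_singleton_replicate: "w \<in> lists {b} \<Longrightarrow> w = replicate (length w) b"
  by (induction w) auto

text \<open>Multiplying from the left, each centered factor lengthens a basis word that starts with a different
  variable, so the empty word is never reached.\<close>

lemma free_covector_vanishes:
  assumes \<mu>: "\<And>i. \<mu> i 0 = 1"
    and "alternating_centered (\<lambda>w. free_covector \<mu> w []) (\<lambda>i. {i}) ts"
    and "if ts = [] then \<sigma> \<noteq> [] else \<sigma> = [] \<or> fst (hd \<sigma>) \<noteq> fst (last ts)"
  shows "dist_eval (\<lambda>w. free_covector \<mu> w \<sigma>) (prod_list (map snd ts)) = 0"
  using assms(2,3)
proof (induction ts arbitrary: \<sigma> rule: rev_induct)
  case Nil
  thus ?case by (simp add: free_covector_def)
next
  case (snoc t ts)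
  obtain b a where t: "t = (b, a)" by (cases t)
  let ?\<phi> = "\<lambda>w. free_covector \<mu> w []"
  have ts: "alternating_centered ?\<phi> (\<lambda>i. {i}) ts" and a: "Poly_Mapping.keys a \<subseteq> lists {b}" "dist_eval ?\<phi> a = 0"
    and last: "ts = [] \<or> fst (last ts) \<noteq> b" and \<sigma>: "\<sigma> = [] \<or> fst (hd \<sigma>) \<noteq> b"
    using snoc.prems by (auto simp: alternating_centered_append alternating_centered_Cons t)
  have "dist_eval (\<lambda>v. free_covector \<mu> (u @ v) \<sigma>) a =
      dist_eval (\<lambda>v. if v = [] then 0 else free_covector \<mu> u ((b, length v) # \<sigma>)) a" for u
  proof -
    let ?h = "free_covector \<mu> u"
    have "dist_eval (\<lambda>v. free_covector \<mu> (u @ v) \<sigma>) a =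
        dist_eval (\<lambda>v. (if v = [] then 0 else ?h ((b, length v) # \<sigma>)) + ?h \<sigma> * ?\<phi> v) a"
    proof (rule dist_eval_cong)
      fix v assume "v \<in> Poly_Mapping.keys a"
      hence v: "v = replicate (length v) b" using a(1) by (intro lists_singleton_replicate) blast
      have "free_covector \<mu> (u @ v) \<sigma> = foldl (free_step \<mu>) ?h (replicate (length v) b) \<sigma>"
        by (subst v) (simp add: free_covector_def)
      also have "\<dots> = (if v = [] then 0 else ?h ((b, length v) # \<sigma>)) + \<mu> b (length v) * ?h \<sigma>"
        by (subst free_step_power) (use \<mu> \<sigma> in auto)
      also have "?\<phi> v = \<mu> b (length v)"
        by (subst v, unfold free_covector_def, subst free_step_power) (use \<mu> in auto)
      hence "\<mu> b (length v) = ?\<phi> v" by simp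
      finally show "free_covector \<mu> (u @ v) \<sigma> =
          (if v = [] then 0 else ?h ((b, length v) # \<sigma>)) + ?h \<sigma> * ?\<phi> v" by (simp add: mult.commute)
    qed
    thus ?thesis by (simp add: dist_eval_functional_add dist_eval_functional_mult a(2))
  qed
  hence "dist_eval (\<lambda>w. free_covector \<mu> w \<sigma>) (prod_list (map snd (ts @ [t]))) =
      dist_eval (\<lambda>v. dist_eval (\<lambda>u. if v = [] then 0 else free_covector \<mu> u ((b, length v) # \<sigma>))
                       (prod_list (map snd ts))) a"
    by (subst dist_eval_swap) (simp add: t dist_eval_mult)
  also have "\<dots> = dist_eval (\<lambda>v. 0) a"
  proof (rule dist_eval_cong)
    fix v
    have "dist_eval (\<lambda>u. free_covector \<mu> u ((b, length v) # \<sigma>)) (prod_list (map snd ts)) = 0"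
      using last by (intro snoc.IH[OF ts]) auto
    thus "dist_eval (\<lambda>u. if v = [] then 0 else free_covector \<mu> u ((b, length v) # \<sigma>))
        (prod_list (map snd ts)) = 0"
      by (cases "v = []") (simp_all add: dist_eval_def)
  qed
  finally show ?case by (simp add: dist_eval_def)
qed

lemma free_product_exists:
  fixes \<mu> :: "'i \<Rightarrow> nat \<Rightarrow> complex"
  assumes "\<And>i. \<mu> i 0 = 1"
  shows "\<exists>\<phi>. \<phi> [] = 1 \<and> free_families \<phi> (\<lambda>i. {i}) \<and> (\<forall>i k. \<phi> (replicate k i) = \<mu> i k)"
proof (intro exI conjI allI)
  let ?\<phi> = "\<lambda>w. free_covector \<mu> w []"
  show "?\<phi> [] = 1" by (simp add: free_covector_def)
  show "free_families ?\<phi> (\<lambda>i. {i})"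
    unfolding free_families_altdef using free_covector_vanishes[of \<mu> _ "[]"] assms by auto
  show "?\<phi> (replicate k i) = \<mu> i k" for i k
    unfolding free_covector_def by (subst free_step_power) (use assms in auto)
qed

lemma split_conv_cong:
  "(\<And>l r. w = l @ x # r \<Longrightarrow> f l = f' l \<and> g r = g' r) \<Longrightarrow> split_conv x f g w = split_conv x f' g' w"
proof (induction w arbitrary: f f')
  case (Cons y w)
  have "split_conv x (\<lambda>v. f (y # v)) g w = split_conv x (\<lambda>v. f' (y # v)) g' w"
    using Cons.prems[of "y # _"] by (intro Cons.IH) simp
  moreover have "y = x \<Longrightarrow> f [] = f' [] \<and> g w = g' w" using Cons.prems[of "[]" w] by auto
  ultimately show ?case by auto
qed simp

text \<open>The Schwinger-Dyson equation expresses the value at a word by values at shorter words.\<close>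

lemma free_product_unique:
  assumes "free_families \<phi> (\<lambda>i. {i})" "free_families \<phi>' (\<lambda>i. {i})" "\<phi> [] = 1" "\<phi>' [] = 1"
    and eq: "\<And>i k. \<phi> (replicate k i) = \<phi>' (replicate k i)"
  shows "\<phi> w = \<phi>' w"
proof (induction "length w" arbitrary: w rule: less_induct)
  case less
  show ?case
  proof (cases w)
    case (Cons x v)
    have "split_moment \<phi> x r u = split_moment \<phi>' x r u" if "length u \<le> length v" for r u
      using that
    proof (induction r arbitrary: u)
      case 0
      thus ?case using less[of u] Cons by simp
    next
      case (Suc r)
      have "split_conv x \<phi> (split_moment \<phi> x r) u = split_conv x \<phi>' (split_moment \<phi>' x r) u"
        using Suc less Cons by (intro split_conv_cong) auto
      thus ?case by simp
    qed
    moreover have sd: "schwinger_dyson \<psi> x (free_cumulant (\<lambda>k. \<psi> (replicate k x))) v"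
      if "free_families \<psi> (\<lambda>i. {i})" "\<psi> [] = 1" for \<psi>
      by (rule schwinger_dyson_free_variables[where G = "\<lambda>i. {i}" and ?i0.0 = x, OF that]) auto
    note sd[OF assms(1,3)] sd[OF assms(2,4)]
    ultimately show ?thesis by (simp add: Cons schwinger_dyson_def eq)
  qed (use assms in simp)
qed

lemma free_mult_conv_eq:
  assumes "\<phi> [] = 1" "free_families \<phi> (\<lambda>b :: bool. {b})"
    and "\<And>k. \<phi> (replicate k True) = \<mu> k" "\<And>k. \<phi> (replicate k False) = \<nu> k"
  shows "\<mu> \<boxtimes> \<nu> = (\<lambda>k. \<phi> (concat (replicate k [True, False])))"
  unfolding free_mult_conv_def
proof (rule the_equality)
  show "\<exists>\<phi>'. \<phi>' [] = 1 \<and> free_families \<phi>' (\<lambda>b :: bool. {b}) \<and>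
      (\<forall>k. \<phi>' (replicate k True) = \<mu> k) \<and> (\<forall>k. \<phi>' (replicate k False) = \<nu> k) \<and>
      (\<forall>k. \<phi> (concat (replicate k [True, False])) = \<phi>' (concat (replicate k [True, False])))"
    using assms by blast
next
  fix \<rho>
  assume "\<exists>\<phi>'. \<phi>' [] = 1 \<and> free_families \<phi>' (\<lambda>b :: bool. {b}) \<and>
      (\<forall>k. \<phi>' (replicate k True) = \<mu> k) \<and> (\<forall>k. \<phi>' (replicate k False) = \<nu> k) \<and>
      (\<forall>k. \<rho> k = \<phi>' (concat (replicate k [True, False])))"
  then obtain \<phi>' where \<phi>': "\<phi>' [] = 1" "free_families \<phi>' (\<lambda>b :: bool. {b})"
      "\<And>k. \<phi>' (replicate k True) = \<mu> k" "\<And>k. \<phi>' (replicate k False) = \<nu> k"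
      "\<And>k. \<rho> k = \<phi>' (concat (replicate k [True, False]))" by blast
  have "\<phi>' (replicate k i) = \<phi> (replicate k i)" for i k
    using \<phi>'(3,4) assms(3,4) by (cases i) simp_all
  hence "\<phi>' w = \<phi> w" for w
    using free_product_unique[OF \<phi>'(2) assms(2)] \<phi>'(1) assms(1) by blast
  thus "\<rho> = (\<lambda>k. \<phi> (concat (replicate k [True, False])))" using \<phi>'(5) by auto
qed

section \<open>Generating series of segments of a periodic word\<close>

text \<open>The subword of length \<open>k\<close>, starting at time \<open>a\<close>, of the infinite word with letters \<open>c t\<close> and separators
  \<open>d t\<close>; both ends carry their separator, and \<open>k\<close> counts the letters only.\<close>

primrec seg :: "(nat \<Rightarrow> 'g list) \<Rightarrow> (nat \<Rightarrow> 'g) \<Rightarrow> nat \<Rightarrow> nat \<Rightarrow> 'g list" where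
  "seg d c 0 a = d a"
| "seg d c (Suc k) a = d a @ c a # seg d c k (Suc a)"

lemma seg_snoc: "seg d c (Suc k) a = seg d c k a @ c (a + k) # d (Suc (a + k))"
proof (induction k arbitrary: a)
  case (Suc k)
  have "seg d c (Suc (Suc k)) a = d a @ c a # seg d c (Suc k) (Suc a)" by simp
  also have "\<dots> = d a @ c a # (seg d c k (Suc a) @ c (Suc a + k) # d (Suc (Suc a + k)))"
    by (simp only: Suc)
  also have "\<dots> = seg d c (Suc k) a @ c (a + Suc k) # d (Suc (a + Suc k))" by simp
  finally show ?case .
qed simp

lemma seg_hd: "\<exists>v. seg d c k a = d a @ v"
  and seg_last: "\<exists>v. seg d c k a = v @ d (a + k)"
proof -
  show "\<exists>v. seg d c k a = d a @ v" by (cases k) auto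
  show "\<exists>v. seg d c k a = v @ d (a + k)"
  proof (cases k)
    case (Suc n)
    thus ?thesis by (intro exI[of _ "seg d c n a @ [c (a + n)]"]) (simp add: seg_snoc del: seg.simps)
  qed simp
qed

lemma seg_periodic:
  assumes "\<And>t. d (t + m) = d t" "\<And>t. c (t + m) = c t"
  shows "seg d c k (a + m) = seg d c k a"
proof (induction k arbitrary: a)
  case (Suc k)
  from Suc[of "Suc a"] show ?case by (simp add: assms)
qed (simp add: assms)

text \<open>The effect of \<open>split_conv\<close> on segments: a segment is cut at the times that satisfy \<open>S\<close>.\<close>

definition path_conv ::
    "(nat \<Rightarrow> bool) \<Rightarrow> (nat \<Rightarrow> nat \<Rightarrow> complex) \<Rightarrow> (nat \<Rightarrow> nat \<Rightarrow> complex) \<Rightarrow> nat \<Rightarrow> nat \<Rightarrow> complex" where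
  "path_conv S f g a k = (\<Sum>i<k. if S (a + i) then f a i * g (Suc (a + i)) (k - Suc i) else 0)"

primrec path_split :: "(nat \<Rightarrow> nat \<Rightarrow> complex) \<Rightarrow> (nat \<Rightarrow> bool) \<Rightarrow> nat \<Rightarrow> nat \<Rightarrow> nat \<Rightarrow> complex" where
  "path_split f S 0 = f"
| "path_split f S (Suc r) = path_conv S f (path_split f S r)"

lemma path_split_eq_0: "r > k \<Longrightarrow> path_split f S r a k = 0"
proof (induction r arbitrary: a k)
  case (Suc r)
  thus ?case by (auto simp: path_conv_def intro!: sum.neutral)
qed simp

lemma split_conv_seg:
  assumes "\<And>t. x \<notin> set (d t)"
  shows "split_conv x F G (seg d c k a) =
    (\<Sum>i<k. if c (a + i) = x then F (seg d c i a) * G (seg d c (k - Suc i) (Suc (a + i))) else 0)"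
proof (induction k arbitrary: a F)
  case 0
  have "split_conv x F G (d a) = 0"
    by (rule split_conv_eq_0) (use assms[of a] in auto)
  thus ?case by simp
next
  case (Suc k)
  have "split_conv x F (\<lambda>r. G (r @ c a # seg d c k (Suc a))) (d a) = 0"
    by (rule split_conv_eq_0) (use assms[of a] in auto)
  thus ?case by (subst sum.lessThan_Suc_shift) (simp add: split_conv_append Suc cong: if_cong)
qed

lemma split_moment_seg:
  assumes "\<And>t. x \<notin> set (d t)"
  shows "split_moment \<phi> x r (seg d c k a) = path_split (\<lambda>a k. \<phi> (seg d c k a)) (\<lambda>t. c t = x) r a k"
  by (induction r arbitrary: a k) (simp_all add: split_conv_seg[OF assms] path_conv_def cong: if_cong)

lemma length_seg: "length (seg d c k a) \<ge> k"
  by (induction k arbitrary: a) (simp_all add: le_SucI trans_le_add2)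

lemma schwinger_dyson_seg:
  assumes "schwinger_dyson \<phi> x \<kappa> (seg d c k a)" "\<And>t. x \<notin> set (d t)"
  shows "\<phi> (x # seg d c k a) =
    (\<Sum>r\<le>k. \<kappa> (Suc r) * path_split (\<lambda>a k. \<phi> (seg d c k a)) (\<lambda>t. c t = x) r a k)"
proof -
  have "\<phi> (x # seg d c k a) =
    (\<Sum>r\<le>length (seg d c k a). \<kappa> (Suc r) * path_split (\<lambda>a k. \<phi> (seg d c k a)) (\<lambda>t. c t = x) r a k)"
    using assms by (simp add: schwinger_dyson_def split_moment_seg)
  also have "\<dots> = (\<Sum>r\<le>k. \<kappa> (Suc r) * path_split (\<lambda>a k. \<phi> (seg d c k a)) (\<lambda>t. c t = x) r a k)"
    using length_seg[of k d c a] by (intro sum.mono_neutral_right) (auto simp: path_split_eq_0)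
  finally show ?thesis .
qed

text \<open>The generating series, by length, of the segments that start at time \<open>a\<close> and end at a time congruent to
  \<open>e\<close> modulo the period.\<close>

definition class_series :: "nat \<Rightarrow> (nat \<Rightarrow> nat \<Rightarrow> complex) \<Rightarrow> nat \<Rightarrow> nat \<Rightarrow> complex fps" where
  "class_series m f a e = Abs_fps (\<lambda>k. if (a + k) mod m = e then f a k else 0)"

lemma if_times_swap: "(if A = e then x else 0) * y = (if e = A then x * y else (0 :: complex))"
  by auto

text \<open>Cutting at a time in the class \<open>e'\<close> factorises a segment; by periodicity the second factor depends on
  that class only. The factor \<open>X\<close> accounts for the letter at the cut.\<close>

lemma class_series_path_conv:
  assumes m: "m > 0" and S: "\<And>t. S (t mod m) = S t" and g: "\<And>t k. g (Suc (t mod m)) k = g (Suc t) k"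
  shows "class_series m (path_conv S f g) a e =
    fps_X * (\<Sum>e'\<in>{e'\<in>{..<m}. S e'}. class_series m f a e' * class_series m g (Suc e') e)"
    (is "_ = fps_X * ?R")
proof (rule fps_ext)
  fix k
  show "class_series m (path_conv S f g) a e $ k = (fps_X * ?R) $ k"
  proof (cases k)
    case 0
    thus ?thesis by (simp add: class_series_def path_conv_def)
  next
    case (Suc n)
    have "(fps_X * ?R) $ k = ?R $ n" by (simp add: Suc)
    also have "\<dots> = (\<Sum>e'\<in>{e'\<in>{..<m}. S e'}. \<Sum>i\<le>n.
        (if (a + i) mod m = e' then f a i else 0) *
        (if (Suc e' + (n - i)) mod m = e then g (Suc e') (n - i) else 0))"
      by (simp add: fps_sum_nth fps_mult_nth class_series_def atLeast0AtMost)
    also have "\<dots> = (\<Sum>i\<le>n. \<Sum>e'\<in>{e'\<in>{..<m}. S e'}. if e' = (a + i) mod m then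
        f a i * (if (Suc e' + (n - i)) mod m = e then g (Suc e') (n - i) else 0) else 0)"
      by (subst sum.swap, intro sum.cong refl) (rule if_times_swap)
    also have "\<dots> = (\<Sum>i\<le>n. if S (a + i) then
        f a i * (if (Suc ((a + i) mod m) + (n - i)) mod m = e then g (Suc ((a + i) mod m)) (n - i) else 0) else 0)"
      using m by (intro sum.cong refl, subst sum.delta) (auto simp: S)
    also have "\<dots> = (\<Sum>i\<le>n. if S (a + i) then
        f a i * (if (a + k) mod m = e then g (Suc (a + i)) (n - i) else 0) else 0)"
    proof (intro sum.cong refl)
      fix i assume "i \<in> {..n}"
      hence *: "Suc (a + i) + (n - i) = a + k" using Suc by auto
      have "(Suc ((a + i) mod m) + (n - i)) mod m = (Suc (a + i) + (n - i)) mod m"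
        by (metis mod_Suc_eq mod_add_left_eq)
      thus "(if S (a + i) then f a i * (if (Suc ((a + i) mod m) + (n - i)) mod m = e
            then g (Suc ((a + i) mod m)) (n - i) else 0) else 0) =
          (if S (a + i) then f a i * (if (a + k) mod m = e then g (Suc (a + i)) (n - i) else 0) else 0)"
        unfolding * g by simp
    qed
    also have "\<dots> = class_series m (path_conv S f g) a e $ k"
      by (auto simp: class_series_def path_conv_def Suc lessThan_Suc_atMost intro!: sum.cong sum.neutral)
    finally show ?thesis ..
  qed
qed

lemma path_split_periodic:
  assumes S: "\<And>t. S (t + m) = S t" and f: "\<And>a k. f (a + m) k = f a k"
  shows "path_split f S r (a + m) k = path_split f S r a k"
proof (induction r arbitrary: a k)
  case 0
  show ?case by (simp add: f)
next
  case (Suc r)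
  have "a + m + i = a + i + m" for i by simp
  hence "S (a + m + i) = S (a + i)" for i using S by metis
  moreover have "path_split f S r (Suc (a + m + i)) k = path_split f S r (Suc (a + i)) k" for i k
    using Suc[of "Suc (a + i)" k] by (simp add: add_ac)
  ultimately show ?case by (simp add: path_conv_def f cong: if_cong)
qed

lemma periodic_mod:
  assumes "\<And>t. h (t + m) = h (t :: nat)"
  shows "h (t mod m) = h t"
proof -
  have "h (s + n * m) = h s" for s n
  proof (induction n)
    case (Suc n)
    have "s + Suc n * m = s + n * m + m" by simp
    thus ?case using assms Suc by metis
  qed simp
  from this[of "t mod m" "t div m"] show ?thesis by simp
qed

lemma class_series_path_split_Suc:
  assumes m: "m > 0" and S: "\<And>t. S (t + m) = S t" and f: "\<And>a k. f (a + m) k = f a k"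
  shows "class_series m (path_split f S (Suc r)) a e =
    fps_X * (\<Sum>e'\<in>{e'\<in>{..<m}. S e'}.
      class_series m f a e' * class_series m (path_split f S r) (Suc e') e)"
  unfolding path_split.simps
proof (rule class_series_path_conv[OF m])
  show "S (t mod m) = S t" for t using periodic_mod[where h = S] S .
  have "path_split f S r (Suc (t + m)) k = path_split f S r (Suc t) k" for t k
    using path_split_periodic[where a = "Suc t" and S = S and f = f and m = m and r = r and k = k] S f by simp
  thus "path_split f S r (Suc (t mod m)) k = path_split f S r (Suc t) k" for t k
    using periodic_mod[where h = "\<lambda>t. path_split f S r (Suc t) k"] by blast
qed

lemma class_series_periodic:
  assumes "\<And>k. f (a + m) k = f a k"
  shows "class_series m f (a + m) e = class_series m f a e"
proof -
  have "(a + m + k) mod m = (a + k) mod m" for k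
    using mod_add_self2[of "a + k" m] by (simp add: ac_simps)
  with assms show ?thesis by (simp add: class_series_def cong: if_cong)
qed

lemma class_series_nth_0: "class_series m f a e $ 0 = (if a mod m = e then f a 0 else 0)"
  by (simp add: class_series_def)

section \<open>Free multiplicative convolution\<close>

text \<open>Here \<open>P\<close>, \<open>H\<close>, \<open>G\<close>, \<open>K\<close> are the series of the words \<open>(ab)\<^sup>k\<close>, \<open>a(ba)\<^sup>k\<close>, \<open>b(ab)\<^sup>k\<close>, \<open>(ba)\<^sup>k\<close>. That \<open>P\<close> and
  \<open>K\<close> coincide is traciality on these words; it follows from the equations.\<close>

lemma alternating_pair_series:
  fixes A B P H G K :: "complex fps"
  defines "y \<equiv> fps_X * P" and "s \<equiv> fps_X * G" and "t \<equiv> fps_X * H"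
  assumes P: "P = 1 + fps_X * ((A oo s) * G)" and H: "H = fps_X * ((A oo s) * K)"
    and G: "G = fps_X * ((B oo t) * P)" and K: "K = 1 + fps_X * ((B oo t) * H)"
  shows "s = fps_X * y * (B oo t)" "t = fps_X * y * (A oo s)" "P = 1 + s * (A oo s)"
proof -
  have eA: "fps_X * ((A oo s) * G) = s * (A oo s)" by (subst (2) s_def) (simp add: mult_ac)
  have P1: "P = 1 + s * (A oo s)" using P unfolding eA .
  have "P - 1 = G * (fps_X * (A oo s))" "K - 1 = H * (fps_X * (B oo t))"
    using P K by (simp_all add: algebra_simps)
  moreover have "fps_X * (A oo s) * K = H" "fps_X * (B oo t) * P = G"
    using H G by (simp_all add: mult.assoc)
  ultimately have "(P - 1) * K = G * H" "(K - 1) * P = H * G"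
    by (simp_all only: mult.assoc)
  hence "(P - 1) * K = (K - 1) * P" by (simp add: mult.commute)
  hence KP: "K = P" by (simp add: algebra_simps)
  show "s = fps_X * y * (B oo t)" unfolding y_def by (subst s_def, subst G) (simp add: mult_ac)
  show "t = fps_X * y * (A oo s)" unfolding y_def by (subst t_def, subst H) (simp add: mult_ac KP)
  show "P = 1 + s * (A oo s)" by (rule P1)
qed

text \<open>The equations for \<open>(ab)\<^sup>k\<close> come with a variable that counts letters, so all series in question are series
  in its square. The number of factors \<open>ab\<close> is counted after this square has been replaced by the variable
  itself.\<close>

lemma free_mult_conv_0_and_series:
  assumes \<mu>: "\<mu> 0 = 1" and \<nu>: "\<nu> 0 = 1"
  shows "(\<mu> \<boxtimes> \<nu>) 0 = 1" (is ?A)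
    and "\<exists>y s t. y = fps_X * Abs_fps (\<mu> \<boxtimes> \<nu>) \<and> s $ 0 = 0 \<and> t $ 0 = 0 \<and>
      s = y * (cumulant_series \<nu> oo t) \<and> t = y * (cumulant_series \<mu> oo s) \<and>
      cumulant_series (\<mu> \<boxtimes> \<nu>) oo y = (cumulant_series \<mu> oo s) * (cumulant_series \<nu> oo t)" (is ?B)
proof -
  have "\<exists>\<phi>. \<phi> [] = 1 \<and> free_families \<phi> (\<lambda>b. {b}) \<and>
      (\<forall>b k. \<phi> (replicate k b) = (if b then \<mu> else \<nu>) k)"
    by (rule free_product_exists) (simp add: \<mu> \<nu>)
  then obtain \<phi> :: "bool list \<Rightarrow> complex" where \<phi>: "\<phi> [] = 1" "free_families \<phi> (\<lambda>b. {b})"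
    "\<And>b k. \<phi> (replicate k b) = (if b then \<mu> else \<nu>) k"
    by blast
  define \<rho> where "\<rho> = \<mu> \<boxtimes> \<nu>"
  have \<rho>: "\<rho> = (\<lambda>k. \<phi> (concat (replicate k [True, False])))"
    unfolding \<rho>_def using \<phi> by (intro free_mult_conv_eq) auto
  hence \<rho>0: "\<rho> 0 = 1" using \<phi>(1) by simp
  thus ?A by (simp add: \<rho>_def)
  define w where "w = seg (\<lambda>_. [] :: bool list) even"
  have w_per: "w k (a + 2) = w k a" for k a
    unfolding w_def by (rule seg_periodic) simp_all
  have "w (2 * k) 0 = concat (replicate k [True, False])" for k
  proof (induction k)
    case (Suc k)
    have "w (2 * Suc k) 0 = True # False # w (2 * k) (0 + 2)" by (simp add: w_def)
    with Suc show ?case unfolding w_per by simp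
  qed (simp add: w_def)
  hence \<rho>_w: "\<rho> k = \<phi> (w (2 * k) 0)" for k by (simp add: \<rho>)
  define f where "f = (\<lambda>a k. \<phi> (w k a))"
  have f_per: "f (a + 2) k = f a k" for a k unfolding f_def w_per ..
  have f_per': "f (Suc (Suc a)) k = f a k" for a k using f_per[of a k] by (simp only: add_2_eq_Suc')
  have f0: "f a 0 = 1" for a by (simp add: f_def w_def \<phi>)
  define F where "F = class_series 2 f"
  define C where "C = (\<lambda>a :: nat. cumulant_series (if even a then \<mu> else \<nu>))"
  have F_eq: "F a e = fps_const (F a e $ 0) + fps_X * ((C a oo (fps_X * F (Suc a) a)) * F (Suc a) e)"
    if "a < 2" for a e
  proof (rule series_of_recursion)
    fix k
    define S where "S = (\<lambda>t :: nat. even t = even a)"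
    define Th where "Th = (\<lambda>r. class_series 2 (path_split f S r) (Suc a) e)"
    have "Th r = (fps_X * F (Suc a) a) ^ r * F (Suc a) e" for r
    proof (induction r)
      case 0
      show ?case by (simp add: Th_def F_def)
    next
      case (Suc r)
      have "{e' \<in> {..<2}. S e'} = {a}" using that unfolding S_def by (auto simp: less_2_cases_iff)
      hence "Th (Suc r) = fps_X * (F (Suc a) a * Th r)"
        unfolding Th_def F_def by (subst class_series_path_split_Suc) (auto simp: S_def f_per')
      thus ?case by (simp add: Suc mult_ac)
    qed
    moreover have "F a e $ Suc k = (\<Sum>r\<le>k. C a $ r * Th r $ k)"
    proof -
      have "schwinger_dyson \<phi> (even a) (free_cumulant (\<lambda>k. \<phi> (replicate k (even a)))) (w k (Suc a))"
        by (rule schwinger_dyson_free_variables[where G = "\<lambda>b. {b}" and ?i0.0 = "even a", OF \<phi>(2,1)]) auto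
      hence "schwinger_dyson \<phi> (even a) (free_cumulant (if even a then \<mu> else \<nu>)) (w k (Suc a))"
        by (simp add: \<phi>(3))
      from schwinger_dyson_seg[OF this[unfolded w_def]]
      have "f a (Suc k) = (\<Sum>r\<le>k. C a $ r * path_split f S r (Suc a) k)"
        by (simp add: f_def w_def S_def C_def cumulant_series_def)
      thus ?thesis by (simp add: F_def Th_def class_series_def)
    qed
    ultimately show "F a e $ Suc k = (\<Sum>r\<le>k. C a $ r * ((fps_X * F (Suc a) a) ^ r * F (Suc a) e) $ k)"
      by simp
  qed simp
  have F2: "F (Suc (Suc 0)) e = F 0 e" for e
    using class_series_periodic[of f 0 2 e] f_per[of 0] by (simp add: F_def numeral_2_eq_2)
  define s where "s = fps_X * F 1 0"
  define t where "t = fps_X * F 0 1"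
  define P where "P = F 0 0"
  note eqs = alternating_pair_series[of P "cumulant_series \<mu>" "F 1 0" "F 0 1" "F 1 1" "cumulant_series \<nu>",
      folded s_def t_def]
  have F_nth_0: "F a e $ 0 = (if a mod 2 = e then 1 else 0)" for a e
    by (simp add: F_def class_series_nth_0 f0)
  have 1: "P = 1 + fps_X * ((cumulant_series \<mu> oo s) * F 1 0)"
    using F_eq[of 0 0] by (simp add: P_def F_nth_0 C_def s_def)
  have 2: "F 0 1 = fps_X * ((cumulant_series \<mu> oo s) * F 1 1)"
    using F_eq[of 0 1] by (simp add: F_nth_0 C_def s_def)
  have 3: "F 1 0 = fps_X * ((cumulant_series \<nu> oo t) * P)"
    using F_eq[of 1 0] by (simp add: F2 P_def F_nth_0 C_def t_def)
  have 4: "F 1 1 = 1 + fps_X * ((cumulant_series \<nu> oo t) * F 0 1)"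
    using F_eq[of 1 1] by (simp add: F2 F_nth_0 C_def t_def)
  note eqs = eqs[OF 1 2 3 4]
  \<comment> \<open>Passing from the count of letters to the count of factors \<open>ab\<close>.\<close>
  define P' s' t' where "P' = Abs_fps (\<lambda>k. P $ (2 * k))" and "s' = Abs_fps (\<lambda>k. s $ (2 * k))"
    and "t' = Abs_fps (\<lambda>k. t $ (2 * k))"
  have odd0: "P $ k = 0" "s $ k = 0" "t $ k = 0" if "odd k" for k
    using that by (cases k; simp add: P_def s_def t_def F_def class_series_def mod2_eq_if)+
  have comp: "P' oo fps_X ^ 2 = P" "s' oo fps_X ^ 2 = s" "t' oo fps_X ^ 2 = t"
    unfolding P'_def s'_def t'_def using odd0 by (auto intro!: fps_even_part)
  have P'_\<rho>: "P' = Abs_fps \<rho>"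
    by (rule fps_ext) (simp add: P'_def P_def F_def class_series_def \<rho>_w f_def)
  define y where "y = fps_X * P'"
  have zero: "s' $ 0 = 0" "t' $ 0 = 0" "y $ 0 = 0" by (simp_all add: s'_def t'_def s_def t_def y_def)
  have X2: "(fps_X ^ 2 :: complex fps) $ 0 = 0" by simp
  have X: "fps_X oo (fps_X ^ 2 :: complex fps) = fps_X ^ 2" by (rule fps_X_fps_compose_startby0) simp
  have inj: "f = g" if "f oo fps_X ^ 2 = g oo fps_X ^ 2" for f g :: "complex fps"
    using fps_compose_X_power_inj[of 2 f g] that by simp
  note compose_simps = fps_compose_mult_distrib[OF X2] fps_compose_add_distrib comp X
    fps_compose_assoc[OF X2 zero(1), symmetric] fps_compose_assoc[OF X2 zero(2), symmetric]
  have s': "s' = y * (cumulant_series \<nu> oo t')"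
    by (rule inj) (simp add: compose_simps y_def, subst eqs(1), simp add: power2_eq_square mult_ac)
  have t': "t' = y * (cumulant_series \<mu> oo s')"
    by (rule inj) (simp add: compose_simps y_def, subst eqs(2), simp add: power2_eq_square mult_ac)
  have P': "P' = 1 + s' * (cumulant_series \<mu> oo s')"
    by (rule inj) (simp add: compose_simps, rule eqs(3))
  have "y * (cumulant_series \<rho> oo y) = s' * (cumulant_series \<mu> oo s')"
    using moment_series_equation[where m = \<rho>, OF \<rho>0, folded P'_\<rho>, folded y_def] P' by simp
  also have "\<dots> = y * ((cumulant_series \<mu> oo s') * (cumulant_series \<nu> oo t'))"
    by (subst (1) s') (simp add: mult_ac)
  finally have "y = 0 \<or> cumulant_series \<rho> oo y = (cumulant_series \<mu> oo s') * (cumulant_series \<nu> oo t')"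
    by simp
  moreover have "y \<noteq> 0"
  proof
    assume "y = 0"
    hence "y $ 1 = 0" by simp
    thus False by (simp add: y_def P'_\<rho> \<rho>0)
  qed
  ultimately show ?B
    unfolding \<rho>_def[symmetric] P'_\<rho>[symmetric] using zero s' t' unfolding y_def by blast
qed

text \<open>The preceding lemma is the case of one particular \<open>y\<close> with a linear term, which is invertible under
  composition. This transports the identity to an arbitrary \<open>y\<close>, and uniqueness identifies \<open>s\<close> and \<open>t\<close>.\<close>

lemma cumulant_series_free_mult_conv:
  assumes "\<mu> 0 = 1" "\<nu> 0 = 1" and y: "y $ 0 = 0"
    and s: "s = y * (cumulant_series \<nu> oo t)" and t: "t = y * (cumulant_series \<mu> oo s)"
  shows "cumulant_series (\<mu> \<boxtimes> \<nu>) oo y = (cumulant_series \<mu> oo s) * (cumulant_series \<nu> oo t)"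
proof -
  obtain y0 s0 t0 where y0: "y0 = fps_X * Abs_fps (\<mu> \<boxtimes> \<nu>)" and zero: "s0 $ 0 = 0" "t0 $ 0 = 0"
    and s0: "s0 = y0 * (cumulant_series \<nu> oo t0)" and t0: "t0 = y0 * (cumulant_series \<mu> oo s0)"
    and eq: "cumulant_series (\<mu> \<boxtimes> \<nu>) oo y0 = (cumulant_series \<mu> oo s0) * (cumulant_series \<nu> oo t0)"
    using free_mult_conv_0_and_series(2)[where \<mu> = \<mu> and \<nu> = \<nu>, OF assms(1,2)] by blast
  have y0_0: "y0 $ 0 = 0" and y0_1: "y0 $ 1 \<noteq> 0"
    using free_mult_conv_0_and_series(1)[where \<mu> = \<mu> and \<nu> = \<nu>, OF assms(1,2)] by (simp_all add: y0)
  \<comment> \<open>The substitution that turns the particular \<open>y0\<close> into \<open>y\<close>.\<close>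
  define v where "v = fps_inv y0 oo y"
  have inv0: "fps_inv y0 $ 0 = 0" by (simp add: fps_inv_def)
  have v0: "v $ 0 = 0" by (simp add: v_def inv0)
  have y0v: "y0 oo v = y"
    unfolding v_def fps_compose_assoc[OF y inv0] fps_inv_right[OF y0_0 y0_1] using y by simp
  have "s0 oo v = y * (cumulant_series \<nu> oo (t0 oo v))"
    by (subst s0) (simp add: fps_compose_mult_distrib[OF v0] y0v fps_compose_assoc[OF v0 zero(2)])
  moreover have "t0 oo v = y * (cumulant_series \<mu> oo (s0 oo v))"
    by (subst t0) (simp add: fps_compose_mult_distrib[OF v0] y0v fps_compose_assoc[OF v0 zero(1)])
  ultimately have st: "s = s0 oo v" "t = t0 oo v"
    using coupled_fps_unique[OF y s t] by blast+
  have "cumulant_series (\<mu> \<boxtimes> \<nu>) oo y = (cumulant_series (\<mu> \<boxtimes> \<nu>) oo y0) oo v"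
    by (simp add: fps_compose_assoc[OF v0 y0_0, symmetric] y0v)
  also have "\<dots> = (cumulant_series \<mu> oo s) * (cumulant_series \<nu> oo t)"
    by (simp add: eq fps_compose_mult_distrib[OF v0] st fps_compose_assoc[OF v0 zero(1)] fps_compose_assoc[OF v0 zero(2)])
  finally show ?thesis .
qed

lemma free_mult_conv_list_0:
  "(\<And>m. m \<in> set ms \<Longrightarrow> m 0 = 1) \<Longrightarrow> free_mult_conv_list ms 0 = 1"
  by (induction ms rule: free_mult_conv_list.induct) (auto intro: free_mult_conv_0_and_series(1))

lemma even_cumulant_dist_0: "even_cumulant_dist m 0 = 1"
  by (simp add: even_cumulant_dist_def)

section \<open>The zigzag between the levels\<close>

lemma sum_parity:
  fixes k :: nat
  shows "(\<Sum>r\<le>2 * k + 1. g r) = (\<Sum>n\<le>k. g (2 * n) + g (2 * n + 1) :: complex)"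
  by (induction k) (simp_all add: add.assoc)

text \<open>The form of \<open>series_of_recursion\<close> for chosen letters that alternate between two classes: only the terms
  with an odd number of further letters survive, and these carry the even cumulants.\<close>

lemma alternating_recursion_series:
  fixes s G F :: "complex fps"
  assumes s: "s $ 0 = 0" and T0: "T 0 = 0" and T1: "T (Suc 0) = G" and T2: "\<And>r. T (Suc (Suc r)) = s * T r"
    and T_0: "\<And>r k. r > k \<Longrightarrow> T r $ k = 0"
    and F: "\<And>k. F $ Suc k = (\<Sum>r\<le>k. \<kappa> (Suc r) * T r $ k)"
  shows "F = fps_const (F $ 0) + fps_X * ((Abs_fps (\<lambda>n. \<kappa> (2 * Suc n)) oo s) * G)"
proof (rule series_of_recursion[OF s])
  fix k
  have even: "T (2 * n) = 0" for n
    by (induction n) (simp_all add: T0 T2)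
  have odd: "T (2 * n + 1) = s ^ n * G" for n
    by (induction n) (simp_all add: T1 T2 mult.assoc)
  have "F $ Suc k = (\<Sum>r\<le>2 * k + 1. \<kappa> (Suc r) * T r $ k)"
    unfolding F by (intro sum.mono_neutral_left) (auto simp: T_0)
  also have "\<dots> = (\<Sum>r\<le>k. Abs_fps (\<lambda>n. \<kappa> (2 * Suc n)) $ r * (s ^ r * G) $ k)"
    unfolding sum_parity even odd by simp
  finally show "F $ Suc k = (\<Sum>r\<le>k. Abs_fps (\<lambda>n. \<kappa> (2 * Suc n)) $ r * (s ^ r * G) $ k)" .
qed

text \<open>The level at time \<open>t\<close> of the path that climbs from level \<open>1\<close> to level \<open>p + 1\<close> during \<open>p\<close> steps and descends
  during the next \<open>p\<close> steps.\<close>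

definition zigzag_level :: "nat \<Rightarrow> nat \<Rightarrow> nat" where
  "zigzag_level p t = (let u = t mod (2 * p) in if u \<le> p then Suc u else 2 * p + 1 - u)"

text \<open>The colour of the step from time \<open>t\<close> to \<open>t + 1\<close> is the lower one of the two levels it joins.\<close>

definition zigzag_colour :: "nat \<Rightarrow> nat \<Rightarrow> nat" where
  "zigzag_colour p t = (let u = t mod (2 * p) in if u < p then Suc u else 2 * p - u)"

lemma zigzag_level_mod [simp]: "zigzag_level p (t mod (2 * p)) = zigzag_level p t"
  and zigzag_level_periodic [simp]: "zigzag_level p (t + 2 * p) = zigzag_level p t"
  and zigzag_colour_periodic [simp]: "zigzag_colour p (t + 2 * p) = zigzag_colour p t"
  by (simp_all add: zigzag_level_def zigzag_colour_def)

lemma zigzag_level_up: "l \<le> p \<Longrightarrow> p \<ge> 1 \<Longrightarrow> zigzag_level p l = Suc l"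
  by (simp add: zigzag_level_def)

lemma zigzag_level_down:
  assumes "1 \<le> l" "l \<le> p"
  shows "zigzag_level p (2 * p - l) = Suc l"
proof -
  have "(2 * p - l) mod (2 * p) = 2 * p - l" using assms by (intro mod_less) simp
  thus ?thesis using assms by (auto simp: zigzag_level_def Let_def)
qed

lemma zigzag_level_down':
  assumes "1 \<le> l" "l \<le> p"
  shows "zigzag_level p (Suc (2 * p - l)) = l"
proof (cases "l = 1")
  case True
  hence "Suc (2 * p - l) = 2 * p" using assms by simp
  with True show ?thesis by (simp add: zigzag_level_def)
next
  case False
  hence "Suc (2 * p - l) = 2 * p - (l - 1)" "1 \<le> l - 1" "l - 1 \<le> p" using assms by auto
  with zigzag_level_down[of "l - 1" p] assms show ?thesis by simp
qed

lemma zigzag_colour_times: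
  assumes "1 \<le> l" "l \<le> p"
  shows "{t \<in> {..<2 * p}. zigzag_colour p t = l} = {l - 1, 2 * p - l}"
  using assms by (auto simp: zigzag_colour_def Let_def)

lemma zigzag_colour_range:
  assumes "p \<ge> 1"
  shows "zigzag_colour p t \<in> {1..p}"
proof -
  have "t mod (2 * p) < 2 * p" using assms by simp
  thus ?thesis by (auto simp: zigzag_colour_def Let_def)
qed

lemma zigzag_level_range:
  assumes "p \<ge> 1"
  shows "zigzag_level p t \<in> {1..Suc p}"
proof -
  have "t mod (2 * p) < 2 * p" using assms by simp
  thus ?thesis by (auto simp: zigzag_level_def Let_def)
qed

text \<open>The properties of \<open>f a k = \<phi>(D Y D \<dots> Y D)\<close>, the value at the segment of the zigzag word with \<open>k\<close> letters
  \<open>Y\<close> that starts at time \<open>a\<close>. A segment between different levels vanishes by traciality and orthogonality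
  of the projections, and a full turn can be rotated.\<close>

locale zigzag =
  fixes p :: nat and d :: "nat \<Rightarrow> complex" and \<kappa> :: "nat \<Rightarrow> nat \<Rightarrow> complex"
    and f :: "nat \<Rightarrow> nat \<Rightarrow> complex"
  assumes p: "p \<ge> 1"
    and f_periodic: "f (a + 2 * p) k = f a k"
    and f_level: "zigzag_level p a \<noteq> zigzag_level p (a + k) \<Longrightarrow> f a k = 0"
    and f_0: "f a 0 = d (zigzag_level p a)"
    and f_rotate: "2 * p dvd k \<Longrightarrow> k > 0 \<Longrightarrow> f (Suc a) k = f a k"
    and f_schwinger_dyson: "zigzag_level p a = zigzag_level p (a + Suc k) \<Longrightarrow>
      f a (Suc k) = (\<Sum>r\<le>k. \<kappa> (zigzag_colour p a) (Suc r) *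
        path_split f (\<lambda>t. zigzag_colour p t = zigzag_colour p a) r (Suc a) k)"
begin

abbreviation F where "F \<equiv> class_series (2 * p) f"

definition C :: "nat \<Rightarrow> complex fps" where "C l = Abs_fps (\<lambda>n. \<kappa> l (2 * Suc n))"

definition \<Psi> :: "complex fps" where "\<Psi> = Abs_fps (\<lambda>k. if k = 0 then 0 else f 0 (2 * p * k))"

definition \<Lambda> :: "nat \<Rightarrow> complex fps" where "\<Lambda> j = fps_const (d j) + (\<Psi> oo fps_X ^ (2 * p))"

lemma F_level: "zigzag_level p a \<noteq> zigzag_level p e \<Longrightarrow> F a e = 0"
  by (rule fps_ext) (auto simp: class_series_def f_level)

lemma F_nth_0: "F a e $ 0 = (if a mod (2 * p) = e then d (zigzag_level p a) else 0)"
  by (simp add: class_series_nth_0 f_0)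

lemma F_loop:
  assumes "t < 2 * p"
  shows "F t t = \<Lambda> (zigzag_level p t)"
proof (rule fps_ext)
  fix k
  have "f t k = f 0 k" if "2 * p dvd k" "k > 0"
    using f_rotate[OF that] by (induction t) simp_all
  moreover have "(t + k) mod (2 * p) = t \<longleftrightarrow> 2 * p dvd k"
  proof -
    have "(t + k) mod (2 * p) = t mod (2 * p) \<longleftrightarrow> 2 * p dvd k"
      using mod_eq_dvd_iff_nat[of t "t + k" "2 * p"] by simp
    thus ?thesis using assms by simp
  qed
  ultimately show "F t t $ k = \<Lambda> (zigzag_level p t) $ k"
    using p by (cases "k = 0")
      (auto simp: class_series_def \<Lambda>_def \<Psi>_def fps_compose_X_power_nth f_0 elim!: dvdE)
qed

text \<open>Let \<open>a\<close> and \<open>b\<close> be the two times, modulo the period, of the steps of one colour. After a step at time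
  \<open>a\<close> the next chosen step of that colour must start at the level just reached, hence at time \<open>b\<close>, and
  vice versa.\<close>

lemma F_step:
  assumes ab: "a < 2 * p" "b < 2 * p" "{t \<in> {..<2 * p}. zigzag_colour p t = zigzag_colour p a} = {a, b}"
    and lev: "zigzag_level p (Suc a) = zigzag_level p b" "zigzag_level p (Suc b) = zigzag_level p a"
      "zigzag_level p a \<noteq> zigzag_level p b" "zigzag_level p e = zigzag_level p a"
  defines "s \<equiv> fps_X ^ 2 * F (Suc a) b * F (Suc b) a"
  shows "F a e = fps_const (F a e $ 0) +
           fps_X * ((C (zigzag_colour p a) oo s) * (fps_X * F (Suc a) b * F (Suc b) e))"
  unfolding C_def
proof (rule alternating_recursion_series)
  let ?S = "\<lambda>t. zigzag_colour p t = zigzag_colour p a"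
  define T where "T = (\<lambda>r c. class_series (2 * p) (path_split f ?S r) c e)"
  have T_Suc: "T (Suc r) c = fps_X * (F c a * T r (Suc a) + F c b * T r (Suc b))" for r c
  proof -
    have "a \<noteq> b" using lev(3) by auto
    moreover have "T (Suc r) c = fps_X * (\<Sum>e'\<in>{e' \<in> {..<2 * p}. ?S e'}. F c e' * T r (Suc e'))"
      unfolding T_def by (rule class_series_path_split_Suc) (use p f_periodic in simp_all)
    ultimately show ?thesis unfolding ab(3) by simp
  qed
  have zero: "F (Suc a) a = 0" "F (Suc b) b = 0" "F (Suc a) e = 0"
    using lev by (auto intro!: F_level)
  show "s $ 0 = 0" by (simp add: s_def)
  show "T 0 (Suc a) = 0" by (simp add: T_def zero)
  show "T (Suc 0) (Suc a) = fps_X * F (Suc a) b * F (Suc b) e"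
    by (simp add: T_Suc zero) (simp add: T_def mult.assoc)
  show "T (Suc (Suc r)) (Suc a) = s * T r (Suc a)" for r
    by (simp add: T_Suc zero) (simp add: s_def power2_eq_square mult_ac)
  show "T r (Suc a) $ k = 0" if "r > k" for r k
    using that by (simp add: T_def class_series_def path_split_eq_0)
  show "F a e $ Suc k = (\<Sum>r\<le>k. \<kappa> (zigzag_colour p a) (Suc r) * T r (Suc a) $ k)" for k
  proof (cases "(a + Suc k) mod (2 * p) = e")
    case True
    hence "zigzag_level p a = zigzag_level p (a + Suc k)" using lev(4) by auto
    from f_schwinger_dyson[OF this] True show ?thesis by (simp add: class_series_def T_def)
  next
    case False
    thus ?thesis by (simp add: class_series_def T_def)
  qed
qed

definition U :: "nat \<Rightarrow> complex fps" where "U l = F l (2 * p - l)"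
definition L :: "nat \<Rightarrow> complex fps" where "L l = F (Suc (2 * p - l)) (l - 1)"
definition s :: "nat \<Rightarrow> complex fps" where "s l = fps_X ^ 2 * U l * L l"

lemma
  assumes l: "1 \<le> l" "l \<le> p"
  shows step_up: "zigzag_level p e = l \<Longrightarrow> F (l - 1) e = fps_const (F (l - 1) e $ 0) +
      fps_X * ((C l oo s l) * (fps_X * U l * F (Suc (2 * p - l)) e))"
    and step_down: "zigzag_level p e = Suc l \<Longrightarrow> F (2 * p - l) e = fps_const (F (2 * p - l) e $ 0) +
      fps_X * ((C l oo s l) * (fps_X * L l * F l e))"
proof -
  have col: "zigzag_colour p (l - 1) = l" "zigzag_colour p (2 * p - l) = l"
    using zigzag_colour_times[OF l] by auto
  have lt: "l - 1 < 2 * p" "2 * p - l < 2 * p" and Suc_l: "Suc (l - 1) = l" using l by auto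
  have lev: "zigzag_level p (l - 1) = l" "zigzag_level p l = Suc l"
    "zigzag_level p (2 * p - l) = Suc l" "zigzag_level p (Suc (2 * p - l)) = l"
    using zigzag_level_up[of "l - 1" p] zigzag_level_up[of l p] zigzag_level_down[OF l]
      zigzag_level_down'[OF l] l p by auto
  have s': "s l = fps_X ^ 2 * L l * U l" by (simp add: s_def mult_ac)
  show "F (l - 1) e = fps_const (F (l - 1) e $ 0) +
      fps_X * ((C l oo s l) * (fps_X * U l * F (Suc (2 * p - l)) e))" if "zigzag_level p e = l"
    using F_step[of "l - 1" "2 * p - l" e] lt that unfolding col zigzag_colour_times[OF l] Suc_l lev
    by (simp add: s_def U_def L_def)
  show "F (2 * p - l) e = fps_const (F (2 * p - l) e $ 0) +
      fps_X * ((C l oo s l) * (fps_X * L l * F l e))" if "zigzag_level p e = Suc l"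
    using F_step[of "2 * p - l" "l - 1" e] lt that unfolding col zigzag_colour_times[OF l] Suc_l lev
    by (simp add: s' U_def L_def insert_commute)
qed

lemma s_equation:
  assumes l: "1 \<le> l" "l \<le> p"
  shows "\<Psi> oo fps_X ^ (2 * p) = s l * (C l oo s l)"
proof -
  have lev: "zigzag_level p (l - 1) = l" using zigzag_level_up[of "l - 1" p] l p by simp
  have "F (l - 1) (l - 1) = \<Lambda> l" using F_loop[of "l - 1"] l unfolding lev by simp
  moreover have "F (l - 1) (l - 1) $ 0 = d l" unfolding F_nth_0 lev using l by simp
  ultimately have "\<Lambda> l = fps_const (d l) + fps_X * ((C l oo s l) * (fps_X * U l * L l))"
    using step_up[OF l lev] unfolding L_def by simp
  thus ?thesis by (simp add: \<Lambda>_def s_def power2_eq_square mult_ac)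
qed

lemma U_equation:
  assumes l: "1 \<le> l" "l < p"
  shows "U l = fps_X ^ 2 * U (Suc l) * (C (Suc l) oo s (Suc l)) * \<Lambda> (Suc l)"
proof -
  have e: "Suc (2 * p - Suc l) = 2 * p - l" using l by simp
  have lev: "zigzag_level p (2 * p - l) = Suc l" using zigzag_level_down[of l p] l by simp
  have "l \<noteq> 2 * p - l" "l mod (2 * p) = l" using l by auto
  hence "U l = fps_X * ((C (Suc l) oo s (Suc l)) * (fps_X * U (Suc l) * F (2 * p - l) (2 * p - l)))"
    using step_up[of "Suc l" "2 * p - l"] l lev by (simp add: U_def F_nth_0 e)
  also have "F (2 * p - l) (2 * p - l) = \<Lambda> (Suc l)"
    using F_loop[of "2 * p - l"] l by (simp add: lev)
  finally show ?thesis by (simp add: power2_eq_square mult_ac)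
qed

lemma L_equation:
  assumes l: "1 \<le> l" "l < p"
  shows "L (Suc l) = fps_X ^ 2 * L l * (C l oo s l) * \<Lambda> (Suc l)"
proof -
  have e: "Suc (2 * p - Suc l) = 2 * p - l" using l by simp
  have lev: "zigzag_level p l = Suc l" using zigzag_level_up[of l p] l by simp
  have "(2 * p - l) mod (2 * p) \<noteq> l" using l by (subst mod_less) auto
  hence "L (Suc l) = fps_X * ((C l oo s l) * (fps_X * L l * F l l))"
    using step_down[of l l] l lev by (simp add: L_def F_nth_0 e)
  also have "F l l = \<Lambda> (Suc l)" using F_loop[of l] l by (simp add: lev)
  finally show ?thesis by (simp add: power2_eq_square mult_ac)
qed

lemma U_last: "U p = \<Lambda> (Suc p)"
  using F_loop[of p] zigzag_level_up[of p p] p by (simp add: U_def mult_2)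

lemma L_first: "L 1 = \<Lambda> 1"
proof -
  have "L 1 = F (0 + 2 * p) 0" using p by (simp add: L_def)
  also have "\<dots> = F 0 0" by (rule class_series_periodic) (rule f_periodic)
  also have "\<dots> = \<Lambda> 1" using F_loop[of 0] zigzag_level_up[of 0 p] p by simp
  finally show ?thesis .
qed

lemma s_nth_0: "s l $ 0 = 0"
  by (simp add: s_def)

text \<open>Put \<open>y\<^sub>l = X\<^sup>2\<^sup>(\<^sup>p\<^sup>+\<^sup>1\<^sup>-\<^sup>l\<^sup>) L\<^sub>l \<Lambda>\<^sub>l\<^sub>+\<^sub>1 \<cdots> \<Lambda>\<^sub>p\<^sub>+\<^sub>1\<close> and let \<open>\<rho>\<^sub>l\<close> be the convolution of \<open>\<mu> l, \<dots>, \<mu> p\<close>. Then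
  \<open>s\<^sub>l = y\<^sub>l C\<^sub>\<rho>\<^sub>,\<^sub>l\<^sub>+\<^sub>1(y\<^sub>l\<^sub>+\<^sub>1)\<close> and \<open>y\<^sub>l\<^sub>+\<^sub>1 = y\<^sub>l C\<^sub>l(s\<^sub>l)\<close>, which is the system that describes \<open>\<rho>\<^sub>l = \<mu> l \<boxtimes> \<rho>\<^sub>l\<^sub>+\<^sub>1\<close>
  at \<open>y\<^sub>l\<close>. At \<open>l = 1\<close> the series \<open>y\<^sub>1\<close> is the argument of \<open>R\<close> in the equation, with \<open>z = X\<^sup>2\<^sup>p\<close>.\<close>

theorem loop_series_equation:
  assumes \<mu>: "\<And>l. 1 \<le> l \<Longrightarrow> l \<le> p \<Longrightarrow> \<mu> l 0 = 1"
      "\<And>l. 1 \<le> l \<Longrightarrow> l \<le> p \<Longrightarrow> cumulant_series (\<mu> l) = C l"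
  shows "\<Psi> = R_series (free_mult_conv_list (map \<mu> [1..<Suc p])) oo
                (fps_X * (\<Prod>j\<in>{1..Suc p}. \<Psi> + fps_const (d j)))"
proof -
  define \<rho> where "\<rho> = (\<lambda>l. free_mult_conv_list (map \<mu> [l..<Suc p]))"
  define tail_prod where "tail_prod = (\<lambda>l. \<Prod>j\<in>{Suc l..Suc p}. \<Lambda> j)"
  have tail_prod_step: "tail_prod l = \<Lambda> (Suc l) * tail_prod (Suc l)" if "l < p" for l
  proof -
    have "{Suc l..Suc p} = insert (Suc l) {Suc (Suc l)..Suc p}" using that by auto
    thus ?thesis unfolding tail_prod_def by (simp only:) (rule prod.insert, auto)
  qed
  have tail_prod_last: "tail_prod p = \<Lambda> (Suc p)" by (simp add: tail_prod_def)
  define y where "y = (\<lambda>l. fps_X ^ (2 * (Suc p - l)) * L l * tail_prod l)"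
  have y_0: "y l $ 0 = 0" if "l \<le> p" for l using that by (simp add: y_def)
  \<comment> \<open>The left-hand side is \<open>U (l - 1)\<close> without its factor \<open>\<Lambda> l\<close>, in a form that makes sense for \<open>l = 1\<close>.\<close>
  have key: "fps_X ^ 2 * U l * (C l oo s l) =
      fps_X ^ (2 * (Suc p - l)) * tail_prod l * (cumulant_series (\<rho> l) oo y l)"
    if "1 \<le> l" "l \<le> p" for l
    using that(2,1)
  proof (induction rule: inc_induct)
    case base
    have "s p = y p" by (simp add: s_def y_def U_last tail_prod_last mult_ac)
    thus ?case using \<mu>(2)[of p] p by (simp add: \<rho>_def U_last tail_prod_last)
  next
    case (step l)
    have l: "1 \<le> l" "l < p" using step by auto
    define Q where "Q = fps_X ^ (2 * (p - l)) * tail_prod l"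
    note prod = tail_prod_step[OF l(2)]
    have pow: "fps_X ^ (2 * (Suc p - l)) = (fps_X ^ 2 * fps_X ^ (2 * (p - l)) :: complex fps)"
      using l by (simp add: Suc_diff_le flip: power_add)
    have yl: "y l = fps_X ^ 2 * L l * Q" by (simp add: y_def pow Q_def mult_ac)
    have U: "U l = Q * (cumulant_series (\<rho> (Suc l)) oo y (Suc l))"
    proof -
      have "U l = (fps_X ^ 2 * U (Suc l) * (C (Suc l) oo s (Suc l))) * \<Lambda> (Suc l)"
        by (rule U_equation[OF l])
      also have "\<dots> = Q * (cumulant_series (\<rho> (Suc l)) oo y (Suc l))"
        using step.IH by (simp add: Q_def prod mult_ac)
      finally show ?thesis .
    qed
    have "s l = y l * (cumulant_series (\<rho> (Suc l)) oo y (Suc l))"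
      by (simp add: s_def U yl mult_ac)
    moreover have "y (Suc l) = y l * (cumulant_series (\<mu> l) oo s l)"
    proof -
      have "y (Suc l) = fps_X ^ (2 * (p - l)) * L (Suc l) * tail_prod (Suc l)"
        by (simp add: y_def)
      also have "\<dots> = y l * (C l oo s l)"
        by (simp add: L_equation[OF l] yl Q_def prod mult_ac)
      finally show ?thesis using \<mu>(2)[of l] l by simp
    qed
    moreover have "\<rho> (Suc l) 0 = 1"
      unfolding \<rho>_def by (rule free_mult_conv_list_0) (use \<mu>(1) in auto)
    moreover have "\<rho> l = \<mu> l \<boxtimes> \<rho> (Suc l)"
    proof -
      have "[l..<Suc p] = l # Suc l # [Suc (Suc l)..<Suc p]" "[Suc l..<Suc p] = Suc l # [Suc (Suc l)..<Suc p]"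
        using l by (simp_all add: upt_rec[of l] upt_rec[of "Suc l"])
      thus ?thesis by (simp add: \<rho>_def)
    qed
    ultimately have "cumulant_series (\<rho> l) oo y l =
        (cumulant_series (\<mu> l) oo s l) * (cumulant_series (\<rho> (Suc l)) oo y (Suc l))"
      using cumulant_series_free_mult_conv[of "\<mu> l" "\<rho> (Suc l)" "y l"] \<mu>(1)[of l] y_0[of l] l by simp
    moreover have "cumulant_series (\<mu> l) = C l" using \<mu>(2)[of l] l by simp
    ultimately show ?case
      by (simp add: U pow) (simp add: Q_def mult_ac)
  qed
  have X0: "(fps_X ^ (2 * p) :: complex fps) $ 0 = 0" using p by simp
  have y1: "y 1 = (fps_X * (\<Prod>j\<in>{1..Suc p}. \<Psi> + fps_const (d j))) oo fps_X ^ (2 * p)"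
  proof -
    have "y 1 = fps_X ^ (2 * p) * tail_prod 0"
      using tail_prod_step[of 0] p L_first by (simp add: y_def mult_ac)
    hence "y 1 = fps_X ^ (2 * p) * (\<Prod>j\<in>{1..Suc p}. \<Lambda> j)"
      by (simp add: tail_prod_def)
    also have "\<dots> = (fps_X * (\<Prod>j\<in>{1..Suc p}. \<Psi> + fps_const (d j))) oo fps_X ^ (2 * p)"
      using X0 by (simp add: fps_compose_mult_distrib[OF X0] fps_compose_prod_distrib[OF X0]
          fps_compose_add_distrib \<Lambda>_def add.commute)
    finally show ?thesis .
  qed
  have "\<Psi> oo fps_X ^ (2 * p) = L 1 * (fps_X ^ 2 * U 1 * (C 1 oo s 1))"
    using s_equation[of 1] p by (simp add: s_def mult_ac)
  also have "\<dots> = y 1 * (cumulant_series (\<rho> 1) oo y 1)"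
    using p by (subst key) (simp_all add: y_def mult_ac)
  also have "\<dots> = R_series (\<rho> 1) oo y 1"
    using y_0[of 1] p by (simp add: R_series_compose)
  also have "\<dots> = (R_series (\<rho> 1) oo (fps_X * (\<Prod>j\<in>{1..Suc p}. \<Psi> + fps_const (d j)))) oo fps_X ^ (2 * p)"
    unfolding y1 by (rule fps_compose_assoc) (use X0 in auto)
  finally have eq: "\<Psi> oo fps_X ^ (2 * p) = \<dots>" .
  show ?thesis
    by (rule fps_compose_X_power_inj[OF _ eq[unfolded \<rho>_def]]) (use p in simp)
qed

end

text \<open>The factor \<open>z\<close> inside \<open>R\<close> gains one order in each round.\<close>

lemma loop_series_equation_unique:
  fixes R :: "complex fps" and d :: "nat \<Rightarrow> complex"
  assumes "\<psi> = R oo (fps_X * (\<Prod>j\<in>J. \<psi> + fps_const (d j)))"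
    and "\<psi>' = R oo (fps_X * (\<Prod>j\<in>J. \<psi>' + fps_const (d j)))"
  shows "\<psi> = \<psi>'"
proof (rule fps_eqI_agree)
  fix n
  show "fps_agree n \<psi> \<psi>'"
  proof (induction n)
    case (Suc n)
    have "fps_agree (Suc n) (R oo (fps_X * (\<Prod>j\<in>J. \<psi> + fps_const (d j))))
        (R oo (fps_X * (\<Prod>j\<in>J. \<psi>' + fps_const (d j))))"
      using Suc by (intro fps_agree_compose fps_agree_Suc_mult fps_agree_prod fps_agree_add) auto
    with assms show ?case by metis
  qed simp
qed

section \<open>Matrices and block projections\<close>

lemma mat_mult_index:
  "A \<in> carrier_mat n m \<Longrightarrow> B \<in> carrier_mat m k \<Longrightarrow> i < n \<Longrightarrow> j < k \<Longrightarrow>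
     (A * B) $$ (i, j) = (\<Sum>l<m. A $$ (i, l) * B $$ (l, j))"
  by (auto simp: scalar_prod_def atLeast0LessThan intro!: sum.cong)

lemma mat_trace_mult_commute:
  assumes "A \<in> carrier_mat n m" "B \<in> carrier_mat m n"
  shows "mat_trace (A * B) = mat_trace (B * A)"
proof -
  have "mat_trace (A * B) = (\<Sum>i<n. \<Sum>l<m. A $$ (i, l) * B $$ (l, i))"
    using assms by (auto simp: mat_trace_def mat_mult_index[OF assms] simp del: index_mult_mat(1) intro!: sum.cong)
  also have "\<dots> = (\<Sum>l<m. \<Sum>i<n. B $$ (l, i) * A $$ (i, l))"
    by (subst sum.swap) (simp add: mult.commute)
  also have "\<dots> = mat_trace (B * A)"
    using assms by (auto simp: mat_trace_def mat_mult_index[OF assms(2,1)] simp del: index_mult_mat(1) intro!: sum.cong)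
  finally show ?thesis .
qed

lemma mat_adjoint_carrier: "A \<in> carrier_mat n m \<Longrightarrow> mat_adjoint A \<in> carrier_mat m n"
  by (auto simp: mat_adjoint_def)

lemma mat_adjoint_index:
  fixes A :: "complex mat"
  assumes "A \<in> carrier_mat n m" "i < m" "j < n"
  shows "mat_adjoint A $$ (i, j) = cnj (A $$ (j, i))"
  using assms by (simp add: mat_adjoint_def mat_of_rows_index)

lemma mat_adjoint_mult:
  fixes A B :: "complex mat"
  assumes A: "A \<in> carrier_mat n m" and B: "B \<in> carrier_mat m k"
  shows "mat_adjoint (A * B) = mat_adjoint B * mat_adjoint A"
proof (rule eq_matI)
  fix i j assume "i < dim_row (mat_adjoint B * mat_adjoint A)" "j < dim_col (mat_adjoint B * mat_adjoint A)"
  hence ij: "i < k" "j < n" using mat_adjoint_carrier[OF A] mat_adjoint_carrier[OF B] by auto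
  have "mat_adjoint (A * B) $$ (i, j) = (\<Sum>l<m. cnj (A $$ (j, l) * B $$ (l, i)))"
    using ij A B by (subst mat_adjoint_index[of _ n k]) (auto simp: mat_mult_index[OF A B] simp del: index_mult_mat(1))
  also have "\<dots> = (\<Sum>l<m. mat_adjoint B $$ (i, l) * mat_adjoint A $$ (l, j))"
    using ij by (intro sum.cong refl) (simp add: mat_adjoint_index[OF A] mat_adjoint_index[OF B] mult.commute)
  also have "\<dots> = (mat_adjoint B * mat_adjoint A) $$ (i, j)"
    by (rule mat_mult_index[symmetric]) (use ij A B mat_adjoint_carrier in auto)
  finally show "mat_adjoint (A * B) $$ (i, j) = (mat_adjoint B * mat_adjoint A) $$ (i, j)" .
qed (use mat_adjoint_carrier[OF A] mat_adjoint_carrier[OF B] mat_adjoint_carrier[OF mult_carrier_mat[OF A B]] in auto)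

lemma mat_prod_list_simps [simp]:
  "mat_prod_list n [] = 1\<^sub>m n" "mat_prod_list n (A # As) = A * mat_prod_list n As"
  by (simp_all add: mat_prod_list_def)

lemma mat_prod_list_carrier:
  "(\<And>A. A \<in> set As \<Longrightarrow> A \<in> carrier_mat n n) \<Longrightarrow> mat_prod_list n As \<in> carrier_mat n n"
  by (induction As) (auto intro!: mult_carrier_mat[of _ n n])

lemma mat_prod_list_append:
  assumes "\<And>A. A \<in> set As \<Longrightarrow> A \<in> carrier_mat n n" "\<And>A. A \<in> set Bs \<Longrightarrow> A \<in> carrier_mat n n"
  shows "mat_prod_list n (As @ Bs) = mat_prod_list n As * mat_prod_list n Bs"
  using assms(1)
proof (induction As)
  case Nil
  show ?case using mat_prod_list_carrier[of Bs n] assms(2) by simp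
next
  case (Cons A As)
  have "mat_prod_list n As \<in> carrier_mat n n" "mat_prod_list n Bs \<in> carrier_mat n n" "A \<in> carrier_mat n n"
    using Cons.prems assms(2) by (auto intro!: mat_prod_list_carrier)
  thus ?case using Cons by (simp add: assoc_mult_mat[of A n n _ n _ n])
qed

lemma mat_prod_list_replicate:
  assumes "A \<in> carrier_mat n n"
  shows "mat_prod_list n (replicate k A) = A ^\<^sub>m k"
proof (induction k)
  case (Suc k)
  have "mat_prod_list n (replicate (Suc k) A) = mat_prod_list n (replicate k A @ [A])"
    by (simp add: replicate_append_same)
  also have "\<dots> = mat_prod_list n (replicate k A) * (A * 1\<^sub>m n)"
    using assms by (subst mat_prod_list_append) auto
  finally show ?case using Suc assms by simp
qed (use assms in simp)

definition block_index :: "(nat \<Rightarrow> nat) \<Rightarrow> nat \<Rightarrow> nat set" where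
  "block_index s j = {(\<Sum>l\<in>{1..<j}. s l)..<(\<Sum>l\<in>{1..j}. s l)}"

lemma block_proj_altdef:
  "block_proj n s j = mat n n (\<lambda>(i, k). if i = k \<and> i \<in> block_index s j then 1 else 0)"
  by (simp add: block_proj_def block_index_def)

lemma block_proj_carrier [simp]: "block_proj n s j \<in> carrier_mat n n"
  by (simp add: block_proj_def)

lemma block_index_disjoint:
  assumes "i \<noteq> j"
  shows "block_index s i \<inter> block_index s j = {}"
proof -
  have *: "block_index s i \<inter> block_index s j = {}" if "i < j" for i j
  proof -
    have "(\<Sum>l\<in>{1..i}. s l) \<le> (\<Sum>l\<in>{1..<j}. s l)" using that by (intro sum_mono2) auto
    thus ?thesis by (auto simp: block_index_def)
  qed
  show ?thesis using *[of i j] *[of j i] assms by (cases i j rule: linorder_cases) auto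
qed

lemma block_proj_mult:
  "block_proj n s i * block_proj n s j = (if i = j then block_proj n s i else 0\<^sub>m n n)"
proof (rule eq_matI)
  fix a b
  assume "a < dim_row (if i = j then block_proj n s i else 0\<^sub>m n n)"
    "b < dim_col (if i = j then block_proj n s i else 0\<^sub>m n n)"
  hence ab: "a < n" "b < n" by (auto simp: block_proj_def split: if_splits)
  have "(block_proj n s i * block_proj n s j) $$ (a, b) =
      (\<Sum>l<n. block_proj n s i $$ (a, l) * block_proj n s j $$ (l, b))"
    using ab by (intro mat_mult_index) auto
  also have "\<dots> = (\<Sum>l<n. if l = a then (if a \<in> block_index s i \<and> a = b \<and> a \<in> block_index s j then 1 else 0) else 0)"
    using ab by (intro sum.cong) (auto simp: block_proj_altdef)
  also have "\<dots> = (if a \<in> block_index s i \<and> a = b \<and> a \<in> block_index s j then 1 else 0)"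
    using ab by simp
  also have "\<dots> = (if i = j then block_proj n s i else 0\<^sub>m n n) $$ (a, b)"
    using ab block_index_disjoint[of i j s] by (auto simp: block_proj_altdef)
  finally show "(block_proj n s i * block_proj n s j) $$ (a, b) =
      (if i = j then block_proj n s i else 0\<^sub>m n n) $$ (a, b)" .
qed (auto simp: block_proj_def)

lemma block_proj_adjoint: "mat_adjoint (block_proj n s j) = block_proj n s j"
proof (rule eq_matI)
  fix a b assume "a < dim_row (block_proj n s j)" "b < dim_col (block_proj n s j)"
  hence "a < n" "b < n" by (auto simp: block_proj_def)
  thus "mat_adjoint (block_proj n s j) $$ (a, b) = block_proj n s j $$ (a, b)"
    by (subst mat_adjoint_index[of _ n n]) (auto simp: block_proj_altdef)
qed (auto simp: block_proj_def mat_adjoint_def)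

lemma mat_trace_block_proj: "mat_trace (block_proj n s j) = of_nat (card ({..<n} \<inter> block_index s j))"
proof -
  have "mat_trace (block_proj n s j) = (\<Sum>i<n. if i \<in> block_index s j then 1 else 0)"
    unfolding mat_trace_def by (auto simp: block_proj_altdef intro!: sum.cong)
  also have "\<dots> = of_nat (card ({..<n} \<inter> block_index s j))"
    by (simp add: sum.inter_restrict[symmetric])
  finally show ?thesis .
qed

text \<open>The uniform bound that freeness from diagonal matrices requires.\<close>

lemma mat_op_norm_block_proj_le: "mat_op_norm (block_proj n s j) \<le> 1"
  unfolding mat_op_norm_def
proof (rule cSUP_least)
  have "0\<^sub>v n \<in> {v \<in> carrier_vec (dim_col (block_proj n s j)). vec_l2_norm v \<le> 1}"
    by (auto simp: vec_l2_norm_def block_proj_def)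
  thus "{v \<in> carrier_vec (dim_col (block_proj n s j)). vec_l2_norm v \<le> 1} \<noteq> {}" by blast
next
  fix v assume "v \<in> {v \<in> carrier_vec (dim_col (block_proj n s j)). vec_l2_norm v \<le> 1}"
  hence v: "dim_vec v = n" "vec_l2_norm v \<le> 1" by (auto simp: block_proj_def)
  have "vec_index (block_proj n s j *\<^sub>v v) i = (if i \<in> block_index s j then vec_index v i else 0)" if "i < n" for i
  proof -
    have "vec_index (block_proj n s j *\<^sub>v v) i = (\<Sum>l<n. block_proj n s j $$ (i, l) * vec_index v l)"
      using that v by (auto simp: scalar_prod_def block_proj_def atLeast0LessThan intro!: sum.cong)
    also have "\<dots> = (\<Sum>l<n. if l = i then (if i \<in> block_index s j then vec_index v i else 0) else 0)"
      using that by (intro sum.cong) (auto simp: block_proj_altdef)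
    finally show ?thesis using that by simp
  qed
  hence "vec_l2_norm (block_proj n s j *\<^sub>v v) \<le> vec_l2_norm v"
    unfolding vec_l2_norm_def using v
    by (intro real_sqrt_le_mono) (auto simp: block_proj_def intro!: sum_mono)
  thus "vec_l2_norm (block_proj n s j *\<^sub>v v) \<le> 1" using v by simp
qed

lemma mat_prod_list_block_proj:
  "mat_prod_list n (map (block_proj n s) (i # w)) =
     (if set w \<subseteq> {i} then block_proj n s i else 0\<^sub>m n n)"
proof (induction w arbitrary: i)
  case Nil
  show ?case using right_mult_one_mat[OF block_proj_carrier] by simp
next
  case (Cons j w)
  have "mat_prod_list n (map (block_proj n s) (i # j # w)) =
      block_proj n s i * (if set w \<subseteq> {j} then block_proj n s j else 0\<^sub>m n n)"
    using Cons[of j] by simp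
  also have "\<dots> = (if set (j # w) \<subseteq> {i} then block_proj n s i else 0\<^sub>m n n)"
    using right_mult_zero_mat[OF block_proj_carrier] by (auto simp: block_proj_mult)
  finally show ?case .
qed

primrec zigzag_mat ::
    "nat \<Rightarrow> (nat \<Rightarrow> complex mat) \<Rightarrow> (nat \<Rightarrow> complex mat) \<Rightarrow> nat \<Rightarrow> nat \<Rightarrow> complex mat" where
  "zigzag_mat p D Z 0 a = D (zigzag_level p a)"
| "zigzag_mat p D Z (Suc k) a = D (zigzag_level p a) * (Z (zigzag_colour p a) * zigzag_mat p D Z k (Suc a))"

lemma zigzag_mat_periodic: "zigzag_mat p D Z k (a + 2 * p) = zigzag_mat p D Z k a"
proof (induction k arbitrary: a)
  case (Suc k)
  from Suc[of "Suc a"] show ?case by simp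
qed simp

text \<open>The matrices at one point of the probability space; \<open>Z l\<close> stands for \<open>Y\<^sub>l\<close>.\<close>

locale zigzag_matrices =
  fixes p n :: nat and D Z :: "nat \<Rightarrow> complex mat"
  assumes p: "p \<ge> 1"
    and D [simp]: "D j \<in> carrier_mat n n" and Z [simp]: "Z j \<in> carrier_mat n n"
    and D_idem: "D j * D j = D j" and D_adj: "mat_adjoint (D j) = D j" and Z_adj: "mat_adjoint (Z j) = Z j"
begin

abbreviation S where "S \<equiv> zigzag_mat p D Z"

lemma S_carrier [simp]: "S k a \<in> carrier_mat n n"
  by (induction k arbitrary: a) (auto intro!: mult_carrier_mat[of _ n n])

lemma assoc: "A \<in> carrier_mat n n \<Longrightarrow> B \<in> carrier_mat n n \<Longrightarrow> E \<in> carrier_mat n n \<Longrightarrow> A * B * E = A * (B * E)"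
  for A B E :: "complex mat"
  by (rule assoc_mult_mat)

lemma mult_carrier [simp]: "A \<in> carrier_mat n n \<Longrightarrow> B \<in> carrier_mat n n \<Longrightarrow> A * B \<in> carrier_mat n n"
  for A B :: "complex mat"
  by (rule mult_carrier_mat)

lemma D_S: "D (zigzag_level p a) * S k a = S k a"
  by (cases k) (simp_all add: D_idem assoc[symmetric])

lemma S_append: "S k a * S j (a + k) = S (k + j) a"
proof (induction k arbitrary: a)
  case 0
  show ?case by (simp add: D_S)
next
  case (Suc k)
  have "S (Suc k) a * S j (a + Suc k) =
      D (zigzag_level p a) * (Z (zigzag_colour p a) * (S k (Suc a) * S j (Suc a + k)))"
    by (simp add: assoc)
  thus ?case unfolding Suc by simp
qed

lemma S_D: "S k a * D (zigzag_level p (a + k)) = S k a"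
  using S_append[of k a 0] by simp

lemma block_products:
  assumes "1 \<le> l" "l \<le> p"
  shows "mat_prod_list n (map (\<lambda>l. D l * Z l * D (Suc l)) [l..<Suc p]) = S (Suc p - l) (l - 1)"
  using assms(2,1)
proof (induction rule: inc_induct)
  case base
  have "zigzag_level p (p - 1) = p" "zigzag_level p p = Suc p" "zigzag_colour p (p - 1) = p"
    using p zigzag_level_up[of "p - 1" p] zigzag_level_up[of p p] zigzag_colour_times[of p p] by auto
  thus ?case using p right_mult_one_mat[OF D] by (simp add: assoc)
next
  case (step l)
  have l: "1 \<le> l" "l < p" using step by auto
  obtain a where a: "l = Suc a" using l by (cases l) auto
  have lev: "zigzag_level p a = l" "zigzag_colour p a = l" "zigzag_level p l = Suc l"
    using l a zigzag_level_up[of a p] zigzag_level_up[of l p] zigzag_colour_times[of l p] by auto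
  have "mat_prod_list n (map (\<lambda>l. D l * Z l * D (Suc l)) [l..<Suc p]) =
      D l * Z l * D (Suc l) * S (Suc p - Suc l) l"
    using step l by (simp add: upt_rec[of l])
  also have "\<dots> = D l * (Z l * S (Suc p - Suc l) l)"
    using D_S[of l] by (simp add: assoc lev)
  also have "\<dots> = S (Suc (Suc p - Suc l)) a" by (simp add: lev a[symmetric])
  also have "Suc (Suc p - Suc l) = Suc p - l" using l by simp
  finally show ?case by (simp add: a)
qed

text \<open>Reversing the climb to the top gives the descent from the top.\<close>

lemma S_adjoint:
  assumes "j \<le> p"
  shows "mat_adjoint (S j (p - j)) = S j p"
  using assms
proof (induction j)
  case 0
  show ?case by (simp add: D_adj)
next
  case (Suc j)
  define l where "l = p - j"
  have l: "1 \<le> l" "l \<le> p" "p - Suc j = l - 1" "Suc (l - 1) = l" "p + j = 2 * p - l" using Suc.prems by (auto simp: l_def)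
  have lev: "zigzag_level p (l - 1) = l" "zigzag_level p (Suc (2 * p - l)) = l"
    "zigzag_colour p (l - 1) = l" "zigzag_colour p (2 * p - l) = l"
    using l p zigzag_level_up[of "l - 1" p] zigzag_level_down'[of l p] zigzag_colour_times[of l p] by auto
  have "S (Suc j) (p - Suc j) = D l * (Z l * S j (p - j))"
    unfolding l(3) by (simp only: zigzag_mat.simps lev l(4)) (simp only: l_def)
  hence "mat_adjoint (S (Suc j) (p - Suc j)) = S j p * Z l * D l"
    using Suc by (simp add: mat_adjoint_mult[of _ n n _ n] D_adj Z_adj)
  also have "\<dots> = S j p * D (zigzag_level p (p + j)) * Z l * D l" by (simp add: S_D)
  also have "\<dots> = S j p * S 1 (p + j)" unfolding l(5) by (simp add: lev assoc)
  also have "\<dots> = S (Suc j) p" by (subst S_append) simp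
  finally show ?case .
qed

lemma D_block_power:
  "D 1 * (mat_prod_list n (map (\<lambda>l. D l * Z l * D (Suc l)) [1..<Suc p]) *
     mat_adjoint (mat_prod_list n (map (\<lambda>l. D l * Z l * D (Suc l)) [1..<Suc p]))) ^\<^sub>m k = S (2 * p * k) 0"
proof -
  have lev: "zigzag_level p 0 = 1" using zigzag_level_up[of 0 p] p by simp
  have "mat_prod_list n (map (\<lambda>l. D l * Z l * D (Suc l)) [1..<Suc p]) = S p 0"
    using block_products[of 1] p by simp
  moreover have "mat_adjoint (S p 0) = S p p" using S_adjoint[of p] by simp
  moreover have "S p 0 * S p p = S (2 * p) 0" using S_append[of p 0 p] by (simp add: mult_2)
  ultimately have "D 1 * (mat_prod_list n (map (\<lambda>l. D l * Z l * D (Suc l)) [1..<Suc p]) *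
     mat_adjoint (mat_prod_list n (map (\<lambda>l. D l * Z l * D (Suc l)) [1..<Suc p]))) ^\<^sub>m k = D 1 * S (2 * p) 0 ^\<^sub>m k"
    by simp
  also have "\<dots> = S (2 * p * k) 0"
  proof (induction k)
    case 0
    have "dim_row (S (2 * p) 0) = n" using S_carrier[of "2 * p" 0] by blast
    thus ?case using right_mult_one_mat[OF D] by (simp add: lev)
  next
    case (Suc k)
    have "D 1 * S (2 * p) 0 ^\<^sub>m Suc k = (D 1 * S (2 * p) 0 ^\<^sub>m k) * S (2 * p) 0"
      by (simp add: assoc)
    also have "\<dots> = S (2 * p * k) 0 * S (2 * p) (0 + 2 * p * k)"
    proof -
      have "S (2 * p) (0 + 2 * p * k) = S (2 * p) 0"
      proof (induction k)
        case (Suc k)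
        from zigzag_mat_periodic[of p D Z "2 * p" "2 * p * k"] Suc show ?case
          by (simp add: algebra_simps)
      qed simp
      thus ?thesis unfolding Suc by simp
    qed
    also have "\<dots> = S (2 * p * Suc k) 0" by (subst S_append) (simp add: algebra_simps)
    finally show ?case .
  qed
  finally show ?thesis .
qed

end

lemma zigzag_mat_word:
  assumes "\<And>j. X (Inr j) = D j" "\<And>l. X (Inl (u l)) = Z l" "\<And>j. D j \<in> carrier_mat n n"
  shows "mat_prod_list n (map X (seg (\<lambda>t. [Inr (zigzag_level p t)]) (\<lambda>t. Inl (u (zigzag_colour p t))) k a)) =
    zigzag_mat p D Z k a"
  by (induction k arbitrary: a) (simp_all add: assms right_mult_one_mat[OF assms(3)])

section \<open>Limit distributions of random matrices\<close>

lemma tau_cong: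
  "(\<And>\<omega>. \<omega> \<in> space M \<Longrightarrow> mat_trace (A \<omega>) = mat_trace (B \<omega>)) \<Longrightarrow> tau M n A = tau M n B"
  unfolding tau_def by (metis (no_types, lifting) Bochner_Integration.integral_cong)

lemma tau_const: "prob_space M \<Longrightarrow> tau M n (\<lambda>_. A) = mat_trace A / of_nat n"
  by (simp add: tau_def prob_space.prob_space)

lemma limit_distribution_cong:
  assumes "limit_distribution M X \<phi>"
    and "\<And>n \<omega>. \<omega> \<in> space (M n) \<Longrightarrow>
      mat_trace (mat_prod_list n (map (\<lambda>g. X g n \<omega>) v)) = mat_trace (mat_prod_list n (map (\<lambda>g. X g n \<omega>) w))"
  shows "\<phi> v = \<phi> w"
proof (rule LIMSEQ_unique)
  show "(\<lambda>n. tau (M n) n (\<lambda>\<omega>. mat_prod_list n (map (\<lambda>g. X g n \<omega>) v))) \<longlonglongrightarrow> \<phi> v"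
    using assms(1) by (simp add: limit_distribution_def)
  have "tau (M n) n (\<lambda>\<omega>. mat_prod_list n (map (\<lambda>g. X g n \<omega>) v)) =
      tau (M n) n (\<lambda>\<omega>. mat_prod_list n (map (\<lambda>g. X g n \<omega>) w))" for n
    by (rule tau_cong) (rule assms(2))
  thus "(\<lambda>n. tau (M n) n (\<lambda>\<omega>. mat_prod_list n (map (\<lambda>g. X g n \<omega>) v))) \<longlonglongrightarrow> \<phi> w"
    using assms(1) by (simp add: limit_distribution_def)
qed

lemma limit_distribution_Nil:
  assumes "limit_distribution M X \<phi>" "\<And>n. prob_space (M n)"
  shows "\<phi> [] = 1"
proof (rule LIMSEQ_unique)
  show "(\<lambda>n. tau (M n) n (\<lambda>\<omega>. mat_prod_list n (map (\<lambda>g. X g n \<omega>) []))) \<longlonglongrightarrow> \<phi> []"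
    using assms(1) unfolding limit_distribution_def by blast
  have "\<forall>\<^sub>F n in sequentially. 1 = tau (M n) n (\<lambda>\<omega>. mat_prod_list n (map (\<lambda>g. X g n \<omega>) []))"
    using eventually_gt_at_top[of 0] by eventually_elim (simp add: tau_const assms(2) mat_trace_def)
  thus "(\<lambda>n. tau (M n) n (\<lambda>\<omega>. mat_prod_list n (map (\<lambda>g. X g n \<omega>) []))) \<longlonglongrightarrow> 1"
    by (rule Lim_transform_eventually[OF tendsto_const])
qed

lemma limit_distribution_trace:
  assumes "limit_distribution M X \<phi>" "\<And>g n \<omega>. \<omega> \<in> space (M n) \<Longrightarrow> X g n \<omega> \<in> carrier_mat n n"
  shows "\<phi> (u @ v) = \<phi> (v @ u)"
proof (rule limit_distribution_cong[OF assms(1)])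
  fix n \<omega> assume \<omega>: "\<omega> \<in> space (M n)"
  have carrier: "A \<in> carrier_mat n n" if "A \<in> set (map (\<lambda>g. X g n \<omega>) w)" for A w
    using that assms(2)[OF \<omega>] by auto
  have append: "mat_prod_list n (map (\<lambda>g. X g n \<omega>) (w @ w')) =
      mat_prod_list n (map (\<lambda>g. X g n \<omega>) w) * mat_prod_list n (map (\<lambda>g. X g n \<omega>) w')" for w w'
    unfolding map_append by (rule mat_prod_list_append; erule carrier)
  show "mat_trace (mat_prod_list n (map (\<lambda>g. X g n \<omega>) (u @ v))) =
        mat_trace (mat_prod_list n (map (\<lambda>g. X g n \<omega>) (v @ u)))"
    unfolding append
    by (rule mat_trace_mult_commute; rule mat_prod_list_carrier; erule carrier)
qed

text \<open>The block sizes add up to \<open>n\<close>, so the projections with an index outside \<open>{1..q}\<close> are zero and cause no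
  trouble as further members of the family.\<close>

lemma block_proj_limit_distribution:
  fixes N :: "nat \<Rightarrow> nat \<Rightarrow> nat" and M :: "nat \<Rightarrow> 'w measure" and d :: "nat \<Rightarrow> real"
  assumes sum: "\<And>n. (\<Sum>j\<in>{1..q}. N n j) = n"
    and lim: "\<And>j. j \<in> {1..q} \<Longrightarrow> (\<lambda>n. real (N n j) / real n) \<longlonglongrightarrow> d j"
    and prob: "\<And>n. prob_space (M n)"
  shows "\<exists>\<delta>. limit_distribution M (\<lambda>j n \<omega>. block_proj n (N n) j) \<delta> \<and>
           (\<forall>j\<in>{1..q}. \<delta> [j] = complex_of_real (d j))"
proof -
  have sizes: "card ({..<n} \<inter> block_index (N n) j) = (if j \<in> {1..q} then N n j else 0)" for n j
  proof -
    consider "j = 0" | "j \<in> {1..q}" | "j > q" by fastforce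
    thus ?thesis
    proof cases
      case 1
      thus ?thesis by (simp add: block_index_def)
    next
      case 2
      have "(\<Sum>l\<in>{1..j}. N n l) \<le> (\<Sum>l\<in>{1..q}. N n l)" using 2 by (intro sum_mono2) auto
      hence "{..<n} \<inter> block_index (N n) j = block_index (N n) j"
        using sum[of n] by (auto simp: block_index_def)
      moreover have "{1..j} = insert j {1..<j}" using 2 by auto
      hence "(\<Sum>l\<in>{1..j}. N n l) = N n j + (\<Sum>l\<in>{1..<j}. N n l)" by simp
      ultimately show ?thesis using 2 by (simp add: block_index_def)
    next
      case 3
      have "(\<Sum>l\<in>{1..q}. N n l) \<le> (\<Sum>l\<in>{1..<j}. N n l)" using 3 by (intro sum_mono2) auto
      hence "{..<n} \<inter> block_index (N n) j = {}" using sum[of n] by (auto simp: block_index_def)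
      thus ?thesis using 3 by simp
    qed
  qed
  define \<delta> where "\<delta> = (\<lambda>w. case w of [] \<Rightarrow> 1 | j # v \<Rightarrow>
      if set v \<subseteq> {j} \<and> j \<in> {1..q} then complex_of_real (d j) else 0)"
  have "(\<lambda>n. tau (M n) n (\<lambda>\<omega>. mat_prod_list n (map (\<lambda>j. block_proj n (N n) j) w))) \<longlonglongrightarrow> \<delta> w" for w
  proof (cases w)
    case Nil
    have "\<forall>\<^sub>F n in sequentially. 1 = tau (M n) n (\<lambda>\<omega>. mat_prod_list n (map (\<lambda>j. block_proj n (N n) j) w))"
      using eventually_gt_at_top[of 0] by eventually_elim (simp add: tau_const prob mat_trace_def Nil)
    thus ?thesis by (simp add: \<delta>_def Nil Lim_transform_eventually[OF tendsto_const])
  next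
    case (Cons j v)
    have tau: "tau (M n) n (\<lambda>\<omega>. mat_prod_list n (map (\<lambda>j. block_proj n (N n) j) w)) =
        (if set v \<subseteq> {j} \<and> j \<in> {1..q} then complex_of_real (real (N n j) / real n) else 0)" for n
    proof -
      have "mat_trace (0\<^sub>m n n) = 0" by (simp add: mat_trace_def)
      thus ?thesis
        unfolding tau_const[OF prob] Cons mat_prod_list_block_proj
        by (auto simp: mat_trace_block_proj sizes)
    qed
    show ?thesis
    proof (cases "set v \<subseteq> {j} \<and> j \<in> {1..q}")
      case True
      hence "(\<lambda>n. complex_of_real (real (N n j) / real n)) \<longlonglongrightarrow> complex_of_real (d j)"
        using lim by (intro tendsto_of_real) auto
      with True show ?thesis unfolding tau by (simp add: \<delta>_def Cons)
    next
      case False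
      hence "\<delta> w = 0" by (auto simp: \<delta>_def Cons)
      thus ?thesis unfolding tau if_not_P[OF False] by simp
    qed
  qed
  hence "limit_distribution M (\<lambda>j n \<omega>. block_proj n (N n) j) \<delta>" by (simp add: limit_distribution_def)
  moreover have "\<forall>j\<in>{1..q}. \<delta> [j] = complex_of_real (d j)" by (simp add: \<delta>_def)
  ultimately show ?thesis by blast
qed

text \<open>A segment is first rotated so that the projections at its two ends meet; this gives either zero or a
  word that begins with a letter \<open>Y\<close>, to which the Schwinger-Dyson equation applies.\<close>

lemma zigzag_of_free_projections:
  fixes \<phi> :: "('u + nat) list \<Rightarrow> complex" and u :: "nat \<Rightarrow> 'u" and d :: "nat \<Rightarrow> complex"
  assumes p: "p \<ge> 1" and u: "inj_on u {1..p}" and one: "\<phi> [] = 1"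
    and trace: "\<And>v w. \<phi> (v @ w) = \<phi> (w @ v)"
    and proj: "\<And>v w i j. \<phi> (v @ Inr i # Inr j # w) = (if i = j then \<phi> (v @ Inr i # w) else 0)"
    and d: "\<And>j. j \<in> {1..Suc p} \<Longrightarrow> \<phi> [Inr j] = d j"
    and free: "free_families \<phi> (\<lambda>b :: bool. if b then range Inl else range Inr)"
    and free_Inl: "free_families (\<lambda>w. \<phi> (map Inl w)) (\<lambda>v. {v})"
  shows "zigzag p d (\<lambda>l. free_cumulant (\<lambda>k. \<phi> (replicate k (Inl (u l)))))
    (\<lambda>a k. \<phi> (seg (\<lambda>t. [Inr (zigzag_level p t)]) (\<lambda>t. Inl (u (zigzag_colour p t))) k a))"
proof -
  define D where "D = (\<lambda>t. [Inr (zigzag_level p t) :: 'u + nat])"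
  define c where "c = (\<lambda>t. Inl (u (zigzag_colour p t)) :: 'u + nat)"
  define f where "f = (\<lambda>a k. \<phi> (seg D c k a))"
  have f_Suc: "f a (Suc k) =
      (if zigzag_level p a = zigzag_level p (a + Suc k) then \<phi> (c a # seg D c k (Suc a)) else 0)" for a k
  proof -
    obtain v where v: "seg D c k (Suc a) = v @ D (Suc a + k)" using seg_last by blast
    have "f a (Suc k) = \<phi> (D a @ c a # seg D c k (Suc a))" by (simp add: f_def)
    also have "\<dots> = \<phi> ([Inr (zigzag_level p a)] @ (c a # v @ D (Suc a + k)))"
      unfolding v by (simp add: D_def)
    also have "\<dots> = \<phi> ((c a # v) @ Inr (zigzag_level p (Suc a + k)) # Inr (zigzag_level p a) # [])"
      by (subst trace) (simp add: D_def)
    finally show ?thesis unfolding proj v by (auto simp: D_def)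
  qed
  have colour_eq: "c t = c a \<longleftrightarrow> zigzag_colour p t = zigzag_colour p a" for t a
    using inj_onD[OF u] zigzag_colour_range[OF p] by (auto simp: c_def)
  have "zigzag p d (\<lambda>l. free_cumulant (\<lambda>k. \<phi> (replicate k (Inl (u l))))) f"
  proof
    show "f (a + 2 * p) k = f a k" for a k
      unfolding f_def by (subst seg_periodic) (simp_all add: D_def c_def)
    show "f a k = 0" if "zigzag_level p a \<noteq> zigzag_level p (a + k)" for a k
      using that f_Suc by (cases k) simp_all
    show "f a 0 = d (zigzag_level p a)" for a
      using d[OF zigzag_level_range[OF p]] by (simp add: f_def D_def)
    show "f (Suc a) k = f a k" if k: "2 * p dvd k" "k > 0" for a k
    proof -
      obtain n where n: "k = Suc n" using k(2) by (cases k) auto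
      have per: "h (t + k) = h t" if "\<And>t. h (t + 2 * p) = h t" for h :: "nat \<Rightarrow> nat" and t
        using periodic_mod[where h = h and m = "2 * p", OF that] k(1)
        by (metis add.right_neutral dvd_imp_mod_0 mod_add_right_eq)
      have "zigzag_level p (a + k) = zigzag_level p a" "zigzag_colour p (a + k) = zigzag_colour p a"
        by (auto intro: per)
      hence lev: "zigzag_level p a = zigzag_level p (a + Suc n)" and col: "c (Suc a + n) = c a"
        by (simp_all add: n c_def)
      obtain v where v: "seg D c n (Suc a) = D (Suc a) @ v" using seg_hd by blast
      have "zigzag_level p (Suc (a + k)) = zigzag_level p (Suc a)"
        using per[of "zigzag_level p" "Suc a"] by simp
      hence D: "D (Suc (Suc a + n)) = D (Suc a)" by (simp add: D_def n)
      have "f (Suc a) k = \<phi> ((seg D c n (Suc a) @ [c a]) @ D (Suc a))"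
        unfolding f_def n seg_snoc col D by simp
      also have "\<dots> = \<phi> ([] @ Inr (zigzag_level p (Suc a)) # Inr (zigzag_level p (Suc a)) # v @ [c a])"
        by (subst trace, unfold v) (simp add: D_def)
      also have "\<dots> = \<phi> (seg D c n (Suc a) @ [c a])"
        unfolding proj v by (simp add: D_def)
      also have "\<dots> = f a k" using f_Suc[of a n] lev by (subst trace) (simp add: n)
      finally show ?thesis .
    qed
    show "f a (Suc k) = (\<Sum>r\<le>k. free_cumulant (\<lambda>k. \<phi> (replicate k (Inl (u (zigzag_colour p a))))) (Suc r) *
        path_split f (\<lambda>t. zigzag_colour p t = zigzag_colour p a) r (Suc a) k)"
      if lev: "zigzag_level p a = zigzag_level p (a + Suc k)" for a k
    proof -
      have "schwinger_dyson \<phi> (c a) (free_cumulant (\<lambda>k. \<phi> (replicate k (c a)))) (seg D c k (Suc a))"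
        unfolding c_def by (rule schwinger_dyson_two_level[OF _ free free_Inl]) (rule one)
      from schwinger_dyson_seg[OF this] have "\<phi> (c a # seg D c k (Suc a)) =
          (\<Sum>r\<le>k. free_cumulant (\<lambda>k. \<phi> (replicate k (c a))) (Suc r) *
            path_split f (\<lambda>t. c t = c a) r (Suc a) k)"
        by (simp add: f_def D_def c_def)
      with f_Suc[of a k] lev show ?thesis unfolding colour_eq by (simp add: c_def)
    qed
  qed (rule p)
  thus ?thesis by (simp only: f_def D_def c_def)
qed

section \<open>The limit moments of the block product\<close>

theorem lemma5p2:
  fixes p :: nat
    and M :: "nat \<Rightarrow> 'w measure"
    and Y :: "'u \<Rightarrow> nat \<Rightarrow> 'w \<Rightarrow> complex mat"
    and N :: "nat \<Rightarrow> nat \<Rightarrow> nat"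
    and d :: "nat \<Rightarrow> real"
    and u :: "nat \<Rightarrow> 'u"
    and \<nu> :: "nat \<Rightarrow> nat \<Rightarrow> complex"
  assumes "p \<ge> 1"
    and "\<And>n. (\<Sum>j\<in>{1..p + 1}. N n j) = n"
    and "\<And>j. j \<in> {1..p + 1} \<Longrightarrow> (\<lambda>n. real (N n j) / real n) \<longlonglongrightarrow> d j"
    and "\<And>j. j \<in> {1..p + 1} \<Longrightarrow> d j > 0"
    and "\<And>n. prob_space (M n)"
    and "\<And>v n. random_matrix (M n) n (Y v n)"
    and "\<And>v n \<omega>. \<omega> \<in> space (M n) \<Longrightarrow> hermitian_mat (Y v n \<omega>)"
    and "\<And>n. prob_space.indep_vars (M n) (\<lambda>v. mat_space n)
               (\<lambda>v \<omega>. mat_entries n (Y v n \<omega>)) UNIV"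
    and A1: "asymptotically_free M Y (\<lambda>v. {v})"
    and A2: "asymptotically_free_from_diagonal M Y"
    and A3: "\<exists>C. \<forall>v n. AE \<omega> in M n. mat_op_norm (Y v n \<omega>) \<le> C"
    and "inj_on u {1..p}"
    and "\<And>j k. j \<in> {1..p} \<Longrightarrow> (\<lambda>n. tau (M n) n (\<lambda>\<omega>. Y (u j) n \<omega> ^\<^sub>m k)) \<longlonglongrightarrow> \<nu> j k"
  defines "B \<equiv> \<lambda>n \<omega>. block_product n (N n) p (\<lambda>l. Y (u l) n \<omega>)"
    and "R \<equiv> R_series (free_mult_conv_list (map (\<lambda>j. even_cumulant_dist (\<nu> j)) [1..<p + 1]))"
  shows "\<exists>m. (\<forall>k. (\<lambda>n. partial_tau (M n) n (N n) 1
                      (\<lambda>\<omega>. (B n \<omega> * mat_adjoint (B n \<omega>)) ^\<^sub>m k)) \<longlonglongrightarrow> m k) \<and>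
             (\<forall>\<psi>. fps_const (complex_of_real (d 1)) * \<psi> =
                    fps_compose R (fps_X * (\<Prod>j\<in>{1..p + 1}.
                      fps_const (complex_of_real (d 1)) * \<psi> + fps_const (complex_of_real (d j))))
                  \<longleftrightarrow> \<psi> = moment_gf m)"
proof -
  note p = assms(1) and sizes = assms(2) and ratios = assms(3) and d_pos = assms(4)
    and prob = assms(5) and rm = assms(6) and herm = assms(7) and u = assms(12) and \<nu> = assms(13)
  have Y_carrier: "Y v n \<omega> \<in> carrier_mat n n" if "\<omega> \<in> space (M n)" for v n \<omega>
    using rm[of n v] that by (simp add: random_matrix_def)
  obtain \<delta> where \<delta>: "limit_distribution M (\<lambda>j n \<omega>. block_proj n (N n) j) \<delta>"
      "\<And>j. j \<in> {1..p + 1} \<Longrightarrow> \<delta> [j] = complex_of_real (d j)"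
    using block_proj_limit_distribution[where q = "p + 1" and N = N and d = d and M = M] sizes ratios prob
    by blast
  \<comment> \<open>Freeness from diagonal matrices is used for the family of the block projections.\<close>
  define X where "X = (\<lambda>g n \<omega>. case g of Inl v \<Rightarrow> Y v n \<omega> | Inr j \<Rightarrow> block_proj n (N n) j)"
  have "asymptotically_free M X (\<lambda>b :: bool. if b then range Inl else range Inr)"
    unfolding X_def
  proof (rule A2[unfolded asymptotically_free_from_diagonal_def, rule_format], intro conjI allI)
    show "diagonal_mat (block_proj n (N n) j)" for j n
      by (auto simp: diagonal_mat_def block_proj_def)
    show "\<exists>C. \<forall>n. mat_op_norm (block_proj n (N n) j) \<le> C" for j
      using mat_op_norm_block_proj_le by blast
    show "\<exists>\<delta>. limit_distribution M (\<lambda>j n \<omega>. block_proj n (N n) j) \<delta>" using \<delta>(1) by blast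
  qed simp
  then obtain \<phi> where \<phi>: "limit_distribution M X \<phi>"
      and free: "free_families \<phi> (\<lambda>b :: bool. if b then range Inl else range Inr)"
    unfolding asymptotically_free_def by blast
  have X_carrier: "X g n \<omega> \<in> carrier_mat n n" if "\<omega> \<in> space (M n)" for g n \<omega>
    using Y_carrier[OF that] by (cases g) (simp_all add: X_def)
  have lim: "(\<lambda>n. tau (M n) n (\<lambda>\<omega>. mat_prod_list n (map (\<lambda>g. X g n \<omega>) w))) \<longlonglongrightarrow> \<phi> w" for w
    using \<phi> by (simp add: limit_distribution_def)
  obtain \<phi>' where \<phi>': "limit_distribution M Y \<phi>'" "free_families \<phi>' (\<lambda>v. {v})"
    using A1 unfolding asymptotically_free_def by blast
  \<comment> \<open>Both assumptions on freeness speak of the same limits, so the two functionals agree on words in \<open>Y\<close>.\<close>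
  have \<phi>_Inl: "\<phi> (map Inl w) = \<phi>' w" for w
  proof (rule LIMSEQ_unique[OF lim[of "map Inl w"]])
    show "(\<lambda>n. tau (M n) n (\<lambda>\<omega>. mat_prod_list n (map (\<lambda>g. X g n \<omega>) (map Inl w)))) \<longlonglongrightarrow> \<phi>' w"
      using \<phi>'(1) by (simp add: limit_distribution_def X_def o_def)
  qed
  have \<phi>_power: "\<phi> (replicate k (Inl (u j))) = \<nu> j k" if "j \<in> {1..p}" for j k
  proof (rule LIMSEQ_unique[OF lim])
    have "tau (M n) n (\<lambda>\<omega>. mat_prod_list n (map (\<lambda>g. X g n \<omega>) (replicate k (Inl (u j))))) =
        tau (M n) n (\<lambda>\<omega>. Y (u j) n \<omega> ^\<^sub>m k)" for n
      by (rule tau_cong) (simp add: map_replicate X_def mat_prod_list_replicate[OF Y_carrier])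
    with \<nu>[OF that, of k]
    show "(\<lambda>n. tau (M n) n (\<lambda>\<omega>. mat_prod_list n (map (\<lambda>g. X g n \<omega>) (replicate k (Inl (u j)))))) \<longlonglongrightarrow> \<nu> j k"
      by simp
  qed
  have \<phi>_proj: "\<phi> (v @ Inr i # Inr j # w) = (if i = j then \<phi> (v @ Inr i # w) else 0)" for v w i j
  proof -
    let ?W = "\<lambda>n \<omega> w. mat_prod_list n (map (\<lambda>g. X g n \<omega>) w)"
    have W: "?W n \<omega> (v @ Inr i # Inr j # w) = (if i = j then ?W n \<omega> (v @ Inr i # w) else 0\<^sub>m n n)"
      if "\<omega> \<in> space (M n)" for n \<omega>
    proof -
      have carrier: "?W n \<omega> w' \<in> carrier_mat n n" for w'
        by (rule mat_prod_list_carrier) (use X_carrier[OF that] in auto)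
      have append: "?W n \<omega> (v' @ w') = ?W n \<omega> v' * ?W n \<omega> w'" for v' w'
        unfolding map_append by (rule mat_prod_list_append) (use X_carrier[OF that] in auto)
      have W_Inr: "?W n \<omega> (Inr j # w') = block_proj n (N n) j * ?W n \<omega> w'" for j w'
        by (simp add: X_def)
      have "?W n \<omega> (v @ Inr i # Inr j # w) =
          ?W n \<omega> v * ((block_proj n (N n) i * block_proj n (N n) j) * ?W n \<omega> w)"
        unfolding append W_Inr
        by (subst assoc_mult_mat[OF block_proj_carrier block_proj_carrier carrier]) (rule refl)
      thus ?thesis
        unfolding block_proj_mult append W_Inr
        using carrier[of v] carrier[of w] by (cases "i = j") simp_all
    qed
    show ?thesis
    proof (cases "i = j")
      case True
      thus ?thesis using limit_distribution_cong[OF \<phi>, of "v @ Inr i # Inr j # w" "v @ Inr i # w"] W by simp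
    next
      case False
      have "tau (M n) n (\<lambda>\<omega>. ?W n \<omega> (v @ Inr i # Inr j # w)) = tau (M n) n (\<lambda>\<omega>. 0\<^sub>m n n)" for n
        by (rule tau_cong) (use W False in simp)
      hence "tau (M n) n (\<lambda>\<omega>. ?W n \<omega> (v @ Inr i # Inr j # w)) = 0" for n
        by (simp add: tau_const[OF prob] mat_trace_def)
      hence "(\<lambda>n. tau (M n) n (\<lambda>\<omega>. ?W n \<omega> (v @ Inr i # Inr j # w))) \<longlonglongrightarrow> 0" by simp
      from LIMSEQ_unique[OF lim this] False show ?thesis by simp
    qed
  qed
  have \<phi>_d: "\<phi> [Inr j] = complex_of_real (d j)" if "j \<in> {1..Suc p}" for j
  proof (rule LIMSEQ_unique[OF lim])
    have "(\<lambda>n. tau (M n) n (\<lambda>\<omega>. mat_prod_list n (map (\<lambda>j. block_proj n (N n) j) [j]))) \<longlonglongrightarrow> \<delta> [j]"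
      using \<delta>(1) unfolding limit_distribution_def by blast
    thus "(\<lambda>n. tau (M n) n (\<lambda>\<omega>. mat_prod_list n (map (\<lambda>g. X g n \<omega>) [Inr j]))) \<longlonglongrightarrow> complex_of_real (d j)"
      using \<delta>(2)[of j] that by (simp add: X_def)
  qed
  let ?d = "\<lambda>j. complex_of_real (d j)"
  let ?w = "seg (\<lambda>t. [Inr (zigzag_level p t)]) (\<lambda>t. Inl (u (zigzag_colour p t)))"
  interpret zigzag p ?d "\<lambda>l. free_cumulant (\<lambda>k. \<phi> (replicate k (Inl (u l))))" "\<lambda>a k. \<phi> (?w k a)"
  proof (rule zigzag_of_free_projections[OF p u _ _ \<phi>_proj \<phi>_d free])
    show "\<phi> [] = 1" by (rule limit_distribution_Nil[OF \<phi> prob])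
    show "\<phi> (v @ w) = \<phi> (w @ v)" for v w by (rule limit_distribution_trace[OF \<phi> X_carrier])
    show "free_families (\<lambda>w. \<phi> (map Inl w)) (\<lambda>v. {v})" using \<phi>'(2) by (simp add: \<phi>_Inl)
  qed
  define m where "m = (\<lambda>k. \<phi> (?w (2 * p * k) 0) / ?d 1)"
  have d1: "?d 1 \<noteq> 0" using d_pos[of 1] by simp
  have "(\<lambda>n. partial_tau (M n) n (N n) 1 (\<lambda>\<omega>. (B n \<omega> * mat_adjoint (B n \<omega>)) ^\<^sub>m k)) \<longlonglongrightarrow> m k" for k
  proof -
    have trace: "mat_trace (block_proj n (N n) 1 * (B n \<omega> * mat_adjoint (B n \<omega>)) ^\<^sub>m k) =
        mat_trace (mat_prod_list n (map (\<lambda>g. X g n \<omega>) (?w (2 * p * k) 0)))" if \<omega>: "\<omega> \<in> space (M n)" for n \<omega>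
    proof -
      interpret zm: zigzag_matrices p n "block_proj n (N n)" "\<lambda>l. Y (u l) n \<omega>"
        by unfold_locales (use p Y_carrier[OF \<omega>] herm[OF \<omega>] in
          \<open>auto simp: block_proj_mult block_proj_adjoint hermitian_mat_def\<close>)
      show ?thesis
        using zm.D_block_power[of k]
          zigzag_mat_word[of "\<lambda>g. X g n \<omega>" "block_proj n (N n)" u "\<lambda>l. Y (u l) n \<omega>" n p "2 * p * k" 0]
        by (simp add: B_def block_product_def X_def)
    qed
    have "partial_tau (M n) n (N n) 1 (\<lambda>\<omega>. (B n \<omega> * mat_adjoint (B n \<omega>)) ^\<^sub>m k) =
        inverse (complex_of_real (real (N n 1) / real n)) *
        tau (M n) n (\<lambda>\<omega>. mat_prod_list n (map (\<lambda>g. X g n \<omega>) (?w (2 * p * k) 0)))" for n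
    proof -
      have "(\<integral>\<omega>. mat_trace (block_proj n (N n) 1 * (B n \<omega> * mat_adjoint (B n \<omega>)) ^\<^sub>m k) \<partial>M n) =
          (\<integral>\<omega>. mat_trace (mat_prod_list n (map (\<lambda>g. X g n \<omega>) (?w (2 * p * k) 0))) \<partial>M n)"
        by (rule Bochner_Integration.integral_cong[OF refl]) (rule trace)
      \<comment> \<open>For \<open>n = 0\<close> both normalisations divide by zero, and both sides are \<open>0\<close>.\<close>
      moreover have "N n 1 = 0" if "n = 0"
        using sizes[of n] that p by (auto simp del: sum.cl_ivl_Suc)
      ultimately show ?thesis unfolding partial_tau_def tau_def by (cases "n = 0") (simp_all add: field_simps)
    qed
    moreover have "(\<lambda>n. inverse (complex_of_real (real (N n 1) / real n)) *
        tau (M n) n (\<lambda>\<omega>. mat_prod_list n (map (\<lambda>g. X g n \<omega>) (?w (2 * p * k) 0)))) \<longlonglongrightarrow>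
        inverse (?d 1) * \<phi> (?w (2 * p * k) 0)"
      using ratios[of 1] d1 by (intro tendsto_mult tendsto_inverse tendsto_of_real lim) auto
    ultimately show ?thesis by (simp add: m_def field_simps)
  qed
  moreover have "\<Psi> = fps_const (?d 1) * moment_gf m"
    using d1 by (intro fps_ext) (simp add: \<Psi>_def moment_gf_def m_def)
  moreover have "\<Psi> = R oo (fps_X * (\<Prod>j\<in>{1..p + 1}. \<Psi> + fps_const (?d j)))"
  proof -
    have "cumulant_series (even_cumulant_dist (\<nu> l)) = C l" if "1 \<le> l" "l \<le> p" for l
      using \<phi>_power[of l] that by (simp add: C_def cumulant_series_even_cumulant_dist)
    from loop_series_equation[of "\<lambda>l. even_cumulant_dist (\<nu> l)", OF even_cumulant_dist_0 this]
    show ?thesis by (simp only: R_def Suc_eq_plus1)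
  qed
  ultimately show ?thesis
  proof (intro exI[of _ m] conjI allI iffI)
    fix \<psi>
    assume \<Psi>: "\<Psi> = fps_const (?d 1) * moment_gf m"
      "\<Psi> = R oo (fps_X * (\<Prod>j\<in>{1..p + 1}. \<Psi> + fps_const (?d j)))"
    show "fps_const (?d 1) * \<psi> = R oo fps_X * (\<Prod>j\<in>{1..p + 1}. fps_const (?d 1) * \<psi> + fps_const (?d j))"
      if "\<psi> = moment_gf m"
      using \<Psi>(2) unfolding \<Psi>(1) that .
    show "\<psi> = moment_gf m"
      if "fps_const (?d 1) * \<psi> = R oo fps_X * (\<Prod>j\<in>{1..p + 1}. fps_const (?d 1) * \<psi> + fps_const (?d j))"
      using loop_series_equation_unique[OF that \<Psi>(2)] d1 unfolding \<Psi>(1) by simp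
  qed
qed

end
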